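(* Let an ODE-PDE system with input $w(t)\in\mathbb{R}^{n_u}$ be given by parameters $\{A,A_0,A_1,A_2,B_1,B_2,B,B_x,C,C_{10},C_a,C_b,D,E,E_{10},E_a,E_b\}$, let $\mathcal{T},\mathcal{A},\mathcal{B},\mathcal{C},\mathcal{D}$ be the 4-PI operators constructed from these parameters by the conversion formulas in the context, and let $\gamma>0$. Then the following are equivalent. 1. For any $w\in L_2([0,\infty);\mathbb{R}^{n_u})$, any solution $\mathbf{v},z$ of the PIE defined by $\{\mathcal{T},\mathcal{A},\mathcal{B},\mathcal{C},\mathcal{D}\}$ with input $w$ and $\mathbf{v}(0)=0$ satisfies $\|z\|_{L_2}\le\gamma\|w\|_{L_2}$. 2. For any $w\in L_2([0,\infty);\mathbb{R}^{n_u})$, any solution $x,\mathbf{x},z$ of the ODE-PDE with input $w$ and $x(0)=0$, $\mathbf{x}(\cdot,0)=0$ satisfies $\|z\|_{L_2}\le\gamma\|w\|_{L_2}$.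
   Context: Fix $a<b$. $Z^{m,n}[a,b]:=\mathbb{R}^m\times L_2^n[a,b]$ with inner product $\langle (x_1,\mathbf{x}_2),(y_1,\mathbf{y}_2)\rangle_Z=x_1^Ty_1+\langle\mathbf{x}_2,\mathbf{y}_2\rangle_{L_2}$. $W_{2,k}$ is the space of $f\in L_2[a,b]$ with $\partial_s^jf\in L_2[a,b]$ for all $j\le k$. Subscripts $s$ denote $\partial_s$; dots denote $\partial_t$. The norms $\|z\|_{L_2},\|w\|_{L_2}$ are norms in $L_2([0,\infty))$. For matrix functions $R_0,R_1,R_2$, $(\mathcal{P}_{\{R_i\}}\mathbf{y})(s)=R_0(s)\mathbf{y}(s)+\int_a^sR_1(s,\theta)\mathbf{y}(\theta)d\theta+\int_s^bR_2(s,\theta)\mathbf{y}(\theta)d\theta$. **ODE-PDE system.** States $x(t)\in\mathbb{R}^{n_o}$ and $\mathbf{x}=(\mathbf{x}_1,\mathbf{x}_2,\mathbf{x}_3)$ with $\mathbf{x}_i(s,t)\in\mathbb{R}^{n_i}$; $n_p=n_1+n_2+n_3$; input $w(t)\in\mathbb{R}^{n_u}$; output $z(t)\in\mathbb{R}^{n_z}$; $\mathbf{x}_c=(\mathbf{x}_2,\mathbf{x}_3,\mathbf{x}_{3s})$; $n_r=n_2+2n_3$. Write $\mathbf{x}_b(t)=(\mathbf{x}_c(a,t),\mathbf{x}_c(b,t))\in\mathbb{R}^{2n_r}$. The equations are $$\dot x=Ax+E_{10}\mathbf{x}_b+\int_a^bE_a(s)\mathbf{x}(s,t)ds+\int_a^bE_b(s)\begin{bmatrix}\mathbf{x}_{2s}\\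 \mathbf{x}_{3s}\end{bmatrix}(s,t)ds+B_1w,$$ $$\dot{\mathbf{x}}(s,t)=E(s)x+A_0(s)\mathbf{x}(s,t)+A_1(s)\begin{bmatrix}\mathbf{x}_{2s}\\ \mathbf{x}_{3s}\end{bmatrix}(s,t)+A_2(s)\mathbf{x}_{3ss}(s,t)+B_2(s)w,$$ $$z=Cx+C_{10}\mathbf{x}_b+\int_a^bC_a(s)\mathbf{x}(s,t)ds+\int_a^bC_b(s)\begin{bmatrix}\mathbf{x}_{2s}\\ \mathbf{x}_{3s}\end{bmatrix}(s,t)ds+Dw,$$ $$B\,\mathbf{x}_b(t)=B_xx(t).$$ Here $A,B_1,B,B_x,C,C_{10},D,E_{10}$ are real matrices and $A_0,A_1,A_2,B_2,C_a,C_b,E,E_a,E_b$ are bounded integrable matrix functions on $[a,b]$, all of compatible sizes; $B\in\mathbb{R}^{n_r\times2n_r}$ has row rank $n_r$, and $BT$ (with $T$ below) is invertible. The domain $D(\mathcal{A}_d)$ is the set of $(x,\mathbf{x}_1,\mathbf{x}_2,\mathbf{x}_3)\in\mathbb{R}^{n_o}\times L_2^{n_1}\times W_{2,1}^{n_2}\times W_{2,2}^{n_3}$ satisfying $B(\mathbf{x}_c(a),\mathbf{x}_c(b))=B_xx$. Given $w$ and an initial condition in $D(\mathcal{A}_d)$, $x,\mathbf{x},z$ is a solution of the ODE-PDE if $x$ is differentiable and $\mathbf{x}:[0,\infty)\to L_2^{n_1}\times W_{2,1}^{n_2}\times W_{2,2}^{n_3}$ is Fréchet differentiable almost everywhere on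 $[0,\infty)$, the initial condition holds, $(x(t),\mathbf{x}(t))\in D(\mathcal{A}_d)$, and the equations hold for almost all $t\ge0$. **PIE.** The PIE defined by $\{\mathcal{T},\mathcal{A},\mathcal{B},\mathcal{C},\mathcal{D}\}$ with input $w$ is $\mathcal{T}\dot{\mathbf{v}}(t)=\mathcal{A}\mathbf{v}(t)+\mathcal{B}w(t)$, $z(t)=\mathcal{C}\mathbf{v}(t)+\mathcal{D}w(t)$. Given $w$ and $\mathbf{v}_0\in Z^{n_o,n_p}[a,b]$, $\mathbf{v},z$ is a solution if $\mathbf{v}:[0,\infty)\to Z^{n_o,n_p}[a,b]$ is Fréchet differentiable almost everywhere, $\mathbf{v}(0)=\mathbf{v}_0$, and the equations hold for almost all $t\ge0$. **Conversion formulas.** With blocks of compatible sizes, $$T=\begin{bmatrix} I & 0 & 0 \\ 0 & I & 0 \\ 0 & 0 & I \\ I & 0 & 0 \\ 0 & I & (b-a)I \\ 0 & 0 & I \end{bmatrix},\ Q(s,\theta)=\begin{bmatrix} 0 & 0 & 0 \\ 0 & 0 & 0 \\ 0 & 0 & 0 \\ 0 & I & 0 \\ 0 & 0 & (b-\theta)I \\ 0 & 0 & I \end{bmatrix},\ K(s)=\begin{bmatrix} 0 & 0 & 0 \\ I & 0 & 0 \\ 0 & I & (s-a)I \end{bmatrix},\ V(s)=\begin{bmatrix} 0 & 0 & 0 \\ 0 & 0 & I \end{bmatrix},$$ $H_0(s)=K(s)(BT)^{-1}B_x$, $H_1(s)=V(s)(BT)^{-1}B_x$, $T_1=T(BT)^{-1}B_x$,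 $T_2(s)=-T(BT)^{-1}BQ(a,s)+Q(a,s)$, $$G_0=\begin{bmatrix} I & 0 & 0 \\ 0 & 0 & 0 \\ 0 & 0 & 0 \end{bmatrix},\ G_2(s,\theta)=-K(s)(BT)^{-1}BQ(s,\theta),\ G_1(s,\theta)=\begin{bmatrix} 0 & 0 & 0 \\ 0 & I & 0 \\ 0 & 0 & (s-\theta)I \end{bmatrix}+G_2(s,\theta),$$ $$L_0=\begin{bmatrix} 0 & I & 0 \\ 0 & 0 & 0 \end{bmatrix},\ L_2(s,\theta)=-V(s)(BT)^{-1}BQ(s,\theta),\ L_1(s,\theta)=\begin{bmatrix} 0 & 0 & 0 \\ 0 & 0 & I \end{bmatrix}+L_2(s,\theta).$$ For $(x,\mathbf{y})\in Z^{n_o,n_p}[a,b]$ put $g=H_0x+\mathcal{P}_{\{G_i\}}\mathbf{y}$ and $\ell=H_1x+\mathcal{P}_{\{L_i\}}\mathbf{y}$. Then $$\mathcal{T}(x,\mathbf{y})=(x,\,g),\qquad \mathcal{B}w=(B_1w,\,B_2(\cdot)w),\qquad\mathcal{D}w=Dw,$$ $$\mathcal{A}(x,\mathbf{y})=\Big((A+E_{10}T_1)x+\int_a^b\big(E_{10}T_2\mathbf{y}+E_ag+E_b\ell\big)(s)ds,\;\;Ex+[0\ 0\ A_2]\mathbf{y}+A_0g+A_1\ell\Big),$$ $$\mathcal{C}(x,\mathbf{y})=(C+C_{10}T_1)x+\int_a^b\big(C_{10}T_2\mathbf{y}+C_ag+C_b\ell\big)(s)ds.$$ *)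

theory Defs
  imports
    "HOL-Analysis.Analysis"
    "Jordan_Normal_Form.Gauss_Jordan_Elimination"
    "Jordan_Normal_Form.DL_Rank"
begin

text \<open>
  Vectors and matrices are those of \<^theory>\<open>Jordan_Normal_Form.Matrix\<close>, whose sizes are natural
  numbers: every dimension below may be zero, as is usual for the state components
  \<open>x1\<close>, \<open>x2\<close>, \<open>x3\<close>.
\<close>

hide_type (open) Finite_Cartesian_Product.vec
hide_const (open) Finite_Cartesian_Product.vec Finite_Cartesian_Product.row
  Finite_Cartesian_Product.column Finite_Cartesian_Product.mat
unbundle no vec_syntax
unbundle no inner_syntax


section \<open>\<open>L\<^sub>2\<close> and Sobolev spaces\<close>

text \<open>
  Elements of \<open>L\<^sub>2\<close> are given by representatives; all notions below depend only on the class of a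
  function modulo equality almost everywhere.
\<close>

definition vnorm :: "real vec \<Rightarrow> real" where
  "vnorm x = sqrt (x \<bullet> x)"

definition L2 :: "real set \<Rightarrow> (real \<Rightarrow> real) set" where
  "L2 S = {f \<in> borel_measurable (lebesgue_on S). integrable (lebesgue_on S) (\<lambda>s. (f s)\<^sup>2)}"

definition L2v :: "real set \<Rightarrow> nat \<Rightarrow> (real \<Rightarrow> real vec) set" where
  "L2v S n = {f. (\<forall>s\<in>S. f s \<in> carrier_vec n) \<and> (\<forall>i<n. (\<lambda>s. f s $ i) \<in> L2 S)}"

definition L2_inner :: "real set \<Rightarrow> (real \<Rightarrow> real vec) \<Rightarrow> (real \<Rightarrow> real vec) \<Rightarrow> real" where
  "L2_inner S f g = (LINT s|lebesgue_on S. f s \<bullet> g s)"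

definition L2_norm :: "real set \<Rightarrow> (real \<Rightarrow> real vec) \<Rightarrow> real" where
  "L2_norm S f = sqrt (L2_inner S f f)"

definition vintegral :: "nat \<Rightarrow> real set \<Rightarrow> (real \<Rightarrow> real vec) \<Rightarrow> real vec" where
  "vintegral n S f = Matrix.vec n (\<lambda>i. LINT s|lebesgue_on S. f s $ i)"

text \<open>\<open>\<phi>\<close> is continuously differentiable with derivative \<open>\<phi>'\<close> and compactly supported in \<open>(a,b)\<close>.\<close>

definition test_function :: "real \<Rightarrow> real \<Rightarrow> (real \<Rightarrow> real) \<Rightarrow> (real \<Rightarrow> real) \<Rightarrow> bool" where
  "test_function a b \<phi> \<phi>' \<longleftrightarrow>
     (\<forall>s. (\<phi> has_real_derivative \<phi>' s) (at s)) \<and> continuous_on UNIV \<phi>' \<and>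
     (\<exists>c d. a < c \<and> d < b \<and> (\<forall>s. s \<notin> {c..d} \<longrightarrow> \<phi> s = 0))"

definition weak_deriv :: "real \<Rightarrow> real \<Rightarrow> (real \<Rightarrow> real) \<Rightarrow> (real \<Rightarrow> real) \<Rightarrow> bool" where
  "weak_deriv a b f g \<longleftrightarrow>
     (\<forall>\<phi> \<phi>'. test_function a b \<phi> \<phi>' \<longrightarrow>
        (LINT s|lebesgue_on {a..b}. f s * \<phi>' s) = - (LINT s|lebesgue_on {a..b}. g s * \<phi> s))"

primrec W2 :: "real \<Rightarrow> real \<Rightarrow> nat \<Rightarrow> (real \<Rightarrow> real) set" where
  "W2 a b 0 = L2 {a..b}"
| "W2 a b (Suc k) = {f \<in> L2 {a..b}. \<exists>g \<in> W2 a b k. weak_deriv a b f g}"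

definition W2v :: "real \<Rightarrow> real \<Rightarrow> nat \<Rightarrow> nat \<Rightarrow> (real \<Rightarrow> real vec) set" where
  "W2v a b k n =
     {f. (\<forall>s\<in>{a..b}. f s \<in> carrier_vec n) \<and> (\<forall>i<n. (\<lambda>s. f s $ i) \<in> W2 a b k)}"

text \<open>The weak derivative is unique up to equality almost everywhere.\<close>

definition wderiv :: "real \<Rightarrow> real \<Rightarrow> (real \<Rightarrow> real) \<Rightarrow> real \<Rightarrow> real" where
  "wderiv a b f = (SOME g. g \<in> L2 {a..b} \<and> weak_deriv a b f g)"

definition pds :: "real \<Rightarrow> real \<Rightarrow> nat \<Rightarrow> (real \<Rightarrow> real vec) \<Rightarrow> real \<Rightarrow> real vec" where
  "pds a b n f = (\<lambda>s. Matrix.vec n (\<lambda>i. wderiv a b (\<lambda>r. f r $ i) s))"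

definition W2_norm :: "real \<Rightarrow> real \<Rightarrow> nat \<Rightarrow> nat \<Rightarrow> (real \<Rightarrow> real vec) \<Rightarrow> real" where
  "W2_norm a b k n f = sqrt (\<Sum>j\<le>k. (L2_norm {a..b} ((pds a b n ^^ j) f))\<^sup>2)"

text \<open>
  The value at \<open>c \<in> [a,b]\<close> of an element of \<open>W\<^sub>2\<^sub>,\<^sub>1\<close> is that of its continuous representative.
\<close>

definition point_value :: "real \<Rightarrow> real \<Rightarrow> (real \<Rightarrow> real) \<Rightarrow> real \<Rightarrow> real" where
  "point_value a b f c =
     (THE y. \<exists>g. continuous_on {a..b} g \<and> (AE s in lebesgue_on {a..b}. f s = g s) \<and> y = g c)"

definition point_valuev ::
  "real \<Rightarrow> real \<Rightarrow> nat \<Rightarrow> (real \<Rightarrow> real vec) \<Rightarrow> real \<Rightarrow> real vec" where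
  "point_valuev a b n f c = Matrix.vec n (\<lambda>i. point_value a b (\<lambda>r. f r $ i) c)"


section \<open>Frechet derivatives of functions of time\<close>

text \<open>
  \<open>d\<close> is the derivative at \<open>t\<close> of \<open>u : [0,\<infinity>) \<rightarrow> X\<close>, that is, \<open>h \<mapsto> h d\<close> is its Frechet
  derivative, where \<open>X\<close> has norm \<open>N\<close>, subtraction \<open>sub\<close> and scalar multiplication \<open>sc\<close>.
\<close>

definition has_frechet_at ::
  "('x \<Rightarrow> real) \<Rightarrow> ('x \<Rightarrow> 'x \<Rightarrow> 'x) \<Rightarrow> (real \<Rightarrow> 'x \<Rightarrow> 'x) \<Rightarrow> (real \<Rightarrow> 'x) \<Rightarrow> 'x \<Rightarrow> real \<Rightarrow> bool" where
  "has_frechet_at N sub sc u d t \<longleftrightarrow>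
     ((\<lambda>r. N (sub (sub (u r) (u t)) (sc (r - t) d)) / \<bar>r - t\<bar>) \<longlongrightarrow> 0) (at t within {0..})"


section \<open>Partial integral equations\<close>

type_synonym zstate = "real vec \<times> (real \<Rightarrow> real vec)"

definition Z_space :: "real \<Rightarrow> real \<Rightarrow> nat \<Rightarrow> nat \<Rightarrow> zstate set" where
  "Z_space a b m n = carrier_vec m \<times> L2v {a..b} n"

definition Z_inner :: "real \<Rightarrow> real \<Rightarrow> zstate \<Rightarrow> zstate \<Rightarrow> real" where
  "Z_inner a b u v = fst u \<bullet> fst v + L2_inner {a..b} (snd u) (snd v)"

definition Z_norm :: "real \<Rightarrow> real \<Rightarrow> zstate \<Rightarrow> real" where
  "Z_norm a b u = sqrt (Z_inner a b u u)"

definition Z_add :: "zstate \<Rightarrow> zstate \<Rightarrow> zstate" where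
  "Z_add u v = (fst u + fst v, \<lambda>s. snd u s + snd v s)"

definition Z_sub :: "zstate \<Rightarrow> zstate \<Rightarrow> zstate" where
  "Z_sub u v = (fst u - fst v, \<lambda>s. snd u s - snd v s)"

definition Z_scale :: "real \<Rightarrow> zstate \<Rightarrow> zstate" where
  "Z_scale c u = (c \<cdot>\<^sub>v fst u, \<lambda>s. c \<cdot>\<^sub>v snd u s)"

definition Z_eq :: "real \<Rightarrow> real \<Rightarrow> zstate \<Rightarrow> zstate \<Rightarrow> bool" where
  "Z_eq a b u v \<longleftrightarrow> fst u = fst v \<and> (AE s in lebesgue_on {a..b}. snd u s = snd v s)"

definition Z_zero :: "nat \<Rightarrow> nat \<Rightarrow> zstate" where
  "Z_zero m n = (0\<^sub>v m, \<lambda>s. 0\<^sub>v n)"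

text \<open>The operator with parameters \<open>R0\<close>, \<open>R1\<close>, \<open>R2\<close>; \<open>n\<close> is the number of their rows.\<close>

definition PI_op :: "real \<Rightarrow> real \<Rightarrow> nat \<Rightarrow> (real \<Rightarrow> real mat) \<Rightarrow> (real \<Rightarrow> real \<Rightarrow> real mat) \<Rightarrow>
    (real \<Rightarrow> real \<Rightarrow> real mat) \<Rightarrow> (real \<Rightarrow> real vec) \<Rightarrow> real \<Rightarrow> real vec" where
  "PI_op a b n R0 R1 R2 y = (\<lambda>s. R0 s *\<^sub>v y s
     + vintegral n {a..s} (\<lambda>\<theta>. R1 s \<theta> *\<^sub>v y \<theta>)
     + vintegral n {s..b} (\<lambda>\<theta>. R2 s \<theta> *\<^sub>v y \<theta>))"

text \<open>
  \<open>v\<close>, \<open>z\<close> is a solution of the equation defined by \<open>\<T>\<close>, \<open>\<A>\<close>, \<open>\<B>\<close>, \<open>\<C>\<close>, \<open>\<D>\<close> with input \<open>w\<close> and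
  initial value \<open>v0\<close>; the state lies in \<open>Z_space a b m n\<close> and the output has \<open>q\<close> components.
\<close>

definition pie_solution :: "real \<Rightarrow> real \<Rightarrow> nat \<Rightarrow> nat \<Rightarrow> nat \<Rightarrow>
    (zstate \<Rightarrow> zstate) \<Rightarrow> (zstate \<Rightarrow> zstate) \<Rightarrow> (real vec \<Rightarrow> zstate) \<Rightarrow>
    (zstate \<Rightarrow> real vec) \<Rightarrow> (real vec \<Rightarrow> real vec) \<Rightarrow>
    (real \<Rightarrow> real vec) \<Rightarrow> zstate \<Rightarrow> (real \<Rightarrow> zstate) \<Rightarrow> (real \<Rightarrow> real vec) \<Rightarrow> bool" where
  "pie_solution a b m n q \<T> \<A> \<B> \<C> \<D> w v0 v z \<longleftrightarrow>
     (\<forall>t\<ge>0. v t \<in> Z_space a b m n \<and> z t \<in> carrier_vec q) \<and>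
     Z_eq a b (v 0) v0 \<and>
     (AE t in lebesgue_on {0..}. \<exists>d \<in> Z_space a b m n.
        has_frechet_at (Z_norm a b) Z_sub Z_scale v d t \<and>
        Z_eq a b (\<T> d) (Z_add (\<A> (v t)) (\<B> (w t))) \<and>
        z t = \<C> (v t) + \<D> (w t))"


section \<open>ODE-PDE systems\<close>

record odepde =
  pa :: real  pb :: real
  no :: nat  n1 :: nat  n2 :: nat  n3 :: nat  nu :: nat  nz :: nat
  pA :: "real mat"
  pA0 :: "real \<Rightarrow> real mat"
  pA1 :: "real \<Rightarrow> real mat"
  pA2 :: "real \<Rightarrow> real mat"
  pB1 :: "real mat"
  pB2 :: "real \<Rightarrow> real mat"
  pB :: "real mat"
  pBx :: "real mat"
  pC :: "real mat"
  pC10 :: "real mat"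
  pCa :: "real \<Rightarrow> real mat"
  pCb :: "real \<Rightarrow> real mat"
  pD :: "real mat"
  pE :: "real \<Rightarrow> real mat"
  pE10 :: "real mat"
  pEa :: "real \<Rightarrow> real mat"
  pEb :: "real \<Rightarrow> real mat"

definition np :: "odepde \<Rightarrow> nat" where "np P = n1 P + n2 P + n3 P"
definition nr :: "odepde \<Rightarrow> nat" where "nr P = n2 P + 2 * n3 P"

definition bdd_int_mat :: "real \<Rightarrow> real \<Rightarrow> nat \<Rightarrow> nat \<Rightarrow> (real \<Rightarrow> real mat) \<Rightarrow> bool" where
  "bdd_int_mat a b m n F \<longleftrightarrow>
     (\<forall>s\<in>{a..b}. F s \<in> carrier_mat m n) \<and>
     (\<forall>i<m. \<forall>j<n. integrable (lebesgue_on {a..b}) (\<lambda>s. F s $$ (i, j)) \<and>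
        (\<exists>M. \<forall>s\<in>{a..b}. \<bar>F s $$ (i, j)\<bar> \<le> M))"

text \<open>
  Block rows are joined by \<open>@\<^sub>r\<close> and block columns by \<open>@\<^sub>c\<close>. The block columns of \<open>T\<close>, \<open>K\<close>, \<open>V\<close>
  have sizes \<open>n2\<close>, \<open>n3\<close>, \<open>n3\<close>, those of \<open>Q\<close>, \<open>G0\<close>, \<open>G1\<close>, \<open>L0\<close>, \<open>L1\<close> have sizes \<open>n1\<close>, \<open>n2\<close>, \<open>n3\<close>.
\<close>

abbreviation append_cols :: "real mat \<Rightarrow> real mat \<Rightarrow> real mat" (infixr \<open>@\<^sub>c\<close> 66) where
  "X @\<^sub>c Y \<equiv> four_block_mat X Y (0\<^sub>m 0 (dim_col X)) (0\<^sub>m 0 (dim_col Y))"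

definition Tm :: "odepde \<Rightarrow> real mat" where
  "Tm P = (let k2 = n2 P; k3 = n3 P in
      (1\<^sub>m k2    @\<^sub>c 0\<^sub>m k2 k3 @\<^sub>c 0\<^sub>m k2 k3)
   @\<^sub>r (0\<^sub>m k3 k2 @\<^sub>c 1\<^sub>m k3    @\<^sub>c 0\<^sub>m k3 k3)
   @\<^sub>r (0\<^sub>m k3 k2 @\<^sub>c 0\<^sub>m k3 k3 @\<^sub>c 1\<^sub>m k3)
   @\<^sub>r (1\<^sub>m k2    @\<^sub>c 0\<^sub>m k2 k3 @\<^sub>c 0\<^sub>m k2 k3)
   @\<^sub>r (0\<^sub>m k3 k2 @\<^sub>c 1\<^sub>m k3    @\<^sub>c (pb P - pa P) \<cdot>\<^sub>m 1\<^sub>m k3)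
   @\<^sub>r (0\<^sub>m k3 k2 @\<^sub>c 0\<^sub>m k3 k3 @\<^sub>c 1\<^sub>m k3))"

definition Qm :: "odepde \<Rightarrow> real \<Rightarrow> real \<Rightarrow> real mat" where
  "Qm P s \<theta> = (let k1 = n1 P; k2 = n2 P; k3 = n3 P in
      (0\<^sub>m k2 k1 @\<^sub>c 0\<^sub>m k2 k2 @\<^sub>c 0\<^sub>m k2 k3)
   @\<^sub>r (0\<^sub>m k3 k1 @\<^sub>c 0\<^sub>m k3 k2 @\<^sub>c 0\<^sub>m k3 k3)
   @\<^sub>r (0\<^sub>m k3 k1 @\<^sub>c 0\<^sub>m k3 k2 @\<^sub>c 0\<^sub>m k3 k3)
   @\<^sub>r (0\<^sub>m k2 k1 @\<^sub>c 1\<^sub>m k2    @\<^sub>c 0\<^sub>m k2 k3)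
   @\<^sub>r (0\<^sub>m k3 k1 @\<^sub>c 0\<^sub>m k3 k2 @\<^sub>c (pb P - \<theta>) \<cdot>\<^sub>m 1\<^sub>m k3)
   @\<^sub>r (0\<^sub>m k3 k1 @\<^sub>c 0\<^sub>m k3 k2 @\<^sub>c 1\<^sub>m k3))"

definition Km :: "odepde \<Rightarrow> real \<Rightarrow> real mat" where
  "Km P s = (let k1 = n1 P; k2 = n2 P; k3 = n3 P in
      (0\<^sub>m k1 k2 @\<^sub>c 0\<^sub>m k1 k3 @\<^sub>c 0\<^sub>m k1 k3)
   @\<^sub>r (1\<^sub>m k2    @\<^sub>c 0\<^sub>m k2 k3 @\<^sub>c 0\<^sub>m k2 k3)
   @\<^sub>r (0\<^sub>m k3 k2 @\<^sub>c 1\<^sub>m k3    @\<^sub>c (s - pa P) \<cdot>\<^sub>m 1\<^sub>m k3))"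

definition Vm :: "odepde \<Rightarrow> real \<Rightarrow> real mat" where
  "Vm P s = (let k2 = n2 P; k3 = n3 P in
      (0\<^sub>m k2 k2 @\<^sub>c 0\<^sub>m k2 k3 @\<^sub>c 0\<^sub>m k2 k3)
   @\<^sub>r (0\<^sub>m k3 k2 @\<^sub>c 0\<^sub>m k3 k3 @\<^sub>c 1\<^sub>m k3))"

definition BTinv :: "odepde \<Rightarrow> real mat" where
  "BTinv P = the (mat_inverse (pB P * Tm P))"

definition H0 :: "odepde \<Rightarrow> real \<Rightarrow> real mat" where
  "H0 P s = Km P s * BTinv P * pBx P"

definition H1 :: "odepde \<Rightarrow> real \<Rightarrow> real mat" where
  "H1 P s = Vm P s * BTinv P * pBx P"

definition T1 :: "odepde \<Rightarrow> real mat" where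
  "T1 P = Tm P * BTinv P * pBx P"

definition T2 :: "odepde \<Rightarrow> real \<Rightarrow> real mat" where
  "T2 P s = - (Tm P * BTinv P * pB P * Qm P (pa P) s) + Qm P (pa P) s"

definition G0 :: "odepde \<Rightarrow> real mat" where
  "G0 P = (let k1 = n1 P; k2 = n2 P; k3 = n3 P in
      (1\<^sub>m k1    @\<^sub>c 0\<^sub>m k1 k2 @\<^sub>c 0\<^sub>m k1 k3)
   @\<^sub>r (0\<^sub>m k2 k1 @\<^sub>c 0\<^sub>m k2 k2 @\<^sub>c 0\<^sub>m k2 k3)
   @\<^sub>r (0\<^sub>m k3 k1 @\<^sub>c 0\<^sub>m k3 k2 @\<^sub>c 0\<^sub>m k3 k3))"

definition G2 :: "odepde \<Rightarrow> real \<Rightarrow> real \<Rightarrow> real mat" where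
  "G2 P s \<theta> = - (Km P s * BTinv P * pB P * Qm P s \<theta>)"

definition G1 :: "odepde \<Rightarrow> real \<Rightarrow> real \<Rightarrow> real mat" where
  "G1 P s \<theta> = (let k1 = n1 P; k2 = n2 P; k3 = n3 P in
      (0\<^sub>m k1 k1 @\<^sub>c 0\<^sub>m k1 k2 @\<^sub>c 0\<^sub>m k1 k3)
   @\<^sub>r (0\<^sub>m k2 k1 @\<^sub>c 1\<^sub>m k2    @\<^sub>c 0\<^sub>m k2 k3)
   @\<^sub>r (0\<^sub>m k3 k1 @\<^sub>c 0\<^sub>m k3 k2 @\<^sub>c (s - \<theta>) \<cdot>\<^sub>m 1\<^sub>m k3)) + G2 P s \<theta>"

definition L0m :: "odepde \<Rightarrow> real mat" where
  "L0m P = (let k1 = n1 P; k2 = n2 P; k3 = n3 P in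
      (0\<^sub>m k2 k1 @\<^sub>c 1\<^sub>m k2    @\<^sub>c 0\<^sub>m k2 k3)
   @\<^sub>r (0\<^sub>m k3 k1 @\<^sub>c 0\<^sub>m k3 k2 @\<^sub>c 0\<^sub>m k3 k3))"

definition L2m :: "odepde \<Rightarrow> real \<Rightarrow> real \<Rightarrow> real mat" where
  "L2m P s \<theta> = - (Vm P s * BTinv P * pB P * Qm P s \<theta>)"

definition L1m :: "odepde \<Rightarrow> real \<Rightarrow> real \<Rightarrow> real mat" where
  "L1m P s \<theta> = (let k1 = n1 P; k2 = n2 P; k3 = n3 P in
      (0\<^sub>m k2 k1 @\<^sub>c 0\<^sub>m k2 k2 @\<^sub>c 0\<^sub>m k2 k3)
   @\<^sub>r (0\<^sub>m k3 k1 @\<^sub>c 0\<^sub>m k3 k2 @\<^sub>c 1\<^sub>m k3)) + L2m P s \<theta>"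

text \<open>
  The row rank of \<open>B\<close> is written as the column rank of its transpose.
\<close>

definition odepde_params :: "odepde \<Rightarrow> bool" where
  "odepde_params P \<longleftrightarrow>
     (let a = pa P; b = pb P in
      a < b \<and>
      pA P \<in> carrier_mat (no P) (no P) \<and>
      pB1 P \<in> carrier_mat (no P) (nu P) \<and>
      pB P \<in> carrier_mat (nr P) (2 * nr P) \<and>
      pBx P \<in> carrier_mat (nr P) (no P) \<and>
      pC P \<in> carrier_mat (nz P) (no P) \<and>
      pC10 P \<in> carrier_mat (nz P) (2 * nr P) \<and>
      pD P \<in> carrier_mat (nz P) (nu P) \<and>
      pE10 P \<in> carrier_mat (no P) (2 * nr P) \<and>
      bdd_int_mat a b (np P) (np P) (pA0 P) \<and>
      bdd_int_mat a b (np P) (n2 P + n3 P) (pA1 P) \<and>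
      bdd_int_mat a b (np P) (n3 P) (pA2 P) \<and>
      bdd_int_mat a b (np P) (nu P) (pB2 P) \<and>
      bdd_int_mat a b (nz P) (np P) (pCa P) \<and>
      bdd_int_mat a b (nz P) (n2 P + n3 P) (pCb P) \<and>
      bdd_int_mat a b (np P) (no P) (pE P) \<and>
      bdd_int_mat a b (no P) (np P) (pEa P) \<and>
      bdd_int_mat a b (no P) (n2 P + n3 P) (pEb P) \<and>
      vec_space.rank (2 * nr P) (transpose_mat (pB P)) = nr P \<and>
      invertible_mat (pB P * Tm P))"

type_synonym pstate = "(real \<Rightarrow> real vec) \<times> (real \<Rightarrow> real vec) \<times> (real \<Rightarrow> real vec)"

definition X_space :: "odepde \<Rightarrow> pstate set" where
  "X_space P = L2v {pa P..pb P} (n1 P) \<times> W2v (pa P) (pb P) 1 (n2 P) \<times> W2v (pa P) (pb P) 2 (n3 P)"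

fun X_norm :: "odepde \<Rightarrow> pstate \<Rightarrow> real" where
  "X_norm P (x1, x2, x3) =
     sqrt ((L2_norm {pa P..pb P} x1)\<^sup>2 + (W2_norm (pa P) (pb P) 1 (n2 P) x2)\<^sup>2
       + (W2_norm (pa P) (pb P) 2 (n3 P) x3)\<^sup>2)"

fun X_sub :: "pstate \<Rightarrow> pstate \<Rightarrow> pstate" where
  "X_sub (x1, x2, x3) (y1, y2, y3) = (\<lambda>s. x1 s - y1 s, \<lambda>s. x2 s - y2 s, \<lambda>s. x3 s - y3 s)"

fun X_scale :: "real \<Rightarrow> pstate \<Rightarrow> pstate" where
  "X_scale c (x1, x2, x3) = (\<lambda>s. c \<cdot>\<^sub>v x1 s, \<lambda>s. c \<cdot>\<^sub>v x2 s, \<lambda>s. c \<cdot>\<^sub>v x3 s)"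

definition X_zero :: "odepde \<Rightarrow> pstate" where
  "X_zero P = (\<lambda>s. 0\<^sub>v (n1 P), \<lambda>s. 0\<^sub>v (n2 P), \<lambda>s. 0\<^sub>v (n3 P))"

fun stack :: "pstate \<Rightarrow> real \<Rightarrow> real vec" where
  "stack (x1, x2, x3) s = x1 s @\<^sub>v x2 s @\<^sub>v x3 s"

fun stack_s :: "odepde \<Rightarrow> pstate \<Rightarrow> real \<Rightarrow> real vec" where
  "stack_s P (x1, x2, x3) s = pds (pa P) (pb P) (n2 P) x2 s @\<^sub>v pds (pa P) (pb P) (n3 P) x3 s"

fun x3_ss :: "odepde \<Rightarrow> pstate \<Rightarrow> real \<Rightarrow> real vec" where
  "x3_ss P (x1, x2, x3) = (pds (pa P) (pb P) (n3 P) ^^ 2) x3"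

fun x_c :: "odepde \<Rightarrow> pstate \<Rightarrow> real \<Rightarrow> real vec" where
  "x_c P (x1, x2, x3) c =
     point_valuev (pa P) (pb P) (n2 P) x2 c @\<^sub>v
     point_valuev (pa P) (pb P) (n3 P) x3 c @\<^sub>v
     point_valuev (pa P) (pb P) (n3 P) (pds (pa P) (pb P) (n3 P) x3) c"

definition x_b :: "odepde \<Rightarrow> pstate \<Rightarrow> real vec" where
  "x_b P X = x_c P X (pa P) @\<^sub>v x_c P X (pb P)"

definition odepde_domain :: "odepde \<Rightarrow> (real vec \<times> pstate) set" where
  "odepde_domain P =
     {(x, X). x \<in> carrier_vec (no P) \<and> X \<in> X_space P \<and> pB P *\<^sub>v x_b P X = pBx P *\<^sub>v x}"

definition X_eq :: "odepde \<Rightarrow> pstate \<Rightarrow> pstate \<Rightarrow> bool" where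
  "X_eq P X Y \<longleftrightarrow> (AE s in lebesgue_on {pa P..pb P}. stack X s = stack Y s)"

text \<open>
  The equations at one time instant: \<open>w\<close>, \<open>x\<close>, \<open>X\<close>, \<open>z\<close> are the values of input, states and output
  and \<open>xd\<close>, \<open>Xd\<close> the time derivatives of the states.
\<close>

definition odepde_equations :: "odepde \<Rightarrow> real vec \<Rightarrow> real vec \<Rightarrow> pstate \<Rightarrow> real vec \<Rightarrow>
    real vec \<Rightarrow> pstate \<Rightarrow> bool" where
  "odepde_equations P w x X z xd Xd \<longleftrightarrow>
     (let I = {pa P..pb P} in
      xd = pA P *\<^sub>v x + pE10 P *\<^sub>v x_b P X
         + vintegral (no P) I (\<lambda>s. pEa P s *\<^sub>v stack X s)
         + vintegral (no P) I (\<lambda>s. pEb P s *\<^sub>v stack_s P X s)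
         + pB1 P *\<^sub>v w \<and>
      (AE s in lebesgue_on I.
         stack Xd s = pE P s *\<^sub>v x + pA0 P s *\<^sub>v stack X s + pA1 P s *\<^sub>v stack_s P X s
           + pA2 P s *\<^sub>v x3_ss P X s + pB2 P s *\<^sub>v w) \<and>
      z = pC P *\<^sub>v x + pC10 P *\<^sub>v x_b P X
         + vintegral (nz P) I (\<lambda>s. pCa P s *\<^sub>v stack X s)
         + vintegral (nz P) I (\<lambda>s. pCb P s *\<^sub>v stack_s P X s)
         + pD P *\<^sub>v w \<and>
      pB P *\<^sub>v x_b P X = pBx P *\<^sub>v x)"

text \<open>
  Differentiability, membership in the domain and the equations are all required for almost all
  \<open>t \<ge> 0\<close>. The PDE state is differentiable with respect to the norm of
  \<open>L\<^sub>2 \<times> W\<^sub>2\<^sub>,\<^sub>1 \<times> W\<^sub>2\<^sub>,\<^sub>2\<close>.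
\<close>

definition odepde_solution :: "odepde \<Rightarrow> (real \<Rightarrow> real vec) \<Rightarrow> real vec \<Rightarrow> pstate \<Rightarrow>
    (real \<Rightarrow> real vec) \<Rightarrow> (real \<Rightarrow> pstate) \<Rightarrow> (real \<Rightarrow> real vec) \<Rightarrow> bool" where
  "odepde_solution P w x0 X0 x X z \<longleftrightarrow>
     (\<forall>t\<ge>0. x t \<in> carrier_vec (no P) \<and> X t \<in> X_space P \<and> z t \<in> carrier_vec (nz P)) \<and>
     x 0 = x0 \<and> X_eq P (X 0) X0 \<and>
     (AE t in lebesgue_on {0..}. (x t, X t) \<in> odepde_domain P) \<and>
     (AE t in lebesgue_on {0..}. \<exists>xd \<in> carrier_vec (no P). \<exists>Xd \<in> X_space P.
        has_frechet_at vnorm (-) (\<cdot>\<^sub>v) x xd t \<and>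
        has_frechet_at (X_norm P) X_sub X_scale X Xd t \<and>
        odepde_equations P (w t) (x t) (X t) (z t) xd Xd)"


section \<open>The partial integral equation of an ODE-PDE system\<close>

definition G_op :: "odepde \<Rightarrow> zstate \<Rightarrow> real \<Rightarrow> real vec" where
  "G_op P u s = H0 P s *\<^sub>v fst u
     + PI_op (pa P) (pb P) (np P) (\<lambda>_. G0 P) (G1 P) (G2 P) (snd u) s"

definition L_op :: "odepde \<Rightarrow> zstate \<Rightarrow> real \<Rightarrow> real vec" where
  "L_op P u s = H1 P s *\<^sub>v fst u
     + PI_op (pa P) (pb P) (n2 P + n3 P) (\<lambda>_. L0m P) (L1m P) (L2m P) (snd u) s"

definition T_op :: "odepde \<Rightarrow> zstate \<Rightarrow> zstate" where
  "T_op P u = (fst u, G_op P u)"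

definition A_op :: "odepde \<Rightarrow> zstate \<Rightarrow> zstate" where
  "A_op P u =
     ((pA P + pE10 P * T1 P) *\<^sub>v fst u
        + vintegral (no P) {pa P..pb P} (\<lambda>s. pE10 P *\<^sub>v (T2 P s *\<^sub>v snd u s)
            + pEa P s *\<^sub>v G_op P u s + pEb P s *\<^sub>v L_op P u s),
      \<lambda>s. pE P s *\<^sub>v fst u
        + (0\<^sub>m (np P) (n1 P) @\<^sub>c 0\<^sub>m (np P) (n2 P) @\<^sub>c pA2 P s) *\<^sub>v snd u s
        + pA0 P s *\<^sub>v G_op P u s + pA1 P s *\<^sub>v L_op P u s)"

definition B_op :: "odepde \<Rightarrow> real vec \<Rightarrow> zstate" where
  "B_op P w = (pB1 P *\<^sub>v w, \<lambda>s. pB2 P s *\<^sub>v w)"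

definition C_op :: "odepde \<Rightarrow> zstate \<Rightarrow> real vec" where
  "C_op P u = (pC P + pC10 P * T1 P) *\<^sub>v fst u
     + vintegral (nz P) {pa P..pb P} (\<lambda>s. pC10 P *\<^sub>v (T2 P s *\<^sub>v snd u s)
         + pCa P s *\<^sub>v G_op P u s + pCb P s *\<^sub>v L_op P u s)"

definition D_op :: "odepde \<Rightarrow> real vec \<Rightarrow> real vec" where
  "D_op P w = pD P *\<^sub>v w"

end

theory Submission
  imports Defs
begin

text \<open>
  The operator \<open>\<T>\<close> is the inverse of the map that sends a state \<open>(x, x1, x2, x3)\<close> satisfying the
  boundary condition to its fundamental state \<open>(x, x1, \<partial>\<^sub>s x2, \<partial>\<^sub>s\<^sup>2 x3)\<close>. Indeed \<open>x2\<close>, \<open>x3\<close> and \<open>\<partial>\<^sub>s x3\<close>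
  are recovered by integration from the fundamental state and the boundary values
  \<open>c = (x2(a), x3(a), \<partial>\<^sub>s x3(a))\<close>, so that the vector of all boundary values is \<open>T c\<close> plus an integral
  of the fundamental state; since \<open>B T\<close> is invertible, the boundary condition determines \<open>c\<close>.
  Both directions are linear and bounded, hence Frechet derivatives in time are mapped to each other, and
  under the correspondence the two sets of equations coincide. Thus every solution of one system gives
  a solution of the other with the same input and output.
\<close>


section \<open>The fundamental lemma of the calculus of variations\<close>

lemma AE_zero_if_interval_integrals_zero_lborel:
  fixes g :: "real \<Rightarrow> real"
  assumes g: "integrable lborel g"
    and zero: "\<And>c d. c \<le> d \<Longrightarrow> (LINT x:{c..d}|lborel. g x) = 0"
  shows "AE x in lborel. g x = 0"
proof -
  have set_int: "set_integrable lborel A g" if "A \<in> sets borel" for A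
    unfolding set_integrable_def using that by (intro integrable_mult_indicator g) auto
  have total: "(LINT x|lborel. g x) = 0"
  proof (rule LIMSEQ_unique)
    show "(\<lambda>n::nat. LINT x:{- real n..real n}|lborel. g x) \<longlonglongrightarrow> 0"
      by (simp add: zero)
    show "(\<lambda>n::nat. LINT x:{- real n..real n}|lborel. g x) \<longlonglongrightarrow> (LINT x|lborel. g x)"
      unfolding set_lebesgue_integral_def
    proof (rule integral_dominated_convergence[where w = "\<lambda>x. \<bar>g x\<bar>"])
      show "AE x in lborel. (\<lambda>n::nat. indicator {- real n..real n} x *\<^sub>R g x) \<longlonglongrightarrow> g x"
      proof (intro AE_I2 tendsto_eventually)
        fix x :: real
        obtain N :: nat where "\<bar>x\<bar> \<le> real N"
          using real_arch_simple by blast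
        then show "\<forall>\<^sub>F n::nat in sequentially. indicator {- real n..real n} x *\<^sub>R g x = g x"
          by (intro eventually_sequentiallyI[of N]) (auto simp: indicator_def)
      qed
    qed (use g in \<open>auto simp: indicator_def\<close>)
  qed
  have "(LINT x:A|lborel. g x) = 0" if "A \<in> sets borel" for A
    using that
  proof (induction A rule: borel_set_induct)
    case empty
    show ?case by (simp add: set_lebesgue_integral_def)
  next
    case (interval c d)
    then show ?case by (rule zero)
  next
    case (compl A)
    have "(LINT x:A \<union> - A|lborel. g x) = (LINT x:A|lborel. g x) + (LINT x:- A|lborel. g x)"
      using compl by (intro set_integral_Un set_int) auto
    then show ?case
      using compl total by (simp add: set_lebesgue_integral_def)
  next
    case (union f)
    have "(LINT x:(\<Union>i. f i)|lborel. g x) = (\<Sum>i. LINT x:f i|lborel. g x)"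
      using union by (intro lebesgue_integral_countable_add set_int) (auto simp: disjoint_family_on_def)
    then show ?case using union by simp
  qed
  then show ?thesis
    using g by (intro sigma_finite_measure.density_zero[OF sigma_finite_lborel]) auto
qed

lemma AE_zero_if_interval_integrals_zero:
  fixes f :: "real \<Rightarrow> real"
  assumes f: "integrable (lebesgue_on {a..b}) f"
    and zero: "\<And>c d. a \<le> c \<Longrightarrow> c \<le> d \<Longrightarrow> d \<le> b \<Longrightarrow> (LINT x|lebesgue_on {c..d}. f x) = 0"
  shows "AE x in lebesgue_on {a..b}. f x = 0"
proof -
  define h where "h = (\<lambda>x. if x \<in> {a..b} then f x else 0)"
  have h: "integrable lebesgue h"
    unfolding h_def using f Lebesgue_Measure.integrable_restrict_UNIV[of "{a..b}" f] by simp
  then obtain g where g: "g \<in> borel_measurable lborel" and hg: "AE x in lborel. h x = g x"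
    using completion_ex_borel_measurable_real[of h lborel] by blast
  have hg': "AE x in lebesgue. h x = g x"
    using hg by (rule AE_completion)
  have gm: "g \<in> borel_measurable lebesgue"
    using g by (auto intro: measurable_completion)
  have "integrable lebesgue g"
    using h gm hg' integrable_cong_AE[of g lebesgue h] by (metis (mono_tags, lifting) AE_mp AE_I2 borel_measurable_integrable)
  then have gi: "integrable lborel g"
    using g integrable_completion by blast
  have "AE x in lborel. g x = 0"
  proof (rule AE_zero_if_interval_integrals_zero_lborel[OF gi])
    fix c d :: real assume "c \<le> d"
    have "(LINT x:{c..d}|lborel. g x) = (LINT x|lebesgue. indicator {c..d} x *\<^sub>R g x)"
      unfolding set_lebesgue_integral_def using g by (intro integral_completion[symmetric]) simp
    also have "\<dots> = (LINT x|lebesgue. indicator {c..d} x *\<^sub>R h x)"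
    proof (rule integral_cong_AE)
      show "AE x in lebesgue. indicat_real {c..d} x *\<^sub>R g x = indicat_real {c..d} x *\<^sub>R h x"
        using hg' by eventually_elim simp
    qed (use gm borel_measurable_integrable[OF h] in
        \<open>auto intro!: borel_measurable_times borel_measurable_indicator\<close>)
    also have "\<dots> = (LINT x|lebesgue. indicator {max a c..min b d} x *\<^sub>R f x)"
      by (intro Bochner_Integration.integral_cong) (auto simp: h_def indicator_def)
    also have "\<dots> = (LINT x|lebesgue_on {max a c..min b d}. f x)"
      by (subst integral_restrict_space) auto
    also have "\<dots> = 0"
    proof (cases "max a c \<le> min b d")
      case True
      then show ?thesis by (intro zero) auto
    next
      case False
      then show ?thesis by (simp add: integral_lebesgue_on_empty)
    qed
    finally show "(LINT x:{c..d}|lborel. g x) = 0" .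
  qed
  then have "AE x in lebesgue. g x = 0"
    by (rule AE_completion)
  with hg' have "AE x in lebesgue. h x = 0"
    by eventually_elim simp
  then have "AE x in lebesgue_on {a..b}. h x = 0"
    by (subst AE_restrict_space_iff) auto
  then show ?thesis
    by (rule lebesgue_on_mono) (simp add: h_def)
qed

lemma finite_measure_lebesgue_on_Icc: "finite_measure (lebesgue_on {a..b::real})"
  by (intro finite_measure_lebesgue_on) auto

lemma integrable_mult_bounded:
  fixes f g :: "real \<Rightarrow> real"
  assumes f: "integrable M f" and g: "g \<in> borel_measurable M"
    and bd: "\<And>x. x \<in> space M \<Longrightarrow> \<bar>g x\<bar> \<le> B"
  shows "integrable M (\<lambda>x. g x * f x)"
proof (rule Bochner_Integration.integrable_bound[of M "\<lambda>x. B * f x"])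
  show "AE x in M. norm (g x * f x) \<le> norm (B * f x)"
  proof (rule AE_I2)
    fix x assume "x \<in> space M"
    then have "\<bar>g x\<bar> \<le> \<bar>B\<bar>" using bd by fastforce
    then show "norm (g x * f x) \<le> norm (B * f x)"
      by (simp add: abs_mult mult_right_mono)
  qed
qed (use f g in auto)

lemma continuous_mult_integrable:
  fixes f \<phi> :: "real \<Rightarrow> real"
  assumes f: "integrable (lebesgue_on {a..b}) f" and \<phi>: "continuous_on {a..b} \<phi>"
  shows "integrable (lebesgue_on {a..b}) (\<lambda>s. \<phi> s * f s)"
proof -
  have "bounded (\<phi> ` {a..b})"
    using \<phi> by (intro compact_imp_bounded compact_continuous_image) auto
  then obtain B where "\<bar>\<phi> x\<bar> \<le> B" if "x \<in> {a..b}" for x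
    by (metis bounded_iff image_eqI real_norm_def)
  then show ?thesis
    using f \<phi> by (intro integrable_mult_bounded[where B = B] continuous_imp_measurable_on_sets_lebesgue) auto
qed

lemma integral_derivative_lebesgue:
  fixes \<phi> \<phi>' :: "real \<Rightarrow> real"
  assumes "c \<le> d" and "\<And>s. (\<phi> has_real_derivative \<phi>' s) (at s)" and "continuous_on UNIV \<phi>'"
  shows "(LINT s|lebesgue_on {c..d}. \<phi>' s) = \<phi> d - \<phi> c"
proof -
  have "(\<phi>' has_integral (\<phi> d - \<phi> c)) {c..d}"
    using assms by (intro fundamental_theorem_of_calculus)
      (auto simp flip: has_real_derivative_iff_has_vector_derivative intro: has_field_derivative_at_within)
  moreover have "integrable (lebesgue_on {c..d}) \<phi>'"
    using assms by (intro continuous_imp_integrable_real continuous_on_subset[OF assms(3)]) auto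
  ultimately show ?thesis
    by (simp add: lebesgue_integral_eq_integral integral_unique)
qed

lemma integral_by_parts_indefinite:
  fixes g \<phi> \<phi>' :: "real \<Rightarrow> real"
  assumes g: "integrable (lebesgue_on {a..b}) g" and ab: "a \<le> b"
    and d: "\<And>s. (\<phi> has_real_derivative \<phi>' s) (at s)" and c: "continuous_on UNIV \<phi>'"
  shows "(LINT s|lebesgue_on {a..b}. (LINT \<theta>|lebesgue_on {a..s}. g \<theta>) * \<phi>' s)
       = (LINT \<theta>|lebesgue_on {a..b}. (\<phi> b - \<phi> \<theta>) * g \<theta>)"
proof -
  let ?M = "lebesgue_on {a..b}"
  interpret M: finite_measure ?M by (rule finite_measure_lebesgue_on_Icc)
  interpret pair_sigma_finite ?M ?M ..
  have \<phi>'i: "integrable ?M \<phi>'"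
    using c by (intro continuous_imp_integrable_real continuous_on_subset[OF c]) auto
  have sub: "(LINT s|lebesgue_on {p..q}. h s) = (LINT s|?M. indicator {p..q} s * h s)"
    if "{p..q} \<subseteq> {a..b}" for p q and h :: "real \<Rightarrow> real"
  proof -
    have "(LINT s|lebesgue_on {p..q}. h s) = (LINT s|?M. (if s \<in> {p..q} then h s else 0))"
      using that by (subst integral_restrict) auto
    also have "\<dots> = (LINT s|?M. indicator {p..q} s * h s)"
      by (intro Bochner_Integration.integral_cong) (auto simp: indicator_def)
    finally show ?thesis .
  qed
  (* Fubini on the triangle theta <= s *)
  define F where "F s \<theta> = (if \<theta> \<le> s then 1 else 0) * (\<phi>' s * g \<theta>)" for s \<theta>
  have idm: "(\<lambda>x. x) \<in> ?M \<rightarrow>\<^sub>M borel"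
    by (intro measurable_restrict_space1 measurable_completion) auto
  have pr: "integrable (?M \<Otimes>\<^sub>M ?M) (\<lambda>(s, \<theta>). \<phi>' s * g \<theta>)"
  proof (rule Fubini_integrable)
    show "(\<lambda>(s, \<theta>). \<phi>' s * g \<theta>) \<in> borel_measurable (?M \<Otimes>\<^sub>M ?M)"
      using borel_measurable_integrable[OF \<phi>'i] borel_measurable_integrable[OF g] by measurable
    show "integrable ?M (\<lambda>x. \<integral>y. norm (case (x, y) of (s, \<theta>) \<Rightarrow> \<phi>' s * g \<theta>) \<partial>?M)"
      using \<phi>'i by (simp add: abs_mult)
    show "AE x in ?M. integrable ?M (\<lambda>y. case (x, y) of (s, \<theta>) \<Rightarrow> \<phi>' s * g \<theta>)"
      using g by simp
  qed
  have F: "integrable (?M \<Otimes>\<^sub>M ?M) (case_prod F)"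
  proof (rule Bochner_Integration.integrable_bound[OF pr])
    have "Measurable.pred (?M \<Otimes>\<^sub>M ?M) (\<lambda>p. snd p \<le> fst p)"
    proof -
      have "fst \<in> borel_measurable (?M \<Otimes>\<^sub>M ?M)" "snd \<in> borel_measurable (?M \<Otimes>\<^sub>M ?M)"
        using measurable_compose[OF measurable_fst idm] measurable_compose[OF measurable_snd idm]
        by auto
      then show ?thesis by measurable
    qed
    then show "case_prod F \<in> borel_measurable (?M \<Otimes>\<^sub>M ?M)"
      using borel_measurable_integrable[OF pr] unfolding F_def case_prod_beta by measurable
  qed (auto simp: F_def)
  have "(LINT s|?M. (LINT \<theta>|lebesgue_on {a..s}. g \<theta>) * \<phi>' s) = (LINT s|?M. LINT \<theta>|?M. F s \<theta>)"
  proof (rule Bochner_Integration.integral_cong)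
    fix s assume s: "s \<in> space ?M"
    then have "(LINT \<theta>|lebesgue_on {a..s}. g \<theta>) * \<phi>' s = \<phi>' s * (LINT \<theta>|?M. indicator {a..s} \<theta> * g \<theta>)"
      by (subst sub) auto
    also have "\<dots> = (LINT \<theta>|?M. \<phi>' s * (indicator {a..s} \<theta> * g \<theta>))"
      by simp
    also have "\<dots> = (LINT \<theta>|?M. F s \<theta>)"
      by (intro Bochner_Integration.integral_cong) (auto simp: F_def indicator_def)
    finally show "(LINT \<theta>|lebesgue_on {a..s}. g \<theta>) * \<phi>' s = (LINT \<theta>|?M. F s \<theta>)" .
  qed simp
  also have "\<dots> = (LINT \<theta>|?M. LINT s|?M. F s \<theta>)"
    by (rule Fubini_integral[OF F, symmetric])
  also have "\<dots> = (LINT \<theta>|?M. (\<phi> b - \<phi> \<theta>) * g \<theta>)"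
  proof (rule Bochner_Integration.integral_cong)
    fix \<theta> assume \<theta>: "\<theta> \<in> space ?M"
    have "(LINT s|?M. F s \<theta>) = (LINT s|?M. g \<theta> * (indicator {\<theta>..b} s * \<phi>' s))"
      by (intro Bochner_Integration.integral_cong) (auto simp: F_def indicator_def)
    also have "\<dots> = g \<theta> * (LINT s|lebesgue_on {\<theta>..b}. \<phi>' s)"
      using \<theta> by (subst sub) auto
    also have "(LINT s|lebesgue_on {\<theta>..b}. \<phi>' s) = \<phi> b - \<phi> \<theta>"
      using \<theta> d c by (intro integral_derivative_lebesgue) auto
    finally show "(LINT s|?M. F s \<theta>) = (\<phi> b - \<phi> \<theta>) * g \<theta>" by simp
  qed simp
  finally show ?thesis .
qed


lemma antiderivative_test_function:
  fixes \<psi> :: "real \<Rightarrow> real"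
  assumes cont: "continuous_on UNIV \<psi>" and pq: "a < p" "q < b"
    and supp: "\<And>s. s \<notin> {p..q} \<Longrightarrow> \<psi> s = 0"
    and mean: "(LINT s|lebesgue_on {a..b}. \<psi> s) = 0"
  shows "\<exists>\<phi>. test_function a b \<phi> \<psi>"
proof (intro exI)
  have int: "\<psi> integrable_on {c..d}" for c d
    using cont by (intro integrable_continuous_real continuous_on_subset[OF cont]) auto
  have ab: "integral {a..b} \<psi> = 0"
    using mean cont continuous_on_subset[OF cont, of "{a..b}"]
    by (subst (asm) lebesgue_integral_eq_integral) (auto intro: continuous_imp_integrable_real)
  define \<phi> where "\<phi> x = integral {a..x} \<psi>" for x
  have left: "\<phi> x = 0" if "x < p" for x
    unfolding \<phi>_def using that supp by (intro integral_eq_0_iff[THEN iffD2] integral_unique has_integral_is_0) auto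
  have right: "\<phi> x = 0" if "q < x" for x
  proof -
    have tail: "integral {c..d} \<psi> = 0" if "q < c" for c d
      using that supp by (intro integral_unique has_integral_is_0) auto
    show ?thesis
    proof (cases "x < a")
      case True
      then show ?thesis using left pq by simp
    next
      case x: False
      show ?thesis
      proof (cases "x \<le> b")
        case True
        then have "integral {a..b} \<psi> = integral {a..x} \<psi> + integral {x..b} \<psi>"
          using x int by (intro Henstock_Kurzweil_Integration.integral_combine[symmetric]) auto
        then show ?thesis using tail[of x b] that ab by (simp add: \<phi>_def)
      next
        case False
        show ?thesis
        proof (cases "a \<le> b")
          case True
          then have "integral {a..x} \<psi> = integral {a..b} \<psi> + integral {b..x} \<psi>"
            using False int by (intro Henstock_Kurzweil_Integration.integral_combine[symmetric]) auto
          then show ?thesis using tail[of b x] pq ab by (simp add: \<phi>_def)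
        next
          case nab: False
          then show ?thesis using tail[of a x] pq by (simp add: \<phi>_def)
        qed
      qed
    qed
  qed
  have deriv: "(\<phi> has_real_derivative \<psi> x) (at x)" for x
  proof (cases "x < p")
    case True
    have "((\<lambda>_. 0) has_real_derivative \<psi> x) (at x)"
      using supp[of x] True by simp
    moreover have "\<forall>\<^sub>F y in nhds x. \<phi> y = 0"
      using eventually_nhds_in_open[of "{..<p}" x] True by (auto elim!: eventually_mono simp: left)
    ultimately show ?thesis
      using DERIV_cong_ev[of x x \<phi> "\<lambda>_. 0" "\<psi> x" "\<psi> x"] by simp
  next
    case False
    have "(\<phi> has_vector_derivative \<psi> x) (at x within {a..x + 1})"
      unfolding \<phi>_def using False pq
      by (intro integral_has_vector_derivative continuous_on_subset[OF cont]) auto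
    then have "(\<phi> has_vector_derivative \<psi> x) (at x)"
      using False pq by (subst (asm) at_within_interior) auto
    then show ?thesis
      by (simp add: has_real_derivative_iff_has_vector_derivative)
  qed
  have "\<phi> s = 0" if "s \<notin> {p..q}" for s
    using that left right by force
  then show "test_function a b \<phi> \<psi>"
    unfolding test_function_def using deriv cont pq by blast
qed

definition tent :: "real \<Rightarrow> real \<Rightarrow> real \<Rightarrow> real \<Rightarrow> real" where
  "tent c d e s = max 0 (1 - max 0 (max (c - s) (s - d)) / e)"

lemma tent_continuous: "continuous_on S (tent c d e)"
  unfolding tent_def divide_inverse by (intro continuous_intros)

lemma tent_support: "e > 0 \<Longrightarrow> s \<notin> {c - e..d + e} \<Longrightarrow> tent c d e s = 0"
  by (auto simp: tent_def max_def field_simps)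

lemma tent_bounds: "e > 0 \<Longrightarrow> 0 \<le> tent c d e s \<and> tent c d e s \<le> 1"
  by (auto simp: tent_def max_def field_simps)

lemma tent_eq_1: "s \<in> {c..d} \<Longrightarrow> tent c d e s = 1"
  by (auto simp: tent_def)

lemma du_Bois_Reymond:
  fixes f :: "real \<Rightarrow> real"
  assumes ab: "a < b" and f: "integrable (lebesgue_on {a..b}) f"
    and orth: "\<And>\<phi> \<phi>'. test_function a b \<phi> \<phi>' \<Longrightarrow> (LINT s|lebesgue_on {a..b}. f s * \<phi>' s) = 0"
  shows "\<exists>k. AE s in lebesgue_on {a..b}. f s = k"
proof -
  let ?M = "lebesgue_on {a..b}"
  define m e where "m = (a + b) / 2" and "e = (b - a) / 4"
  have e: "e > 0" "a < m - e" "m + e < b" using ab by (auto simp: m_def e_def field_simps)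
  define \<psi>\<^sub>0 where "\<psi>\<^sub>0 = tent m m e"
  have \<psi>\<^sub>0: "continuous_on S \<psi>\<^sub>0" for S unfolding \<psi>\<^sub>0_def by (rule tent_continuous)
  define I where "I = (LINT s|?M. \<psi>\<^sub>0 s)"
  have "I \<noteq> 0"
  proof
    assume "I = 0"
    then have "\<forall>x\<in>{a..b}. \<psi>\<^sub>0 x = 0"
      unfolding I_def using ab \<psi>\<^sub>0 tent_bounds e
      by (subst (asm) integralL_eq_0_iff) (auto simp: \<psi>\<^sub>0_def)
    moreover have "m \<in> {a..b}" "\<psi>\<^sub>0 m = 1"
      using e tent_eq_1[of m m m e] by (auto simp: \<psi>\<^sub>0_def)
    ultimately show False by auto
  qed
  have ci: "integrable ?M \<psi>" if "continuous_on UNIV \<psi>" for \<psi> :: "real \<Rightarrow> real"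
    by (intro continuous_imp_integrable_real continuous_on_subset[OF that]) auto
  have cif: "integrable ?M (\<lambda>s. f s * \<psi> s)" if "continuous_on UNIV \<psi>" for \<psi>
    using continuous_mult_integrable[OF f continuous_on_subset[OF that, of "{a..b}"]] by (simp add: mult.commute)
  define k where "k = (LINT s|?M. f s * \<psi>\<^sub>0 s) / I"
  (* subtracting a multiple of the bump psi0 makes psi mean-free, hence the derivative of a test function *)
  have zero: "(LINT s|?M. (f s - k) * \<psi> s) = 0"
    if \<psi>: "continuous_on UNIV \<psi>" and pq: "a < p" "q < b" and supp: "\<And>s. s \<notin> {p..q} \<Longrightarrow> \<psi> s = 0"
    for \<psi> p q
  proof -
    define J where "J = (LINT s|?M. \<psi> s)"
    let ?\<eta> = "\<lambda>s. \<psi> s - J / I * \<psi>\<^sub>0 s"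
    have \<eta>: "continuous_on UNIV ?\<eta>"
      using \<psi> \<psi>\<^sub>0 by (intro continuous_intros)
    have "\<exists>\<phi>. test_function a b \<phi> ?\<eta>"
    proof (rule antiderivative_test_function[OF \<eta>])
      show "a < min p (m - e)" "max q (m + e) < b" using pq e by auto
      show "?\<eta> s = 0" if "s \<notin> {min p (m - e)..max q (m + e)}" for s
      proof -
        have "s \<notin> {p..q}" "s \<notin> {m - e..m + e}" using that by auto
        then show ?thesis using supp[of s] tent_support[of e s m m] e by (simp add: \<psi>\<^sub>0_def)
      qed
      show "(LINT s|?M. ?\<eta> s) = 0"
        using ci[OF \<psi>] ci[OF \<psi>\<^sub>0] \<open>I \<noteq> 0\<close> by (simp add: J_def I_def)
    qed
    then have "0 = (LINT s|?M. f s * ?\<eta> s)"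
      using orth by force
    also have "\<dots> = (LINT s|?M. f s * \<psi> s - J / I * (f s * \<psi>\<^sub>0 s))"
      by (intro Bochner_Integration.integral_cong) (auto simp: algebra_simps)
    also have "\<dots> = (LINT s|?M. f s * \<psi> s) - J * k"
      using cif[OF \<psi>] cif[OF \<psi>\<^sub>0] by (simp add: k_def)
    finally have "(LINT s|?M. f s * \<psi> s) = J * k" by simp
    then show ?thesis
      using cif[OF \<psi>] ci[OF \<psi>] by (simp add: left_diff_distrib J_def)
  qed
  let ?h = "\<lambda>s. f s - k"
  interpret M: finite_measure ?M by (rule finite_measure_lebesgue_on_Icc)
  have h: "integrable ?M ?h" using f by simp
  (* tents over {c..d} converge boundedly to its indicator function *)
  have inner: "(LINT s|lebesgue_on {c..d}. ?h s) = 0" if cd: "a < c" "c \<le> d" "d < b" for c d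
  proof -
    define \<delta> where "\<delta> = min (c - a) (b - d)"
    define \<epsilon> where "\<epsilon> n = \<delta> / (2 + real n)" for n :: nat
    have \<delta>: "\<delta> > 0" "\<delta> \<le> c - a" "\<delta> \<le> b - d" using cd by (auto simp: \<delta>_def)
    have \<epsilon>: "\<epsilon> n > 0" "a < c - \<epsilon> n" "d + \<epsilon> n < b" for n
    proof -
      show "\<epsilon> n > 0" using \<delta> by (simp add: \<epsilon>_def)
      have "\<delta> * 1 < \<delta> * (2 + real n)" using \<delta> by (intro mult_strict_left_mono) auto
      then have "\<epsilon> n < \<delta>" by (simp add: \<epsilon>_def divide_less_eq)
      then show "a < c - \<epsilon> n" "d + \<epsilon> n < b" using \<delta> by auto
    qed
    have \<epsilon>0: "\<epsilon> \<longlonglongrightarrow> 0"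
      unfolding \<epsilon>_def by real_asymp
    have "(\<lambda>n. LINT s|?M. ?h s * tent c d (\<epsilon> n) s) \<longlonglongrightarrow> (LINT s|?M. ?h s * indicator {c..d} s)"
    proof (rule integral_dominated_convergence[where w = "\<lambda>s. \<bar>?h s\<bar>"])
      show "(\<lambda>s. ?h s * indicator {c..d} s) \<in> borel_measurable ?M"
        using borel_measurable_integrable[OF h]
        by (intro borel_measurable_times borel_measurable_indicator) (use cd in \<open>auto simp: sets_restrict_space_iff\<close>)
      show "(\<lambda>s. ?h s * tent c d (\<epsilon> n) s) \<in> borel_measurable ?M" for n
        by (intro borel_measurable_times borel_measurable_integrable[OF h]
            continuous_imp_measurable_on_sets_lebesgue tent_continuous) auto
      show "AE s in ?M. (\<lambda>n. ?h s * tent c d (\<epsilon> n) s) \<longlonglongrightarrow> ?h s * indicator {c..d} s"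
      proof (intro AE_I2 tendsto_mult tendsto_const)
        fix s
        show "(\<lambda>n. tent c d (\<epsilon> n) s) \<longlonglongrightarrow> indicator {c..d} s"
        proof (cases "s \<in> {c..d}")
          case True
          then show ?thesis by (simp add: tent_eq_1)
        next
          case False
          define r where "r = max (c - s) (s - d)"
          have "r > 0" using False by (auto simp: r_def)
          then have "\<forall>\<^sub>F n in sequentially. \<epsilon> n < r"
            using \<epsilon>0 by (simp add: order_tendstoD)
          then have "\<forall>\<^sub>F n in sequentially. tent c d (\<epsilon> n) s = indicator {c..d} s"
          proof eventually_elim
            case (elim n)
            then show ?case using \<epsilon>(1)[of n] False by (auto simp: r_def max_def intro!: tent_support split: if_splits)
          qed
          then show ?thesis by (rule tendsto_eventually)
        qed
      qed
      show "AE s in ?M. norm (?h s * tent c d (\<epsilon> n) s) \<le> \<bar>?h s\<bar>" for n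
        using tent_bounds[OF \<epsilon>(1)[of n], of c d] by (auto simp: abs_mult mult_left_le)
    qed (use h in auto)
    moreover have "(LINT s|?M. ?h s * tent c d (\<epsilon> n) s) = 0" for n
      using \<epsilon>[of n] by (intro zero[of _ "c - \<epsilon> n" "d + \<epsilon> n"] tent_continuous tent_support) auto
    ultimately have "(LINT s|?M. ?h s * indicator {c..d} s) = 0"
      by (simp add: LIMSEQ_const_iff)
    moreover have "(LINT s|?M. ?h s * indicator {c..d} s) = (LINT s|?M. (if s \<in> {c..d} then ?h s else 0))"
      by (intro Bochner_Integration.integral_cong) (auto simp: indicator_def)
    moreover have "\<dots> = (LINT s|lebesgue_on {c..d}. ?h s)"
      using cd by (intro integral_restrict) auto
    ultimately show ?thesis by simp
  qed
  define H where "H x = (LINT s|lebesgue_on {a..x}. ?h s)" for x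
  have Hc: "continuous_on {a..b} H"
    unfolding H_def by (rule indefinite_integral_continuous_real[OF h])
  have Hm: "H x = H m" if x: "x \<in> {a<..<b}" for x
  proof -
    have *: "H d = H c" if "a < c" "c \<le> d" "d < b" for c d
      unfolding H_def using that inner[OF that] integral_combine[OF integrable_subinterval[OF h, of a d], of c] by auto
    show ?thesis
      using *[of x m] *[of m x] x e by (cases "x \<le> m") auto
  qed
  have Hall: "H x = H m" if "x \<in> {a..b}" for x
  proof (rule continuous_constant_on_closure[of "{a<..<b}" H "H m"])
    show "continuous_on (closure {a<..<b}) H" using Hc ab by simp
  qed (use Hm that ab in auto)
  have "AE s in ?M. ?h s = 0"
  proof (rule AE_zero_if_interval_integrals_zero[OF h])
    fix c d assume "a \<le> c" "c \<le> d" "d \<le> b"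
    then show "(LINT s|lebesgue_on {c..d}. ?h s) = 0"
      using integral_combine[OF integrable_subinterval[OF h, of a d], of c] Hall[of c] Hall[of d]
      by (auto simp: H_def)
  qed
  then show ?thesis
    by (intro exI[of _ k]) (auto elim!: eventually_mono)
qed

section \<open>Sobolev functions on an interval\<close>

lemma L2_integrable:
  assumes "f \<in> L2 {a..b}"
  shows "integrable (lebesgue_on {a..b}) f"
proof (rule Bochner_Integration.integrable_bound[of _ "\<lambda>s. 1 + (f s)\<^sup>2"])
  interpret finite_measure "lebesgue_on {a..b}" by (rule finite_measure_lebesgue_on_Icc)
  show "integrable (lebesgue_on {a..b}) (\<lambda>s. 1 + (f s)\<^sup>2)"
    using assms by (auto simp: L2_def)
  show "AE s in lebesgue_on {a..b}. norm (f s) \<le> norm (1 + (f s)\<^sup>2)"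
  proof (rule AE_I2)
    fix s
    have "0 \<le> (\<bar>f s\<bar> - 1)\<^sup>2" by simp
    then have "2 * \<bar>f s\<bar> \<le> 1 + (f s)\<^sup>2" by (simp add: power2_diff)
    then show "norm (f s) \<le> norm (1 + (f s)\<^sup>2)" by simp
  qed
qed (use assms in \<open>auto simp: L2_def\<close>)

lemma L2_lincomb:
  assumes "f \<in> L2 S" "g \<in> L2 S"
  shows "(\<lambda>s. \<alpha> * f s + \<beta> * g s) \<in> L2 S"
proof -
  have "integrable (lebesgue_on S) (\<lambda>s. (\<alpha> * f s + \<beta> * g s)\<^sup>2)"
  proof (rule Bochner_Integration.integrable_bound)
    show "integrable (lebesgue_on S) (\<lambda>s. 2 * \<alpha>\<^sup>2 * (f s)\<^sup>2 + 2 * \<beta>\<^sup>2 * (g s)\<^sup>2)"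
      using assms by (auto simp: L2_def)
    show "AE s in lebesgue_on S. norm ((\<alpha> * f s + \<beta> * g s)\<^sup>2) \<le> norm (2 * \<alpha>\<^sup>2 * (f s)\<^sup>2 + 2 * \<beta>\<^sup>2 * (g s)\<^sup>2)"
    proof (rule AE_I2)
      fix s
      have "0 \<le> (\<alpha> * f s - \<beta> * g s)\<^sup>2" by simp
      then have "(\<alpha> * f s + \<beta> * g s)\<^sup>2 \<le> 2 * \<alpha>\<^sup>2 * (f s)\<^sup>2 + 2 * \<beta>\<^sup>2 * (g s)\<^sup>2"
        by (simp add: power2_sum power2_diff power_mult_distrib)
      then show "norm ((\<alpha> * f s + \<beta> * g s)\<^sup>2) \<le> norm (2 * \<alpha>\<^sup>2 * (f s)\<^sup>2 + 2 * \<beta>\<^sup>2 * (g s)\<^sup>2)"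
        by simp
    qed
  qed (use assms in \<open>auto simp: L2_def\<close>)
  with assms show ?thesis by (auto simp: L2_def)
qed

lemma L2_continuous:
  assumes "continuous_on {a..b} f"
  shows "f \<in> L2 {a..b}"
proof -
  have "continuous_on {a..b} (\<lambda>s. (f s)\<^sup>2)" by (intro continuous_on_power assms)
  then show ?thesis
    unfolding L2_def
    using continuous_imp_measurable_on_sets_lebesgue[OF assms] continuous_imp_integrable_real by simp
qed

lemma L2_const: "(\<lambda>_. c) \<in> L2 {a..b}"
  by (intro L2_continuous) auto

lemma L2_cong:
  assumes "\<And>s. s \<in> S \<Longrightarrow> f s = g s"
  shows "f \<in> L2 S \<longleftrightarrow> g \<in> L2 S"
proof -
  have "f \<in> borel_measurable (lebesgue_on S) \<longleftrightarrow> g \<in> borel_measurable (lebesgue_on S)"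
    using assms by (intro measurable_cong) auto
  moreover have "integrable (lebesgue_on S) (\<lambda>s. (f s)\<^sup>2) \<longleftrightarrow> integrable (lebesgue_on S) (\<lambda>s. (g s)\<^sup>2)"
    using assms by (intro Bochner_Integration.integrable_cong) auto
  ultimately show ?thesis by (simp add: L2_def)
qed

lemma borel_measurable_lebesgue_on_AE:
  fixes f g :: "real \<Rightarrow> real"
  assumes f: "f \<in> borel_measurable (lebesgue_on {a..b})" and ae: "AE s in lebesgue_on {a..b}. f s = g s"
  shows "g \<in> borel_measurable (lebesgue_on {a..b})"
proof -
  have "AE s in lebesgue. s \<in> {a..b} \<longrightarrow> f s = g s"
    using ae by (subst (asm) AE_restrict_space_iff) auto
  then have "AE s in lebesgue. (if s \<in> {a..b} then f s else 0) = (if s \<in> {a..b} then g s else 0)"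
    by eventually_elim auto
  moreover have "(\<lambda>s. if s \<in> {a..b} then f s else 0) \<in> borel_measurable lebesgue"
    by (rule borel_measurable_if_I[OF f]) auto
  ultimately have "(\<lambda>s. if s \<in> {a..b} then g s else 0) \<in> borel_measurable lebesgue"
    by (rule borel_measurable_AE[rotated])
  then show ?thesis
    by (rule borel_measurable_if_D)
qed

lemma L2_AE_cong:
  assumes f: "f \<in> L2 {a..b}" and ae: "AE s in lebesgue_on {a..b}. f s = g s"
  shows "g \<in> L2 {a..b}"
proof -
  have g: "g \<in> borel_measurable (lebesgue_on {a..b})"
    using f ae by (auto simp: L2_def intro: borel_measurable_lebesgue_on_AE)
  moreover have "integrable (lebesgue_on {a..b}) (\<lambda>s. (g s)\<^sup>2)"
  proof (subst integrable_cong_AE)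
    show "AE s in lebesgue_on {a..b}. (g s)\<^sup>2 = (f s)\<^sup>2" using ae by eventually_elim simp
  qed (use f g in \<open>auto simp: L2_def\<close>)
  ultimately show ?thesis by (simp add: L2_def)
qed

definition l2 :: "real \<Rightarrow> real \<Rightarrow> (real \<Rightarrow> real) \<Rightarrow> real" where
  "l2 a b f = sqrt (LINT s|lebesgue_on {a..b}. (f s)\<^sup>2)"

lemma l2_nonneg: "0 \<le> l2 a b f"
  by (simp add: l2_def integral_nonneg_AE)

lemma l2_AE_cong:
  assumes "AE s in lebesgue_on {a..b}. f s = g s" "f \<in> L2 {a..b}"
  shows "l2 a b f = l2 a b g"
proof -
  have "g \<in> L2 {a..b}" using assms L2_AE_cong by blast
  then have "(LINT s|lebesgue_on {a..b}. (f s)\<^sup>2) = (LINT s|lebesgue_on {a..b}. (g s)\<^sup>2)"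
    using assms by (intro integral_cong_AE) (auto simp: L2_def elim: eventually_mono)
  then show ?thesis by (simp add: l2_def)
qed

lemma integral_abs_le_l2:
  assumes ab: "a < b" and f: "f \<in> L2 {a..b}"
  shows "(LINT s|lebesgue_on {a..b}. \<bar>f s\<bar>) \<le> sqrt (b - a) * l2 a b f"
proof -
  let ?M = "lebesgue_on {a..b}"
  interpret finite_measure ?M by (rule finite_measure_lebesgue_on_Icc)
  have mM: "measure ?M {a..b} = b - a"
    using ab by (simp add: measure_restrict_space)
  (* expand the nonnegative integral of (|f| - m)^2, where m is the mean of |f| *)
  define J where "J = (LINT s|?M. \<bar>f s\<bar>)"
  define m where "m = J / (b - a)"
  have i: "integrable ?M f" "integrable ?M (\<lambda>s. (f s)\<^sup>2)"
    using L2_integrable[OF f] f by (simp_all add: L2_def)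
  have "0 \<le> (LINT s|?M. (\<bar>f s\<bar> - m)\<^sup>2)" by (rule integral_nonneg_AE) auto
  also have "\<dots> = (LINT s|?M. (f s)\<^sup>2 - 2 * m * \<bar>f s\<bar> + m\<^sup>2)"
    by (intro Bochner_Integration.integral_cong) (auto simp: power2_diff algebra_simps)
  also have "\<dots> = (LINT s|?M. (f s)\<^sup>2) - 2 * m * J + m\<^sup>2 * (b - a)"
    using i by (simp add: J_def mM)
  also have "\<dots> = (LINT s|?M. (f s)\<^sup>2) - J\<^sup>2 / (b - a)"
  proof -
    have J: "J = m * (b - a)" using ab by (simp add: m_def)
    have "J\<^sup>2 / (b - a) = m\<^sup>2 * (b - a)" using ab by (simp add: J power2_eq_square)
    moreover have "2 * m * J = 2 * (m\<^sup>2 * (b - a))" by (simp add: J power2_eq_square)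
    ultimately show ?thesis by simp
  qed
  finally have "J\<^sup>2 \<le> (b - a) * (LINT s|?M. (f s)\<^sup>2)"
    using ab by (simp add: field_simps)
  then have "J \<le> sqrt ((b - a) * (LINT s|?M. (f s)\<^sup>2))"
    by (rule real_le_rsqrt)
  then show ?thesis by (simp add: J_def l2_def real_sqrt_mult)
qed

lemma l2_le_bound:
  assumes ab: "a < b" and f: "f \<in> L2 {a..b}" and B: "0 \<le> B" and bd: "AE s in lebesgue_on {a..b}. \<bar>f s\<bar> \<le> B"
  shows "l2 a b f \<le> sqrt (b - a) * B"
proof -
  let ?M = "lebesgue_on {a..b}"
  interpret finite_measure ?M by (rule finite_measure_lebesgue_on_Icc)
  have mM: "measure ?M {a..b} = b - a"
    using ab by (simp add: measure_restrict_space)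
  have "(LINT s|?M. (f s)\<^sup>2) \<le> (LINT s|?M. B\<^sup>2)"
  proof (rule integral_mono_AE)
    show "AE s in ?M. (f s)\<^sup>2 \<le> B\<^sup>2"
      using bd by eventually_elim (simp add: abs_le_square_iff[symmetric] B)
  qed (use f in \<open>auto simp: L2_def\<close>)
  also have "\<dots> = (b - a) * B\<^sup>2" by (simp add: mM)
  finally have "l2 a b f \<le> sqrt ((b - a) * B\<^sup>2)" by (simp add: l2_def)
  then show ?thesis using B by (simp add: real_sqrt_mult)
qed

abbreviation indef :: "real \<Rightarrow> (real \<Rightarrow> real) \<Rightarrow> real \<Rightarrow> real" where
  "indef a g s \<equiv> LINT \<theta>|lebesgue_on {a..s}. g \<theta>"

lemma integral_lebesgue_on_singleton [simp]:
  fixes g :: "real \<Rightarrow> real"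
  shows "(LINT s|lebesgue_on {a}. g s) = 0"
  by (intro integral_eq_zero_null_sets) auto

lemma indef_bound:
  assumes g: "integrable (lebesgue_on {a..b}) g" and s: "s \<in> {a..b}"
  shows "\<bar>indef a g s\<bar> \<le> (LINT \<theta>|lebesgue_on {a..b}. \<bar>g \<theta>\<bar>)"
proof -
  have gs: "integrable (lebesgue_on {a..s}) g" "integrable (lebesgue_on {s..b}) g"
    using s by (auto intro!: integrable_subinterval[OF g])
  have "\<bar>indef a g s\<bar> \<le> (LINT \<theta>|lebesgue_on {a..s}. \<bar>g \<theta>\<bar>)"
    by (rule integral_abs_bound)
  also have "\<dots> \<le> (LINT \<theta>|lebesgue_on {a..s}. \<bar>g \<theta>\<bar>) + (LINT \<theta>|lebesgue_on {s..b}. \<bar>g \<theta>\<bar>)"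
    by (simp add: integral_nonneg_AE)
  also have "\<dots> = (LINT \<theta>|lebesgue_on {a..b}. \<bar>g \<theta>\<bar>)"
    using g s by (intro integral_combine[symmetric]) auto
  finally show ?thesis .
qed

lemma indef_lincomb:
  assumes "integrable (lebesgue_on {a..b}) f" "integrable (lebesgue_on {a..b}) g" "s \<in> {a..b}"
  shows "indef a (\<lambda>s. \<alpha> * f s + \<beta> * g s) s = \<alpha> * indef a f s + \<beta> * indef a g s"
proof -
  have "integrable (lebesgue_on {a..s}) f" "integrable (lebesgue_on {a..s}) g"
    using assms by (auto intro!: integrable_subinterval[of a b])
  then show ?thesis by simp
qed

lemma AE_lebesgue_on_space: "AE s in lebesgue_on S. s \<in> S"
  using AE_space[of "lebesgue_on S"] by simp

lemma AE_lebesgue_on_subset: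
  fixes a b :: real
  assumes "AE s in lebesgue_on {a..b}. P s" "{c..d} \<subseteq> {a..b}"
  shows "AE s in lebesgue_on {c..d}. P s"
proof -
  have "AE s in lebesgue. s \<in> {a..b} \<longrightarrow> P s"
    using assms(1) by (subst (asm) AE_restrict_space_iff) auto
  then have "AE s in lebesgue. s \<in> {c..d} \<longrightarrow> P s"
    using assms(2) by (auto elim!: eventually_mono simp del: atLeastatMost_subset_iff)
  then show ?thesis
    by (subst AE_restrict_space_iff) auto
qed

lemma indef_AE_cong:
  assumes "AE s in lebesgue_on {a..b}. f s = g s" "integrable (lebesgue_on {a..b}) f" "s \<in> {a..b}"
  shows "indef a f s = indef a g s"
proof (rule integral_cong_AE)
  show f: "f \<in> borel_measurable (lebesgue_on {a..s})"
    using assms integrable_subinterval[OF assms(2), of a s] by auto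
  show ae: "AE s in lebesgue_on {a..s}. f s = g s"
    using assms by (intro AE_lebesgue_on_subset[OF assms(1)]) auto
  show "g \<in> borel_measurable (lebesgue_on {a..s})"
    by (rule borel_measurable_lebesgue_on_AE[OF f ae])
qed

lemma continuous_AE_eq_imp_eq:
  fixes f g :: "real \<Rightarrow> real"
  assumes ab: "a < b" and f: "continuous_on {a..b} f" and g: "continuous_on {a..b} g"
    and ae: "AE s in lebesgue_on {a..b}. f s = g s" and s: "s \<in> {a..b}"
  shows "f s = g s"
proof -
  have c: "continuous_on {a..b} (\<lambda>s. \<bar>f s - g s\<bar>)"
    using f g by (intro continuous_intros)
  have "(LINT s|lebesgue_on {a..b}. \<bar>f s - g s\<bar>) = 0"
    using ae by (intro integral_eq_zero_AE) (auto elim: eventually_mono)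
  with integralL_eq_0_iff[OF c ab] s show ?thesis by auto
qed

lemma point_value_eq:
  assumes ab: "a < b" and F: "continuous_on {a..b} F" and ae: "AE s in lebesgue_on {a..b}. f s = F s"
    and t: "t \<in> {a..b}"
  shows "point_value a b f t = F t"
  unfolding point_value_def
proof (rule the_equality)
  show "\<exists>g. continuous_on {a..b} g \<and> (AE s in lebesgue_on {a..b}. f s = g s) \<and> F t = g t"
    using F ae by blast
next
  fix y assume "\<exists>g. continuous_on {a..b} g \<and> (AE s in lebesgue_on {a..b}. f s = g s) \<and> y = g t"
  then obtain g where g: "continuous_on {a..b} g" "AE s in lebesgue_on {a..b}. f s = g s" "y = g t" by blast
  have "AE s in lebesgue_on {a..b}. F s = g s"
    using ae g(2) by eventually_elim simp
  then show "y = F t"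
    using continuous_AE_eq_imp_eq[OF ab F g(1) _ t] g(3) by simp
qed

lemma continuous_affine_indef:
  assumes "integrable (lebesgue_on {a..b}) g"
  shows "continuous_on {a..b} (\<lambda>s. c + indef a g s)"
  using indefinite_integral_continuous_real[OF assms] by (intro continuous_intros)

lemma indef_zero_imp_AE_zero:
  assumes h: "integrable (lebesgue_on {a..b}) h" and z: "\<And>s. s \<in> {a..b} \<Longrightarrow> indef a h s = 0"
  shows "AE s in lebesgue_on {a..b}. h s = 0"
proof (rule AE_zero_if_interval_integrals_zero[OF h])
  fix c d assume "a \<le> c" "c \<le> d" "d \<le> b"
  then show "(LINT s|lebesgue_on {c..d}. h s) = 0"
    using integral_combine[OF integrable_subinterval[OF h, of a d], of c] z[of c] z[of d] by auto
qed

lemma test_function_boundary: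
  assumes "test_function a b \<phi> \<phi>'"
  shows "\<phi> a = 0" "\<phi> b = 0"
  using assms unfolding test_function_def by (metis atLeastAtMost_iff not_le)+

lemma integral_indef_test_function:
  assumes ab: "a < b" and g: "integrable (lebesgue_on {a..b}) g" and \<phi>: "test_function a b \<phi> \<phi>'"
  shows "(LINT s|lebesgue_on {a..b}. (c + indef a g s) * \<phi>' s) = - (LINT s|lebesgue_on {a..b}. g s * \<phi> s)"
proof -
  let ?M = "lebesgue_on {a..b}"
  have d: "\<And>s. (\<phi> has_real_derivative \<phi>' s) (at s)" and c': "continuous_on UNIV \<phi>'"
    using \<phi> by (auto simp: test_function_def)
  have i1: "integrable ?M \<phi>'"
    by (intro continuous_imp_integrable_real continuous_on_subset[OF c']) auto
  have i2: "integrable ?M (\<lambda>s. indef a g s * \<phi>' s)"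
    by (intro continuous_imp_integrable_real continuous_on_mult indefinite_integral_continuous_real
        g continuous_on_subset[OF c']) auto
  have "(LINT s|?M. (c + indef a g s) * \<phi>' s) = c * (LINT s|?M. \<phi>' s) + (LINT s|?M. indef a g s * \<phi>' s)"
    using i1 i2 by (simp add: distrib_right)
  also have "(LINT s|?M. \<phi>' s) = 0"
    using integral_derivative_lebesgue[OF _ d c', of a b] ab test_function_boundary[OF \<phi>] by simp
  also have "(LINT s|?M. indef a g s * \<phi>' s) = - (LINT s|?M. g s * \<phi> s)"
    using integral_by_parts_indefinite[OF g _ d c'] ab test_function_boundary[OF \<phi>]
    by (simp add: mult.commute)
  finally show ?thesis by simp
qed

lemma weak_deriv_indef:
  assumes ab: "a < b" and g: "integrable (lebesgue_on {a..b}) g"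
    and ae: "AE s in lebesgue_on {a..b}. f s = c + indef a g s"
  shows "weak_deriv a b f g"
  unfolding weak_deriv_def
proof (intro allI impI)
  fix \<phi> \<phi>' assume \<phi>: "test_function a b \<phi> \<phi>'"
  have ae': "AE s in lebesgue_on {a..b}. (c + indef a g s) = f s"
    using ae by eventually_elim simp
  have c': "continuous_on UNIV \<phi>'"
    using \<phi> by (auto simp: test_function_def)
  have m1: "(\<lambda>s. c + indef a g s) \<in> borel_measurable (lebesgue_on {a..b})"
    by (intro continuous_imp_measurable_on_sets_lebesgue continuous_affine_indef g) auto
  have m2: "\<phi>' \<in> borel_measurable (lebesgue_on {a..b})"
    by (intro continuous_imp_measurable_on_sets_lebesgue continuous_on_subset[OF c']) auto
  have "(LINT s|lebesgue_on {a..b}. f s * \<phi>' s) = (LINT s|lebesgue_on {a..b}. (c + indef a g s) * \<phi>' s)"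
    using ae borel_measurable_lebesgue_on_AE[OF m1 ae'] m1 m2
    by (intro integral_cong_AE borel_measurable_times) (auto elim: eventually_mono)
  then show "(LINT s|lebesgue_on {a..b}. f s * \<phi>' s) = - (LINT s|lebesgue_on {a..b}. g s * \<phi> s)"
    using integral_indef_test_function[OF ab g \<phi>] by simp
qed

lemma weak_deriv_imp_indef:
  assumes ab: "a < b" and f: "integrable (lebesgue_on {a..b}) f" and g: "integrable (lebesgue_on {a..b}) g"
    and w: "weak_deriv a b f g"
  shows "\<exists>c. AE s in lebesgue_on {a..b}. f s = c + indef a g s"
proof -
  let ?M = "lebesgue_on {a..b}"
  have G: "continuous_on {a..b} (indef a g)" by (rule indefinite_integral_continuous_real[OF g])
  have Gi: "integrable ?M (indef a g)" by (intro continuous_imp_integrable_real G)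
  have "\<exists>k. AE s in ?M. f s - indef a g s = k"
  proof (rule du_Bois_Reymond[OF ab])
    show "integrable ?M (\<lambda>s. f s - indef a g s)" using f Gi by simp
    fix \<phi> \<phi>' assume \<phi>: "test_function a b \<phi> \<phi>'"
    have c': "continuous_on {a..b} \<phi>'"
      using \<phi> continuous_on_subset by (auto simp: test_function_def)
    have "integrable ?M (\<lambda>s. f s * \<phi>' s)" "integrable ?M (\<lambda>s. indef a g s * \<phi>' s)"
      using continuous_mult_integrable[OF f c'] continuous_mult_integrable[OF Gi c'] by (simp_all add: mult.commute)
    then show "(LINT s|?M. (f s - indef a g s) * \<phi>' s) = 0"
      using w \<phi> integral_indef_test_function[OF ab g \<phi>, of 0] by (simp add: left_diff_distrib weak_deriv_def)
  qed
  then obtain k where "AE s in ?M. f s - indef a g s = k" by blast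
  then show ?thesis by (intro exI[of _ k]) (auto elim!: eventually_mono)
qed

lemma weak_deriv_AE_unique:
  assumes ab: "a < b" and f: "integrable (lebesgue_on {a..b}) f"
    and g: "integrable (lebesgue_on {a..b}) g" "weak_deriv a b f g"
    and h: "integrable (lebesgue_on {a..b}) h" "weak_deriv a b f h"
  shows "AE s in lebesgue_on {a..b}. g s = h s"
proof -
  obtain c d where c: "AE s in lebesgue_on {a..b}. f s = c + indef a g s"
    and d: "AE s in lebesgue_on {a..b}. f s = d + indef a h s"
    using weak_deriv_imp_indef[OF ab f g] weak_deriv_imp_indef[OF ab f h] by blast
  have "AE s in lebesgue_on {a..b}. c + indef a g s = d + indef a h s"
    using c d by eventually_elim simp
  then have eq: "c + indef a g s = d + indef a h s" if "s \<in> {a..b}" for s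
    using that by (intro continuous_AE_eq_imp_eq[OF ab continuous_affine_indef[OF g(1)] continuous_affine_indef[OF h(1)]])
  have "c = d" using eq[of a] ab by simp
  have "AE s in lebesgue_on {a..b}. 1 * g s + (- 1) * h s = 0"
  proof (rule indef_zero_imp_AE_zero)
    fix s assume s: "s \<in> {a..b}"
    then show "indef a (\<lambda>s. 1 * g s + (- 1) * h s) s = 0"
      using eq[OF s] \<open>c = d\<close> by (subst indef_lincomb[OF g(1) h(1) s]) simp
  qed (use g h in auto)
  then show ?thesis by eventually_elim simp
qed

lemma wderiv_props:
  assumes ab: "a < b" and f: "integrable (lebesgue_on {a..b}) f" and g: "g \<in> L2 {a..b}" "weak_deriv a b f g"
  shows "wderiv a b f \<in> L2 {a..b}" "weak_deriv a b f (wderiv a b f)"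
    "AE s in lebesgue_on {a..b}. wderiv a b f s = g s"
proof -
  have "\<exists>g. g \<in> L2 {a..b} \<and> weak_deriv a b f g" using g by blast
  then have *: "wderiv a b f \<in> L2 {a..b} \<and> weak_deriv a b f (wderiv a b f)"
    unfolding wderiv_def by (rule someI_ex)
  then show "wderiv a b f \<in> L2 {a..b}" "weak_deriv a b f (wderiv a b f)" by auto
  show "AE s in lebesgue_on {a..b}. wderiv a b f s = g s"
    using * g by (intro weak_deriv_AE_unique[OF ab f]) (auto intro: L2_integrable)
qed

lemma W2_1_iff: "f \<in> W2 a b 1 \<longleftrightarrow> f \<in> L2 {a..b} \<and> (\<exists>g \<in> L2 {a..b}. weak_deriv a b f g)"
  by simp

lemma W2_2_iff: "f \<in> W2 a b 2 \<longleftrightarrow> f \<in> L2 {a..b} \<and> (\<exists>g \<in> W2 a b 1. weak_deriv a b f g)"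
  by (simp add: numeral_2_eq_2)

lemma W2_1_intro:
  assumes ab: "a < b" and g: "g \<in> L2 {a..b}"
    and ae: "AE s in lebesgue_on {a..b}. f s = c + indef a g s"
  shows "f \<in> W2 a b 1" "AE s in lebesgue_on {a..b}. wderiv a b f s = g s"
    "\<And>t. t \<in> {a..b} \<Longrightarrow> point_value a b f t = c + indef a g t"
proof -
  have gi: "integrable (lebesgue_on {a..b}) g" by (rule L2_integrable[OF g])
  have c: "continuous_on {a..b} (\<lambda>s. c + indef a g s)" by (rule continuous_affine_indef[OF gi])
  have f: "f \<in> L2 {a..b}"
    using ae by (intro L2_AE_cong[OF L2_continuous[OF c]]) (auto elim: eventually_mono)
  have w: "weak_deriv a b f g"
    by (rule weak_deriv_indef[OF ab gi ae])
  show "f \<in> W2 a b 1" unfolding W2_1_iff using f g w by blast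
  show "AE s in lebesgue_on {a..b}. wderiv a b f s = g s"
    by (rule wderiv_props(3)[OF ab L2_integrable[OF f] g w])
  show "point_value a b f t = c + indef a g t" if "t \<in> {a..b}" for t
    by (rule point_value_eq[OF ab c ae that])
qed

lemma W2_1_elim:
  assumes ab: "a < b" and f: "f \<in> W2 a b 1"
  shows "f \<in> L2 {a..b}" "wderiv a b f \<in> L2 {a..b}"
    "AE s in lebesgue_on {a..b}. f s = point_value a b f a + indef a (wderiv a b f) s"
    "\<And>t. t \<in> {a..b} \<Longrightarrow> point_value a b f t = point_value a b f a + indef a (wderiv a b f) t"
proof -
  show fL: "f \<in> L2 {a..b}" using f by (simp add: W2_1_iff)
  obtain g where g: "g \<in> L2 {a..b}" "weak_deriv a b f g" using f by (auto simp: W2_1_iff)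
  note w = wderiv_props[OF ab L2_integrable[OF fL] g]
  show "wderiv a b f \<in> L2 {a..b}" by (rule w)
  obtain c where c: "AE s in lebesgue_on {a..b}. f s = c + indef a (wderiv a b f) s"
    using weak_deriv_imp_indef[OF ab L2_integrable[OF fL] L2_integrable[OF w(1)] w(2)] by blast
  note pv = W2_1_intro(3)[OF ab w(1) c]
  have ca: "point_value a b f a = c" using pv[of a] ab by simp
  show "AE s in lebesgue_on {a..b}. f s = point_value a b f a + indef a (wderiv a b f) s"
    using c by (simp add: ca)
  show "\<And>t. t \<in> {a..b} \<Longrightarrow> point_value a b f t = point_value a b f a + indef a (wderiv a b f) t"
    using pv by (simp add: ca)
qed

lemma W2_1_AE_cong:
  assumes ab: "a < b" and f: "f \<in> W2 a b 1" and ae: "AE s in lebesgue_on {a..b}. f s = g s"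
  shows "g \<in> W2 a b 1" "AE s in lebesgue_on {a..b}. wderiv a b g s = wderiv a b f s"
    "t \<in> {a..b} \<Longrightarrow> point_value a b g t = point_value a b f t"
proof -
  note e = W2_1_elim[OF ab f]
  have "AE s in lebesgue_on {a..b}. g s = point_value a b f a + indef a (wderiv a b f) s"
    using e(3) ae by eventually_elim simp
  note i = W2_1_intro[OF ab e(2) this]
  show "g \<in> W2 a b 1" "AE s in lebesgue_on {a..b}. wderiv a b g s = wderiv a b f s"
    by (rule i)+
  show "t \<in> {a..b} \<Longrightarrow> point_value a b g t = point_value a b f t"
    using i(3)[of t] e(4)[of t] by simp
qed

lemma W2_1_lincomb:
  assumes ab: "a < b" and f: "f \<in> W2 a b 1" and g: "g \<in> W2 a b 1" and d: "d \<in> W2 a b 1"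
    and e: "\<forall>s\<in>{a..b}. e s = f s - g s - h * d s"
  shows "e \<in> W2 a b 1"
    "AE s in lebesgue_on {a..b}. wderiv a b e s = wderiv a b f s - wderiv a b g s - h * wderiv a b d s"
    "\<And>t. t \<in> {a..b} \<Longrightarrow> point_value a b e t = point_value a b f t - point_value a b g t - h * point_value a b d t"
proof -
  note ef = W2_1_elim[OF ab f] and eg = W2_1_elim[OF ab g] and ed = W2_1_elim[OF ab d]
  let ?q = "\<lambda>s. 1 * wderiv a b f s + (- 1) * wderiv a b g s"
  let ?r = "\<lambda>s. 1 * ?q s + (- h) * wderiv a b d s"
  have q: "?q \<in> L2 {a..b}" by (rule L2_lincomb[OF ef(2) eg(2)])
  have ind: "indef a ?r s = indef a (wderiv a b f) s - indef a (wderiv a b g) s - h * indef a (wderiv a b d) s"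
    if "s \<in> {a..b}" for s
    using indef_lincomb[OF L2_integrable[OF ef(2)] L2_integrable[OF eg(2)] that, of 1 "- 1"]
      indef_lincomb[OF L2_integrable[OF q] L2_integrable[OF ed(2)] that, of 1 "- h"] by simp
  let ?c = "point_value a b f a - point_value a b g a - h * point_value a b d a"
  have "AE s in lebesgue_on {a..b}. e s = ?c + indef a ?r s"
    using ef(3) eg(3) ed(3) AE_lebesgue_on_space
  proof eventually_elim
    case (elim s)
    show ?case unfolding ind[OF elim(4)] bspec[OF e elim(4)] using elim(1-3) by (simp add: algebra_simps)
  qed
  note i = W2_1_intro[OF ab L2_lincomb[OF q ed(2)] this]
  show "e \<in> W2 a b 1" by (rule i)
  show "AE s in lebesgue_on {a..b}. wderiv a b e s = wderiv a b f s - wderiv a b g s - h * wderiv a b d s"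
    using i(2) by eventually_elim simp
  fix t assume t: "t \<in> {a..b}"
  show "point_value a b e t = point_value a b f t - point_value a b g t - h * point_value a b d t"
    unfolding i(3)[OF t] ind[OF t] ef(4)[OF t] eg(4)[OF t] ed(4)[OF t] by (simp add: algebra_simps)
qed

lemma W2_2_iff_wderiv:
  assumes ab: "a < b"
  shows "f \<in> W2 a b 2 \<longleftrightarrow> f \<in> W2 a b 1 \<and> wderiv a b f \<in> W2 a b 1"
proof
  assume "f \<in> W2 a b 2"
  then obtain g where f: "f \<in> L2 {a..b}" and g: "g \<in> W2 a b 1" "weak_deriv a b f g"
    by (auto simp: W2_2_iff simp del: W2.simps One_nat_def)
  have gL: "g \<in> L2 {a..b}" using g by (simp add: W2_1_iff)
  note w = wderiv_props[OF ab L2_integrable[OF f] gL g(2)]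
  have "AE s in lebesgue_on {a..b}. g s = wderiv a b f s"
    using w(3) by eventually_elim simp
  then have "wderiv a b f \<in> W2 a b 1" by (rule W2_1_AE_cong(1)[OF ab g(1)])
  moreover have "f \<in> W2 a b 1" unfolding W2_1_iff using f gL g(2) by blast
  ultimately show "f \<in> W2 a b 1 \<and> wderiv a b f \<in> W2 a b 1" by simp
next
  assume *: "f \<in> W2 a b 1 \<and> wderiv a b f \<in> W2 a b 1"
  then obtain g where f: "f \<in> L2 {a..b}" and g: "g \<in> L2 {a..b}" "weak_deriv a b f g"
    unfolding W2_1_iff by blast
  note w = wderiv_props[OF ab L2_integrable[OF f] g]
  show "f \<in> W2 a b 2" unfolding W2_2_iff using f w(2) * by blast
qed

lemma indef_affine_indef:
  assumes y: "integrable (lebesgue_on {a..b}) y" and s: "s \<in> {a..b}"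
  shows "indef a (\<lambda>r. c + indef a y r) s = (s - a) * c + indef a (\<lambda>\<theta>. (s - \<theta>) * y \<theta>) s"
proof -
  have ys: "integrable (lebesgue_on {a..s}) y" using s by (auto intro: integrable_subinterval[OF y])
  interpret finite_measure "lebesgue_on {a..s}" by (rule finite_measure_lebesgue_on_Icc)
  have m: "measure (lebesgue_on {a..s}) {a..s} = s - a" using s by (simp add: measure_restrict_space)
  have "integrable (lebesgue_on {a..s}) (indef a y)"
    by (intro continuous_imp_integrable_real indefinite_integral_continuous_real ys)
  then have "indef a (\<lambda>r. c + indef a y r) s = (s - a) * c + indef a (indef a y) s"
    by (simp add: m)
  also have "indef a (indef a y) s = indef a (\<lambda>\<theta>. (s - \<theta>) * y \<theta>) s"
    using integral_by_parts_indefinite[OF ys, of "\<lambda>x. x" "\<lambda>_. 1"] s by simp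
  finally show ?thesis .
qed

lemma W2_2_intro:
  assumes ab: "a < b" and y: "y \<in> L2 {a..b}"
    and ae: "AE s in lebesgue_on {a..b}. f s = c + (s - a) * d + indef a (\<lambda>\<theta>. (s - \<theta>) * y \<theta>) s"
  shows "f \<in> W2 a b 2" "AE s in lebesgue_on {a..b}. wderiv a b f s = d + indef a y s"
    "AE s in lebesgue_on {a..b}. wderiv a b (wderiv a b f) s = y s"
    "\<And>t. t \<in> {a..b} \<Longrightarrow> point_value a b f t = c + (t - a) * d + indef a (\<lambda>\<theta>. (t - \<theta>) * y \<theta>) t"
    "\<And>t. t \<in> {a..b} \<Longrightarrow> point_value a b (wderiv a b f) t = d + indef a y t"
proof -
  let ?g = "\<lambda>s. d + indef a y s"
  have yi: "integrable (lebesgue_on {a..b}) y" by (rule L2_integrable[OF y])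
  have g: "?g \<in> L2 {a..b}" by (intro L2_continuous continuous_affine_indef yi)
  have "AE s in lebesgue_on {a..b}. f s = c + indef a ?g s"
    using ae AE_lebesgue_on_space
    by eventually_elim (simp only: indef_affine_indef[OF yi])
  note i = W2_1_intro[OF ab g this]
  note j = W2_1_intro[OF ab y i(2)]
  show "f \<in> W2 a b 2" using i(1) j(1) by (simp only: W2_2_iff_wderiv[OF ab])
  show "AE s in lebesgue_on {a..b}. wderiv a b f s = d + indef a y s" by (rule i)
  show "AE s in lebesgue_on {a..b}. wderiv a b (wderiv a b f) s = y s" by (rule j)
  show "\<And>t. t \<in> {a..b} \<Longrightarrow> point_value a b f t = c + (t - a) * d + indef a (\<lambda>\<theta>. (t - \<theta>) * y \<theta>) t"
    using i(3) by (simp only: indef_affine_indef[OF yi])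
  show "\<And>t. t \<in> {a..b} \<Longrightarrow> point_value a b (wderiv a b f) t = d + indef a y t" by (rule j)
qed

lemma W2_2_elim:
  assumes ab: "a < b" and f: "f \<in> W2 a b 2"
  defines "g \<equiv> wderiv a b f" and "y \<equiv> wderiv a b (wderiv a b f)"
  shows "f \<in> W2 a b 1" "g \<in> W2 a b 1" "y \<in> L2 {a..b}"
    "AE s in lebesgue_on {a..b}. f s = point_value a b f a + (s - a) * point_value a b g a + indef a (\<lambda>\<theta>. (s - \<theta>) * y \<theta>) s"
    "AE s in lebesgue_on {a..b}. g s = point_value a b g a + indef a y s"
    "\<And>t. t \<in> {a..b} \<Longrightarrow> point_value a b f t = point_value a b f a + (t - a) * point_value a b g a + indef a (\<lambda>\<theta>. (t - \<theta>) * y \<theta>) t"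
    "\<And>t. t \<in> {a..b} \<Longrightarrow> point_value a b g t = point_value a b g a + indef a y t"
proof -
  show f1: "f \<in> W2 a b 1" and g1: "g \<in> W2 a b 1"
    using f unfolding g_def W2_2_iff_wderiv[OF ab] by blast+
  have wf: "wderiv a b f = g" and wg: "wderiv a b g = y" by (simp_all only: g_def y_def)
  note ef = W2_1_elim[OF ab f1, unfolded wf] and eg = W2_1_elim[OF ab g1, unfolded wg]
  show y: "y \<in> L2 {a..b}" by (rule eg(2))
  have eg3: "AE s in lebesgue_on {a..b}. g s = point_value a b g a + indef a y s"
    by (rule eg(3))
  show "AE s in lebesgue_on {a..b}. g s = point_value a b g a + indef a y s" by (rule eg3)
  show "\<And>t. t \<in> {a..b} \<Longrightarrow> point_value a b g t = point_value a b g a + indef a y t"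
    by (rule eg(4))
  have ind: "indef a g s = (s - a) * point_value a b g a + indef a (\<lambda>\<theta>. (s - \<theta>) * y \<theta>) s" if s: "s \<in> {a..b}" for s
    unfolding indef_affine_indef[OF L2_integrable[OF y] s, symmetric]
    using eg3 L2_integrable[OF eg(1)] s by (rule indef_AE_cong)
  show "AE s in lebesgue_on {a..b}. f s = point_value a b f a + (s - a) * point_value a b g a + indef a (\<lambda>\<theta>. (s - \<theta>) * y \<theta>) s"
    using ef(3) AE_lebesgue_on_space by eventually_elim (simp add: ind)
  show "point_value a b f t = point_value a b f a + (t - a) * point_value a b g a + indef a (\<lambda>\<theta>. (t - \<theta>) * y \<theta>) t"
    if "t \<in> {a..b}" for t
    using ef(4)[OF that] ind[OF that] by linarith
qed

lemma W2_2_lincomb: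
  assumes ab: "a < b" and f: "f \<in> W2 a b 2" and g: "g \<in> W2 a b 2" and d: "d \<in> W2 a b 2"
    and e: "\<forall>s\<in>{a..b}. e s = f s - g s - h * d s"
  shows "e \<in> W2 a b 2"
    "AE s in lebesgue_on {a..b}. wderiv a b (wderiv a b e) s
       = wderiv a b (wderiv a b f) s - wderiv a b (wderiv a b g) s - h * wderiv a b (wderiv a b d) s"
    "\<And>t. t \<in> {a..b} \<Longrightarrow> point_value a b e t = point_value a b f t - point_value a b g t - h * point_value a b d t"
    "\<And>t. t \<in> {a..b} \<Longrightarrow> point_value a b (wderiv a b e) t
       = point_value a b (wderiv a b f) t - point_value a b (wderiv a b g) t - h * point_value a b (wderiv a b d) t"
proof -
  note f' = W2_2_elim(1,2)[OF ab f] and g' = W2_2_elim(1,2)[OF ab g] and d' = W2_2_elim(1,2)[OF ab d]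
  note l = W2_1_lincomb[OF ab f'(1) g'(1) d'(1) e]
  note m = W2_1_lincomb[OF ab f'(2) g'(2) d'(2) ballI[OF refl], where h = h]
  have ae: "AE s in lebesgue_on {a..b}. wderiv a b f s - wderiv a b g s - h * wderiv a b d s = wderiv a b e s"
    using l(2) by eventually_elim simp
  note c = W2_1_AE_cong[OF ab m(1) ae]
  show "e \<in> W2 a b 2" using l(1) c(1) by (simp only: W2_2_iff_wderiv[OF ab])
  show "AE s in lebesgue_on {a..b}. wderiv a b (wderiv a b e) s
       = wderiv a b (wderiv a b f) s - wderiv a b (wderiv a b g) s - h * wderiv a b (wderiv a b d) s"
    using c(2) m(2) by eventually_elim simp
  show "\<And>t. t \<in> {a..b} \<Longrightarrow> point_value a b e t = point_value a b f t - point_value a b g t - h * point_value a b d t"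
    by (rule l(3))
  show "\<And>t. t \<in> {a..b} \<Longrightarrow> point_value a b (wderiv a b e) t
       = point_value a b (wderiv a b f) t - point_value a b (wderiv a b g) t - h * point_value a b (wderiv a b d) t"
    using c(3) m(3) by simp
qed

lemma point_value_left_bound:
  assumes ab: "a < b" and f: "f \<in> W2 a b 1"
  shows "\<bar>point_value a b f a\<bar> \<le> (1 / (b - a) + 1) * sqrt (b - a) * (l2 a b f + l2 a b (wderiv a b f))"
proof -
  let ?M = "lebesgue_on {a..b}"
  interpret finite_measure ?M by (rule finite_measure_lebesgue_on_Icc)
  have m: "measure ?M {a..b} = b - a" using ab by (simp add: measure_restrict_space)
  note e = W2_1_elim[OF ab f]
  let ?c = "point_value a b f a" and ?g = "wderiv a b f"
  define F where "F = (LINT s|?M. \<bar>f s\<bar>)"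
  define G where "G = (LINT s|?M. \<bar>?g s\<bar>)"
  (* average this bound over s *)
  have "AE s in ?M. \<bar>?c\<bar> \<le> \<bar>f s\<bar> + G"
    using e(3) AE_lebesgue_on_space
  proof eventually_elim
    case (elim s)
    with indef_bound[OF L2_integrable[OF e(2)] elim(2)] show ?case by (simp add: G_def)
  qed
  then have "(LINT s|?M. \<bar>?c\<bar>) \<le> (LINT s|?M. \<bar>f s\<bar> + G)"
    using L2_integrable[OF e(1)] by (intro integral_mono_AE) auto
  also have "\<dots> = F + (b - a) * G"
    using L2_integrable[OF e(1)] by (simp add: m F_def)
  finally have "(b - a) * \<bar>?c\<bar> \<le> F + (b - a) * G" by (simp add: m)
  then have "\<bar>?c\<bar> \<le> F / (b - a) + G"
    using ab by (simp add: field_simps)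
  also have "\<dots> \<le> (sqrt (b - a) * l2 a b f) / (b - a) + sqrt (b - a) * l2 a b ?g"
    unfolding F_def G_def using ab integral_abs_le_l2[OF ab e(1)] integral_abs_le_l2[OF ab e(2)]
    by (intro add_mono divide_right_mono) auto
  also have "\<dots> = 1 / (b - a) * sqrt (b - a) * l2 a b f + 1 * sqrt (b - a) * l2 a b ?g" by simp
  also have "\<dots> \<le> (1 / (b - a) + 1) * sqrt (b - a) * l2 a b f + (1 / (b - a) + 1) * sqrt (b - a) * l2 a b ?g"
    using ab by (intro add_mono mult_right_mono) (auto simp: l2_nonneg)
  also have "\<dots> = (1 / (b - a) + 1) * sqrt (b - a) * (l2 a b f + l2 a b ?g)"
    by (simp add: algebra_simps)
  finally show ?thesis .
qed

section \<open>Block matrices and integrals of vector functions\<close>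

lemma append_cols_carrier [simp, intro]:
  fixes A B :: "real mat"
  assumes "A \<in> carrier_mat m nc1" "B \<in> carrier_mat m nc2"
  shows "A @\<^sub>c B \<in> carrier_mat m (nc1 + nc2)"
  using assms by auto

lemma append_dims [simp]:
  fixes A B :: "real mat"
  shows "dim_row (A @\<^sub>r B) = dim_row A + dim_row B" "dim_col (A @\<^sub>r B) = dim_col A"
    "dim_row (A @\<^sub>c B) = dim_row A" "dim_col (A @\<^sub>c B) = dim_col A + dim_col B"
  by (simp_all add: append_rows_def)

lemma append_rows_mult_vec:
  fixes A B :: "real mat"
  assumes "dim_col A = dim_col B" "dim_vec u = dim_col A"
  shows "(A @\<^sub>r B) *\<^sub>v u = (A *\<^sub>v u) @\<^sub>v (B *\<^sub>v u)"
  using assms by (intro mat_mult_append[of _ "dim_row A" "dim_col A" _ "dim_row B"]) (auto intro: carrier_vecI)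

lemma append_cols_mult_vec:
  fixes A B :: "real mat"
  assumes "dim_row A = dim_row B" "dim_vec u = dim_col A" "dim_vec w = dim_col B"
    "p = dim_col A" "q = dim_col B"
  shows "four_block_mat A B (0\<^sub>m 0 p) (0\<^sub>m 0 q) *\<^sub>v (u @\<^sub>v w) = A *\<^sub>v u + B *\<^sub>v w"
proof -
  have "four_block_mat A B (0\<^sub>m 0 p) (0\<^sub>m 0 q) *\<^sub>v (u @\<^sub>v w)
      = (A *\<^sub>v u + B *\<^sub>v w) @\<^sub>v (0\<^sub>m 0 p *\<^sub>v u + 0\<^sub>m 0 q *\<^sub>v w)"
    using assms by (intro four_block_mat_mult_vec[of _ "dim_row A" "dim_col A" _ "dim_col B" _ 0])
      (auto intro: carrier_vecI)
  also have "\<dots> = A *\<^sub>v u + B *\<^sub>v w"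
    by (intro eq_vecI) auto
  finally show ?thesis .
qed

lemma zero_mult_vec:
  fixes u :: "real vec"
  assumes "dim_vec u = n" shows "0\<^sub>m m n *\<^sub>v u = 0\<^sub>v m"
  using assms by (intro eq_vecI) (auto simp: scalar_prod_def)

lemma smult_one_mult_vec:
  fixes u :: "real vec"
  assumes "dim_vec u = n" shows "(c \<cdot>\<^sub>m 1\<^sub>m n) *\<^sub>v u = c \<cdot>\<^sub>v u"
proof (intro eq_vecI)
  fix i assume "i < dim_vec (c \<cdot>\<^sub>v u)"
  then have i: "i < n" using assms by simp
  have "((c \<cdot>\<^sub>m 1\<^sub>m n) *\<^sub>v u) $ i = (\<Sum>j = 0..<n. c * (if j = i then 1 else 0) * u $ j)"
    using i assms by (simp add: scalar_prod_def)
  also have "\<dots> = (\<Sum>j = 0..<n. if j = i then c * u $ j else 0)"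
    by (intro sum.cong) auto
  also have "\<dots> = c * u $ i" using i by simp
  finally show "((c \<cdot>\<^sub>m 1\<^sub>m n) *\<^sub>v u) $ i = (c \<cdot>\<^sub>v u) $ i" using i assms by simp
qed (use assms in simp)

lemma one_mult_vec:
  fixes u :: "real vec"
  assumes "dim_vec u = n" shows "1\<^sub>m n *\<^sub>v u = u"
  using assms by (intro one_mult_mat_vec carrier_vecI)

lemma zero_add_vec:
  fixes u :: "real vec"
  assumes "dim_vec u = n" shows "0\<^sub>v n + u = u" "u + 0\<^sub>v n = u"
  using assms by (intro eq_vecI; simp)+

lemmas block_mult_simps =
  append_rows_mult_vec append_cols_mult_vec zero_mult_vec smult_one_mult_vec one_mult_vec zero_add_vec

definition slice :: "nat \<Rightarrow> nat \<Rightarrow> real vec \<Rightarrow> real vec" where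
  "slice k n v = Matrix.vec n (\<lambda>i. v $ (k + i))"

lemma slice_carrier [simp]: "slice k n v \<in> carrier_vec n"
  by (simp add: slice_def)

lemma slice_index [simp]: "i < n \<Longrightarrow> slice k n v $ i = v $ (k + i)"
  by (simp add: slice_def)

lemma slice_split:
  assumes "v \<in> carrier_vec (p + q + r)"
  shows "v = slice 0 p v @\<^sub>v slice p q v @\<^sub>v slice (p + q) r v"
  using assms by (intro eq_vecI) (auto simp: slice_def)

locale ode_pde =
  fixes P :: odepde
  assumes params: "odepde_params P"
begin

abbreviation "lo \<equiv> pa P"
abbreviation "hi \<equiv> pb P"
abbreviation "I \<equiv> {lo..hi}"
abbreviation "k1 \<equiv> n1 P"
abbreviation "k2 \<equiv> n2 P"
abbreviation "k3 \<equiv> n3 P"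
abbreviation "kp \<equiv> np P"
abbreviation "kr \<equiv> nr P"
abbreviation "ko \<equiv> no P"

lemma lo_less_hi: "lo < hi"
  using params by (simp add: odepde_params_def Let_def)

lemma kp_eq: "kp = k1 + k2 + k3" and kr_eq: "kr = k2 + k3 + k3"
  by (simp_all add: np_def nr_def)

lemma param_carriers:
  "pA P \<in> carrier_mat ko ko" "pB1 P \<in> carrier_mat ko (nu P)"
  "pB P \<in> carrier_mat kr (2 * kr)" "pBx P \<in> carrier_mat kr ko"
  "pC P \<in> carrier_mat (nz P) ko" "pC10 P \<in> carrier_mat (nz P) (2 * kr)"
  "pD P \<in> carrier_mat (nz P) (nu P)" "pE10 P \<in> carrier_mat ko (2 * kr)"
  using params by (simp_all add: odepde_params_def Let_def)

lemma param_functions: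
  "bdd_int_mat lo hi kp kp (pA0 P)" "bdd_int_mat lo hi kp (k2 + k3) (pA1 P)"
  "bdd_int_mat lo hi kp k3 (pA2 P)" "bdd_int_mat lo hi kp (nu P) (pB2 P)"
  "bdd_int_mat lo hi (nz P) kp (pCa P)" "bdd_int_mat lo hi (nz P) (k2 + k3) (pCb P)"
  "bdd_int_mat lo hi kp ko (pE P)" "bdd_int_mat lo hi ko kp (pEa P)"
  "bdd_int_mat lo hi ko (k2 + k3) (pEb P)"
  using params by (simp_all add: odepde_params_def Let_def)

lemma Tm_carrier: "Tm P \<in> carrier_mat (2 * kr) kr"
proof -
  have "Tm P \<in> carrier_mat (k2 + (k3 + (k3 + (k2 + (k3 + k3))))) (k2 + (k3 + k3))"
    unfolding Tm_def Let_def by (intro carrier_append_rows append_cols_carrier) auto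
  moreover have "k2 + (k3 + (k3 + (k2 + (k3 + k3)))) = 2 * kr" "k2 + (k3 + k3) = kr"
    by (simp_all add: kr_eq)
  ultimately show ?thesis by (simp only:)
qed

lemma Qm_carrier: "Qm P s \<theta> \<in> carrier_mat (2 * kr) kp"
proof -
  have "Qm P s \<theta> \<in> carrier_mat (k2 + (k3 + (k3 + (k2 + (k3 + k3))))) (k1 + (k2 + k3))"
    unfolding Qm_def Let_def by (intro carrier_append_rows append_cols_carrier) auto
  moreover have "k2 + (k3 + (k3 + (k2 + (k3 + k3)))) = 2 * kr" "k1 + (k2 + k3) = kp"
    by (simp_all add: kr_eq kp_eq)
  ultimately show ?thesis by (simp only:)
qed

lemma Km_carrier: "Km P s \<in> carrier_mat kp kr"
proof -
  have "Km P s \<in> carrier_mat (k1 + (k2 + k3)) (k2 + (k3 + k3))"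
    unfolding Km_def Let_def by (intro carrier_append_rows append_cols_carrier) auto
  then show ?thesis by (simp add: kr_eq kp_eq ac_simps)
qed

lemma Vm_carrier: "Vm P s \<in> carrier_mat (k2 + k3) kr"
proof -
  have "Vm P s \<in> carrier_mat (k2 + k3) (k2 + (k3 + k3))"
    unfolding Vm_def Let_def by (intro carrier_append_rows append_cols_carrier) auto
  then show ?thesis by (simp add: kr_eq ac_simps)
qed

lemma BTinv: "BTinv P \<in> carrier_mat kr kr" "pB P * Tm P * BTinv P = 1\<^sub>m kr" "BTinv P * (pB P * Tm P) = 1\<^sub>m kr"
proof -
  have BT: "pB P * Tm P \<in> carrier_mat kr kr"
    using param_carriers(3) Tm_carrier by auto
  have "invertible_mat (pB P * Tm P)"
    using params by (simp add: odepde_params_def Let_def)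
  then obtain B' where B': "inverts_mat (pB P * Tm P) B'" "inverts_mat B' (pB P * Tm P)"
    unfolding invertible_mat_def by blast
  have one: "pB P * Tm P * B' = 1\<^sub>m kr" "B' * (pB P * Tm P) = 1\<^sub>m (dim_row B')"
    using B' BT unfolding inverts_mat_def by auto
  have "B' \<in> carrier_mat kr kr"
    using one[THEN arg_cong[of _ _ dim_col]] BT by (intro carrier_matI) auto
  then have "pB P * Tm P \<in> Units (ring_mat TYPE(real) kr ())"
    using one BT unfolding Units_def by (auto simp: ring_mat_simps)
  then obtain C where "mat_inverse (pB P * Tm P) = Some C"
    using mat_inverse(1)[OF BT, where b = "()"] by (cases "mat_inverse (pB P * Tm P)") auto
  then show "BTinv P \<in> carrier_mat kr kr" "pB P * Tm P * BTinv P = 1\<^sub>m kr" "BTinv P * (pB P * Tm P) = 1\<^sub>m kr"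
    using mat_inverse(2)[OF BT] by (auto simp: BTinv_def)
qed

lemma Tm_mult:
  assumes "dim_vec c2 = k2" "dim_vec c3 = k3" "dim_vec d3 = k3"
  shows "Tm P *\<^sub>v (c2 @\<^sub>v c3 @\<^sub>v d3)
       = c2 @\<^sub>v c3 @\<^sub>v d3 @\<^sub>v c2 @\<^sub>v (c3 + (hi - lo) \<cdot>\<^sub>v d3) @\<^sub>v d3"
  unfolding Tm_def Let_def by (simp add: block_mult_simps assms)

lemma Qm_mult:
  assumes "dim_vec y1 = k1" "dim_vec y2 = k2" "dim_vec y3 = k3"
  shows "Qm P s \<theta> *\<^sub>v (y1 @\<^sub>v y2 @\<^sub>v y3)
       = 0\<^sub>v k2 @\<^sub>v 0\<^sub>v k3 @\<^sub>v 0\<^sub>v k3 @\<^sub>v y2 @\<^sub>v ((hi - \<theta>) \<cdot>\<^sub>v y3) @\<^sub>v y3"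
  unfolding Qm_def Let_def by (simp add: block_mult_simps assms)

lemma Km_mult:
  assumes "dim_vec c2 = k2" "dim_vec c3 = k3" "dim_vec d3 = k3"
  shows "Km P s *\<^sub>v (c2 @\<^sub>v c3 @\<^sub>v d3) = 0\<^sub>v k1 @\<^sub>v c2 @\<^sub>v (c3 + (s - lo) \<cdot>\<^sub>v d3)"
  unfolding Km_def Let_def by (simp add: block_mult_simps assms)

lemma Vm_mult:
  assumes "dim_vec c2 = k2" "dim_vec c3 = k3" "dim_vec d3 = k3"
  shows "Vm P s *\<^sub>v (c2 @\<^sub>v c3 @\<^sub>v d3) = 0\<^sub>v k2 @\<^sub>v d3"
  unfolding Vm_def Let_def by (simp add: block_mult_simps assms)

lemma G0_mult:
  assumes "dim_vec y1 = k1" "dim_vec y2 = k2" "dim_vec y3 = k3"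
  shows "G0 P *\<^sub>v (y1 @\<^sub>v y2 @\<^sub>v y3) = y1 @\<^sub>v 0\<^sub>v k2 @\<^sub>v 0\<^sub>v k3"
  unfolding G0_def Let_def by (simp add: block_mult_simps assms)

lemma L0m_mult:
  assumes "dim_vec y1 = k1" "dim_vec y2 = k2" "dim_vec y3 = k3"
  shows "L0m P *\<^sub>v (y1 @\<^sub>v y2 @\<^sub>v y3) = y2 @\<^sub>v 0\<^sub>v k3"
  unfolding L0m_def Let_def by (simp add: block_mult_simps assms)

lemma add_mult_vec:
  fixes A B :: "real mat"
  assumes "dim_row A = dim_row B" "dim_col A = dim_col B" "dim_vec u = dim_col A"
  shows "(A + B) *\<^sub>v u = A *\<^sub>v u + B *\<^sub>v u"
  using assms by (intro add_mult_distrib_mat_vec[of _ "dim_row A" "dim_col A"]) (auto intro: carrier_vecI)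

lemma boundary_kernel_mult:
  assumes M: "M \<in> carrier_mat m kr" and u: "u \<in> carrier_vec kp"
  shows "- (M * BTinv P * pB P * Qm P s \<theta>) *\<^sub>v u = - ((M * BTinv P * pB P) *\<^sub>v (Qm P lo \<theta> *\<^sub>v u))"
proof -
  have Q: "Qm P s \<theta> = Qm P lo \<theta>" by (simp add: Qm_def)
  have c: "M * BTinv P * pB P \<in> carrier_mat m (2 * kr)"
    using M BTinv(1) param_carriers(3) by (intro mult_carrier_mat)
  have "- (M * BTinv P * pB P * Qm P lo \<theta>) *\<^sub>v u = - ((M * BTinv P * pB P * Qm P lo \<theta>) *\<^sub>v u)"
    using c Qm_carrier[of lo \<theta>] u by (intro uminus_mult_mat_vec) auto
  also have "(M * BTinv P * pB P * Qm P lo \<theta>) *\<^sub>v u = (M * BTinv P * pB P) *\<^sub>v (Qm P lo \<theta> *\<^sub>v u)"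
    by (rule assoc_mult_mat_vec[OF c Qm_carrier u])
  finally show ?thesis by (simp only: Q)
qed

lemmas G2_mult = boundary_kernel_mult[OF Km_carrier[of s], where s = s and \<theta> = \<theta>, folded G2_def]
  and L2m_mult = boundary_kernel_mult[OF Vm_carrier[of s], where s = s and \<theta> = \<theta>, folded L2m_def]
  for s \<theta>

lemma T2_mult:
  assumes u: "u \<in> carrier_vec kp"
  shows "T2 P \<theta> *\<^sub>v u = - ((Tm P * BTinv P * pB P) *\<^sub>v (Qm P lo \<theta> *\<^sub>v u)) + Qm P lo \<theta> *\<^sub>v u"
proof -
  have c: "Tm P * BTinv P * pB P * Qm P lo \<theta> \<in> carrier_mat (2 * kr) kp"
    using Tm_carrier BTinv(1) param_carriers(3) Qm_carrier by (intro mult_carrier_mat)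
  show ?thesis
    unfolding T2_def boundary_kernel_mult[OF Tm_carrier u, of lo, symmetric]
    using c Qm_carrier u by (intro add_mult_distrib_mat_vec[of _ "2 * kr" kp]) auto
qed

lemma G1_mult:
  assumes "dim_vec y1 = k1" "dim_vec y2 = k2" "dim_vec y3 = k3"
  shows "G1 P s \<theta> *\<^sub>v (y1 @\<^sub>v y2 @\<^sub>v y3)
    = (0\<^sub>v k1 @\<^sub>v y2 @\<^sub>v ((s - \<theta>) \<cdot>\<^sub>v y3)) + G2 P s \<theta> *\<^sub>v (y1 @\<^sub>v y2 @\<^sub>v y3)"
proof -
  have "G2 P s \<theta> \<in> carrier_mat kp kp"
    unfolding G2_def using Km_carrier BTinv(1) param_carriers(3) Qm_carrier
    by (intro uminus_carrier_mat mult_carrier_mat)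
  then have "dim_row (G2 P s \<theta>) = k1 + (k2 + k3)" "dim_col (G2 P s \<theta>) = k1 + (k2 + k3)"
    by (auto simp: kp_eq)
  then show ?thesis
    unfolding G1_def Let_def
    by (subst add_mult_vec) (simp_all add: block_mult_simps assms)
qed

lemma L1m_mult:
  assumes "dim_vec y1 = k1" "dim_vec y2 = k2" "dim_vec y3 = k3"
  shows "L1m P s \<theta> *\<^sub>v (y1 @\<^sub>v y2 @\<^sub>v y3)
    = (0\<^sub>v k2 @\<^sub>v y3) + L2m P s \<theta> *\<^sub>v (y1 @\<^sub>v y2 @\<^sub>v y3)"
proof -
  have "L2m P s \<theta> \<in> carrier_mat (k2 + k3) kp"
    unfolding L2m_def using Vm_carrier BTinv(1) param_carriers(3) Qm_carrier
    by (intro uminus_carrier_mat mult_carrier_mat)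
  then have "dim_row (L2m P s \<theta>) = k2 + k3" "dim_col (L2m P s \<theta>) = k1 + (k2 + k3)"
    by (auto simp: kp_eq)
  then show ?thesis
    unfolding L1m_def Let_def
    by (subst add_mult_vec) (simp_all add: block_mult_simps assms)
qed

lemma A2_block_mult:
  assumes "dim_vec y1 = k1" "dim_vec y2 = k2" "dim_vec y3 = k3" "M \<in> carrier_mat kp k3"
  shows "(0\<^sub>m kp k1 @\<^sub>c 0\<^sub>m kp k2 @\<^sub>c M) *\<^sub>v (y1 @\<^sub>v y2 @\<^sub>v y3) = M *\<^sub>v y3"
  using assms by (simp add: block_mult_simps)

end

lemma vec_diff_add_cancel:
  fixes u v :: "real vec"
  assumes "u \<in> carrier_vec n" "v \<in> carrier_vec n"
  shows "u - v + v = u"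
  using assms by (intro eq_vecI) auto

lemma vec_add_uminus_add:
  fixes u v w :: "real vec"
  assumes "u \<in> carrier_vec n" "v \<in> carrier_vec n" "w \<in> carrier_vec n"
  shows "u + (- v + w) = u - v + w"
  using assms by (intro eq_vecI) auto

lemma append_vec_assoc: "(u @\<^sub>v v) @\<^sub>v w = u @\<^sub>v v @\<^sub>v w"
  by (intro eq_vecI) auto

definition vint_on :: "nat \<Rightarrow> real set \<Rightarrow> (real \<Rightarrow> real vec) \<Rightarrow> bool" where
  "vint_on n S f \<longleftrightarrow> (\<forall>s\<in>S. f s \<in> carrier_vec n) \<and> (\<forall>i<n. integrable (lebesgue_on S) (\<lambda>s. f s $ i))"

lemma vint_onD:
  assumes "vint_on n S f"
  shows "s \<in> S \<Longrightarrow> f s \<in> carrier_vec n" "s \<in> S \<Longrightarrow> dim_vec (f s) = n"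
    "i < n \<Longrightarrow> integrable (lebesgue_on S) (\<lambda>s. f s $ i)"
  using assms by (auto simp: vint_on_def)

lemma vintegral_carrier [simp]: "vintegral n S f \<in> carrier_vec n"
  and vintegral_dim [simp]: "dim_vec (vintegral n S f) = n"
  and vintegral_index [simp]: "i < n \<Longrightarrow> vintegral n S f $ i = (LINT s|lebesgue_on S. f s $ i)"
  by (simp_all add: vintegral_def)

lemma vint_on_cong:
  assumes "\<And>s. s \<in> S \<Longrightarrow> f s = g s"
  shows "vint_on n S f \<longleftrightarrow> vint_on n S g"
proof -
  have "integrable (lebesgue_on S) (\<lambda>s. f s $ i) \<longleftrightarrow> integrable (lebesgue_on S) (\<lambda>s. g s $ i)" for i
    using assms by (intro Bochner_Integration.integrable_cong) auto
  then show ?thesis using assms by (auto simp: vint_on_def)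
qed

lemma vintegral_cong:
  assumes "\<And>s. s \<in> S \<Longrightarrow> f s = g s"
  shows "vintegral n S f = vintegral n S g"
  using assms by (intro eq_vecI) (auto intro!: Bochner_Integration.integral_cong)

lemma vintegral_AE_cong:
  assumes f: "vint_on n {a..b} f" and ae: "AE s in lebesgue_on {a..b}. f s = g s"
  shows "vintegral n {a..b} f = vintegral n {a..b} g"
proof (intro eq_vecI)
  fix i assume "i < dim_vec (vintegral n {a..b} g)"
  then have i: "i < n" by simp
  have m: "(\<lambda>s. f s $ i) \<in> borel_measurable (lebesgue_on {a..b})"
    using vint_onD(3)[OF f i] by auto
  have ae': "AE s in lebesgue_on {a..b}. f s $ i = g s $ i"
    using ae by eventually_elim simp
  have "(LINT s|lebesgue_on {a..b}. f s $ i) = (LINT s|lebesgue_on {a..b}. g s $ i)"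
    by (rule integral_cong_AE[OF m borel_measurable_lebesgue_on_AE[OF m ae'] ae'])
  then show "vintegral n {a..b} f $ i = vintegral n {a..b} g $ i" using i by simp
qed simp

lemma vintegral_add:
  assumes f: "vint_on n S f" and g: "vint_on n S g"
  shows "vint_on n S (\<lambda>s. f s + g s)" "vintegral n S (\<lambda>s. f s + g s) = vintegral n S f + vintegral n S g"
proof -
  have eq: "integrable (lebesgue_on S) (\<lambda>s. (f s + g s) $ i) \<and>
    (LINT s|lebesgue_on S. (f s + g s) $ i) = (LINT s|lebesgue_on S. f s $ i) + (LINT s|lebesgue_on S. g s $ i)"
    if i: "i < n" for i
  proof -
    have "(f s + g s) $ i = f s $ i + g s $ i" if "s \<in> S" for s
      using vint_onD(2)[OF g that] i by simp
    then have "integrable (lebesgue_on S) (\<lambda>s. (f s + g s) $ i) \<longleftrightarrow> integrable (lebesgue_on S) (\<lambda>s. f s $ i + g s $ i)"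
      "(LINT s|lebesgue_on S. (f s + g s) $ i) = (LINT s|lebesgue_on S. f s $ i + g s $ i)"
      by (auto intro!: Bochner_Integration.integrable_cong Bochner_Integration.integral_cong)
    then show ?thesis using vint_onD(3)[OF f i] vint_onD(3)[OF g i] by simp
  qed
  show "vint_on n S (\<lambda>s. f s + g s)"
    using eq vint_onD(1)[OF f] vint_onD(1)[OF g] by (auto simp: vint_on_def)
  show "vintegral n S (\<lambda>s. f s + g s) = vintegral n S f + vintegral n S g"
    using eq by (intro eq_vecI) auto
qed

lemma mult_mat_vec_index_sum:
  fixes M :: "real mat"
  assumes "M \<in> carrier_mat m n" "v \<in> carrier_vec n" "i < m"
  shows "(M *\<^sub>v v) $ i = (\<Sum>j<n. M $$ (i, j) * v $ j)"
  using assms by (auto simp: scalar_prod_def lessThan_atLeast0)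

lemma vintegral_mult_mat:
  assumes M: "M \<in> carrier_mat m n" and f: "vint_on n S f"
  shows "vint_on m S (\<lambda>s. M *\<^sub>v f s)" "vintegral m S (\<lambda>s. M *\<^sub>v f s) = M *\<^sub>v vintegral n S f"
proof -
  have eq: "integrable (lebesgue_on S) (\<lambda>s. (M *\<^sub>v f s) $ i) \<and>
    (LINT s|lebesgue_on S. (M *\<^sub>v f s) $ i) = (M *\<^sub>v vintegral n S f) $ i" if i: "i < m" for i
  proof -
    have "(M *\<^sub>v f s) $ i = (\<Sum>j<n. M $$ (i, j) * f s $ j)" if "s \<in> S" for s
      by (rule mult_mat_vec_index_sum[OF M vint_onD(1)[OF f that] i])
    then have *: "integrable (lebesgue_on S) (\<lambda>s. (M *\<^sub>v f s) $ i) \<longleftrightarrow> integrable (lebesgue_on S) (\<lambda>s. \<Sum>j<n. M $$ (i, j) * f s $ j)"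
      "(LINT s|lebesgue_on S. (M *\<^sub>v f s) $ i) = (LINT s|lebesgue_on S. (\<Sum>j<n. M $$ (i, j) * f s $ j))"
      by (intro Bochner_Integration.integrable_cong Bochner_Integration.integral_cong; simp)+
    have int: "integrable (lebesgue_on S) (\<lambda>s. M $$ (i, j) * f s $ j)" if "j \<in> {..<n}" for j
      using vint_onD(3)[OF f, of j] that by simp
    have "(LINT s|lebesgue_on S. (\<Sum>j<n. M $$ (i, j) * f s $ j)) = (\<Sum>j<n. M $$ (i, j) * vintegral n S f $ j)"
      by (subst Bochner_Integration.integral_sum[OF int]) (auto intro!: sum.cong)
    also have "\<dots> = (M *\<^sub>v vintegral n S f) $ i"
      by (rule mult_mat_vec_index_sum[OF M vintegral_carrier i, symmetric])
    finally show ?thesis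
      unfolding * using int by (intro conjI Bochner_Integration.integrable_sum) auto
  qed
  show "vint_on m S (\<lambda>s. M *\<^sub>v f s)"
    using eq vint_onD(1)[OF f] M by (auto simp: vint_on_def)
  show "vintegral m S (\<lambda>s. M *\<^sub>v f s) = M *\<^sub>v vintegral n S f"
    using eq M by (intro eq_vecI) auto
qed

lemma vintegral_uminus:
  assumes f: "vint_on n S f"
  shows "vint_on n S (\<lambda>s. - f s)" "vintegral n S (\<lambda>s. - f s) = - vintegral n S f"
proof -
  have eq: "integrable (lebesgue_on S) (\<lambda>s. (- f s) $ i) \<and>
    (LINT s|lebesgue_on S. (- f s) $ i) = - (LINT s|lebesgue_on S. f s $ i)" if i: "i < n" for i
  proof -
    have "(- f s) $ i = - (f s $ i)" if "s \<in> S" for s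
      using vint_onD(2)[OF f that] i by simp
    then have "integrable (lebesgue_on S) (\<lambda>s. (- f s) $ i) \<longleftrightarrow> integrable (lebesgue_on S) (\<lambda>s. - (f s $ i))"
      "(LINT s|lebesgue_on S. (- f s) $ i) = (LINT s|lebesgue_on S. - (f s $ i))"
      by (intro Bochner_Integration.integrable_cong Bochner_Integration.integral_cong; simp)+
    then show ?thesis using vint_onD(3)[OF f i] by simp
  qed
  show "vint_on n S (\<lambda>s. - f s)"
    using eq vint_onD(1)[OF f] by (auto simp: vint_on_def)
  show "vintegral n S (\<lambda>s. - f s) = - vintegral n S f"
    using eq by (intro eq_vecI) auto
qed

lemma vintegral_append:
  assumes f: "vint_on m S f" and g: "vint_on n S g"
  shows "vint_on (m + n) S (\<lambda>s. f s @\<^sub>v g s)"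
    "vintegral (m + n) S (\<lambda>s. f s @\<^sub>v g s) = vintegral m S f @\<^sub>v vintegral n S g"
proof -
  have ind: "(f s @\<^sub>v g s) $ i = (if i < m then f s $ i else g s $ (i - m))" if "s \<in> S" "i < m + n" for s i
    using vint_onD(2)[OF f that(1)] vint_onD(2)[OF g that(1)] that(2) by simp
  have eq: "integrable (lebesgue_on S) (\<lambda>s. (f s @\<^sub>v g s) $ i) \<and>
    (LINT s|lebesgue_on S. (f s @\<^sub>v g s) $ i) = (vintegral m S f @\<^sub>v vintegral n S g) $ i" if i: "i < m + n" for i
  proof -
    have *: "integrable (lebesgue_on S) (\<lambda>s. (f s @\<^sub>v g s) $ i) \<longleftrightarrow> integrable (lebesgue_on S) (\<lambda>s. if i < m then f s $ i else g s $ (i - m))"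
      "(LINT s|lebesgue_on S. (f s @\<^sub>v g s) $ i) = (LINT s|lebesgue_on S. (if i < m then f s $ i else g s $ (i - m)))"
      using ind i by (intro Bochner_Integration.integrable_cong Bochner_Integration.integral_cong; simp)+
    show ?thesis
      unfolding * using i vint_onD(3)[OF f, of i] vint_onD(3)[OF g, of "i - m"] by auto
  qed
  show "vint_on (m + n) S (\<lambda>s. f s @\<^sub>v g s)"
    using eq vint_onD(1)[OF f] vint_onD(1)[OF g] by (auto simp: vint_on_def)
  show "vintegral (m + n) S (\<lambda>s. f s @\<^sub>v g s) = vintegral m S f @\<^sub>v vintegral n S g"
    using eq by (intro eq_vecI) auto
qed

lemma vint_on_subinterval:
  assumes "vint_on n {a..b} f" "{c..d} \<subseteq> {a..b}"
  shows "vint_on n {c..d} f"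
  using assms by (auto simp: vint_on_def simp del: atLeastatMost_subset_iff intro: integrable_subinterval)

lemma vintegral_combine:
  assumes f: "vint_on n {a..b} f" and s: "s \<in> {a..b}"
  shows "vintegral n {a..b} f = vintegral n {a..s} f + vintegral n {s..b} f"
proof (intro eq_vecI)
  fix i assume "i < dim_vec (vintegral n {a..s} f + vintegral n {s..b} f)"
  then have i: "i < n" by simp
  then show "vintegral n {a..b} f $ i = (vintegral n {a..s} f + vintegral n {s..b} f) $ i"
    using integral_combine[OF vint_onD(3)[OF f i], of s] s by simp
qed simp

lemma vint_on_zero: "vint_on n S (\<lambda>s. 0\<^sub>v n)" "vintegral n S (\<lambda>s. 0\<^sub>v n) = 0\<^sub>v n"
  by (auto simp: vint_on_def intro!: eq_vecI)

lemma vint_on_L2v: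
  assumes "f \<in> L2v {a..b} n"
  shows "vint_on n {a..b} f"
  using assms by (auto simp: vint_on_def L2v_def intro: L2_integrable)

lemma vint_on_continuous_smult:
  assumes f: "vint_on n {a..b} f" and h: "continuous_on {a..b} h"
  shows "vint_on n {a..b} (\<lambda>s. h s \<cdot>\<^sub>v f s)"
proof -
  have "integrable (lebesgue_on {a..b}) (\<lambda>s. (h s \<cdot>\<^sub>v f s) $ i)" if i: "i < n" for i
  proof -
    have "integrable (lebesgue_on {a..b}) (\<lambda>s. (h s \<cdot>\<^sub>v f s) $ i)
      \<longleftrightarrow> integrable (lebesgue_on {a..b}) (\<lambda>s. h s * f s $ i)"
      using vint_onD(2)[OF f] i by (intro Bochner_Integration.integrable_cong) auto
    then show ?thesis using continuous_mult_integrable[OF vint_onD(3)[OF f i] h] by simp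
  qed
  then show ?thesis using vint_onD(1)[OF f] by (auto simp: vint_on_def)
qed

lemma vint_on_bdd_mult:
  assumes F: "bdd_int_mat a b m n F" and f: "f \<in> L2v {a..b} n"
  shows "vint_on m {a..b} (\<lambda>s. F s *\<^sub>v f s)"
proof -
  have "integrable (lebesgue_on {a..b}) (\<lambda>s. (F s *\<^sub>v f s) $ i)" if i: "i < m" for i
  proof -
    have "(F s *\<^sub>v f s) $ i = (\<Sum>j<n. F s $$ (i, j) * f s $ j)" if "s \<in> {a..b}" for s
      using F f that i by (intro mult_mat_vec_index_sum[of _ m]) (auto simp: bdd_int_mat_def L2v_def)
    then have *: "integrable (lebesgue_on {a..b}) (\<lambda>s. (F s *\<^sub>v f s) $ i)
        \<longleftrightarrow> integrable (lebesgue_on {a..b}) (\<lambda>s. \<Sum>j<n. F s $$ (i, j) * f s $ j)"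
      by (intro Bochner_Integration.integrable_cong) simp_all
    show ?thesis unfolding *
    proof (rule Bochner_Integration.integrable_sum)
      fix j assume "j \<in> {..<n}"
      then have j: "j < n" by simp
      have "integrable (lebesgue_on {a..b}) (\<lambda>s. F s $$ (i, j))"
        using F i j by (auto simp: bdd_int_mat_def)
      moreover obtain B where "\<forall>s\<in>{a..b}. \<bar>F s $$ (i, j)\<bar> \<le> B"
        using F i j by (auto simp: bdd_int_mat_def) blast
      moreover have "integrable (lebesgue_on {a..b}) (\<lambda>s. f s $ j)"
        using vint_onD(3)[OF vint_on_L2v[OF f] j] .
      ultimately show "integrable (lebesgue_on {a..b}) (\<lambda>s. F s $$ (i, j) * f s $ j)"
        by (intro integrable_mult_bounded[where B = B]) auto
    qed
  qed
  then show ?thesis using F f by (auto simp: vint_on_def bdd_int_mat_def L2v_def)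
qed

lemma L2v_append:
  assumes f: "f \<in> L2v S m" and g: "g \<in> L2v S n"
  shows "(\<lambda>s. f s @\<^sub>v g s) \<in> L2v S (m + n)"
proof -
  have "(\<lambda>s. (f s @\<^sub>v g s) $ i) \<in> L2 S" if i: "i < m + n" for i
  proof -
    have "(\<lambda>s. if i < m then f s $ i else g s $ (i - m)) \<in> L2 S"
      using f g i by (cases "i < m") (auto simp: L2v_def)
    moreover have "(f s @\<^sub>v g s) $ i = (if i < m then f s $ i else g s $ (i - m))" if "s \<in> S" for s
      using f g i that by (auto simp: L2v_def dest!: bspec)
    ultimately show ?thesis by (subst L2_cong) auto
  qed
  then show ?thesis using f g by (auto simp: L2v_def)
qed

lemma slice_L2v:
  assumes "f \<in> L2v S n" "k + m \<le> n"
  shows "(\<lambda>s. slice k m (f s)) \<in> L2v S m"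
  using assms by (auto simp: L2v_def)

context ode_pde
begin

definition y1_of :: "(real \<Rightarrow> real vec) \<Rightarrow> real \<Rightarrow> real vec" where "y1_of y s = slice 0 k1 (y s)"
definition y2_of :: "(real \<Rightarrow> real vec) \<Rightarrow> real \<Rightarrow> real vec" where "y2_of y s = slice k1 k2 (y s)"
definition y3_of :: "(real \<Rightarrow> real vec) \<Rightarrow> real \<Rightarrow> real vec" where "y3_of y s = slice (k1 + k2) k3 (y s)"

lemma y_of_dims [simp]:
  "dim_vec (y1_of y s) = k1" "dim_vec (y2_of y s) = k2" "dim_vec (y3_of y s) = k3"
  by (simp_all add: y1_of_def y2_of_def y3_of_def slice_def)

lemma y_of_index [simp]:
  "i < k1 \<Longrightarrow> y1_of y s $ i = y s $ i"
  "i < k2 \<Longrightarrow> y2_of y s $ i = y s $ (k1 + i)"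
  "i < k3 \<Longrightarrow> y3_of y s $ i = y s $ (k1 + k2 + i)"
  by (simp_all add: y1_of_def y2_of_def y3_of_def)

lemma y_of_split:
  assumes "y s \<in> carrier_vec kp"
  shows "y s = y1_of y s @\<^sub>v y2_of y s @\<^sub>v y3_of y s"
  unfolding y1_of_def y2_of_def y3_of_def
  using assms by (intro slice_split) (simp add: kp_eq)

lemma y_of_L2v:
  assumes "y \<in> L2v I kp"
  shows "y1_of y \<in> L2v I k1" "y2_of y \<in> L2v I k2" "y3_of y \<in> L2v I k3"
  using slice_L2v[OF assms, of 0 k1] slice_L2v[OF assms, of k1 k2] slice_L2v[OF assms, of "k1 + k2" k3]
  by (simp_all add: y1_of_def[abs_def] y2_of_def[abs_def] y3_of_def[abs_def] kp_eq)

lemma Z_spaceD: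
  assumes "u \<in> Z_space lo hi ko kp"
  shows "fst u \<in> carrier_vec ko" "snd u \<in> L2v I kp" "s \<in> I \<Longrightarrow> snd u s \<in> carrier_vec kp"
    "s \<in> I \<Longrightarrow> dim_vec (snd u s) = kp"
  using assms by (auto simp: Z_space_def L2v_def)

definition Qint :: "(real \<Rightarrow> real vec) \<Rightarrow> real vec" where
  "Qint y = vintegral (2 * kr) I (\<lambda>\<theta>. Qm P lo \<theta> *\<^sub>v y \<theta>)"

lemma Q_integral:
  assumes y: "y \<in> L2v I kp"
  shows "vint_on (2 * kr) I (\<lambda>\<theta>. Qm P lo \<theta> *\<^sub>v y \<theta>)"
    "Qint y = 0\<^sub>v k2 @\<^sub>v 0\<^sub>v k3 @\<^sub>v 0\<^sub>v k3 @\<^sub>v vintegral k2 I (y2_of y)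
       @\<^sub>v vintegral k3 I (\<lambda>\<theta>. (hi - \<theta>) \<cdot>\<^sub>v y3_of y \<theta>) @\<^sub>v vintegral k3 I (y3_of y)"
proof -
  let ?f = "\<lambda>\<theta>. 0\<^sub>v k2 @\<^sub>v 0\<^sub>v k3 @\<^sub>v 0\<^sub>v k3 @\<^sub>v y2_of y \<theta> @\<^sub>v ((hi - \<theta>) \<cdot>\<^sub>v y3_of y \<theta>) @\<^sub>v y3_of y \<theta>"
  have Q: "Qm P lo \<theta> *\<^sub>v y \<theta> = ?f \<theta>" if "\<theta> \<in> I" for \<theta>
  proof -
    have "y \<theta> \<in> carrier_vec kp" using y that by (simp add: L2v_def)
    then show ?thesis by (subst y_of_split) (simp_all add: Qm_mult)
  qed
  note v2 = vint_on_L2v[OF y_of_L2v(2)[OF y]] and v3 = vint_on_L2v[OF y_of_L2v(3)[OF y]]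
  have v3': "vint_on k3 I (\<lambda>\<theta>. (hi - \<theta>) \<cdot>\<^sub>v y3_of y \<theta>)"
    by (intro vint_on_continuous_smult[OF v3] continuous_intros)
  note a5 = vintegral_append[OF v3' v3]
  note a4 = vintegral_append[OF v2 a5(1)]
  note a3 = vintegral_append[OF vint_on_zero(1)[of k3] a4(1)]
  note a2 = vintegral_append[OF vint_on_zero(1)[of k3] a3(1)]
  note a1 = vintegral_append[OF vint_on_zero(1)[of k2] a2(1)]
  have d: "k2 + (k3 + (k3 + (k2 + (k3 + k3)))) = 2 * kr" by (simp add: kr_eq)
  have "vint_on (2 * kr) I ?f" using a1(1) unfolding d .
  then show "vint_on (2 * kr) I (\<lambda>\<theta>. Qm P lo \<theta> *\<^sub>v y \<theta>)"
    using Q by (subst vint_on_cong[of _ _ ?f]) auto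
  have "Qint y = vintegral (2 * kr) I ?f"
    unfolding Qint_def by (intro vintegral_cong Q)
  also have "\<dots> = 0\<^sub>v k2 @\<^sub>v 0\<^sub>v k3 @\<^sub>v 0\<^sub>v k3 @\<^sub>v vintegral k2 I (y2_of y)
       @\<^sub>v vintegral k3 I (\<lambda>\<theta>. (hi - \<theta>) \<cdot>\<^sub>v y3_of y \<theta>) @\<^sub>v vintegral k3 I (y3_of y)"
    unfolding d[symmetric] a1(2) a2(2) a3(2) a4(2) a5(2) vint_on_zero(2) ..
  finally show "Qint y = 0\<^sub>v k2 @\<^sub>v 0\<^sub>v k3 @\<^sub>v 0\<^sub>v k3 @\<^sub>v vintegral k2 I (y2_of y)
       @\<^sub>v vintegral k3 I (\<lambda>\<theta>. (hi - \<theta>) \<cdot>\<^sub>v y3_of y \<theta>) @\<^sub>v vintegral k3 I (y3_of y)" .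
qed

lemma Qint_carrier [simp]: "Qint y \<in> carrier_vec (2 * kr)"
  by (simp add: Qint_def)

text \<open>The left boundary values of the state with fundamental state \<open>u\<close>.\<close>

definition cvec :: "zstate \<Rightarrow> real vec" where
  "cvec u = BTinv P *\<^sub>v (pBx P *\<^sub>v fst u - pB P *\<^sub>v Qint (snd u))"

definition xb_of :: "zstate \<Rightarrow> real vec" where
  "xb_of u = Tm P *\<^sub>v cvec u + Qint (snd u)"

lemma cvec_carrier [simp]: "cvec u \<in> carrier_vec kr"
  using BTinv(1) by (auto simp: cvec_def intro: carrier_vecI)

lemma cvec_split: "cvec u = slice 0 k2 (cvec u) @\<^sub>v slice k2 k3 (cvec u) @\<^sub>v slice (k2 + k3) k3 (cvec u)"
  by (intro slice_split) (simp flip: kr_eq)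

lemma mult_cvec:
  assumes M: "M \<in> carrier_mat m kr" and x: "fst u \<in> carrier_vec ko"
  shows "M *\<^sub>v cvec u = (M * BTinv P * pBx P) *\<^sub>v fst u - (M * BTinv P * pB P) *\<^sub>v Qint (snd u)"
proof -
  note c = param_carriers(3,4) BTinv(1)
  have MB: "M * BTinv P \<in> carrier_mat m kr" using M c(3) by (rule mult_carrier_mat)
  have "M *\<^sub>v cvec u = (M * BTinv P) *\<^sub>v (pBx P *\<^sub>v fst u - pB P *\<^sub>v Qint (snd u))"
    unfolding cvec_def using M c x by (intro assoc_mult_mat_vec[symmetric]) auto
  also have "\<dots> = (M * BTinv P) *\<^sub>v (pBx P *\<^sub>v fst u) - (M * BTinv P) *\<^sub>v (pB P *\<^sub>v Qint (snd u))"
    using MB c x by (intro mult_minus_distrib_mat_vec) auto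
  also have "(M * BTinv P) *\<^sub>v (pBx P *\<^sub>v fst u) = (M * BTinv P * pBx P) *\<^sub>v fst u"
    by (rule assoc_mult_mat_vec[symmetric, OF MB c(2) x])
  also have "(M * BTinv P) *\<^sub>v (pB P *\<^sub>v Qint (snd u)) = (M * BTinv P * pB P) *\<^sub>v Qint (snd u)"
    by (rule assoc_mult_mat_vec[symmetric, OF MB c(1) Qint_carrier])
  finally show ?thesis .
qed

lemma B_xb_of:
  assumes x: "fst u \<in> carrier_vec ko"
  shows "pB P *\<^sub>v xb_of u = pBx P *\<^sub>v fst u"
proof -
  note c = param_carriers(3,4) BTinv(1)
  let ?r = "pBx P *\<^sub>v fst u" and ?q = "pB P *\<^sub>v Qint (snd u)"
  have r: "?r \<in> carrier_vec kr" "?q \<in> carrier_vec kr" using c x by auto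
  have "pB P *\<^sub>v xb_of u = pB P *\<^sub>v (Tm P *\<^sub>v cvec u) + ?q"
    unfolding xb_of_def using c(1) Tm_carrier by (intro mult_add_distrib_mat_vec) auto
  also have "pB P *\<^sub>v (Tm P *\<^sub>v cvec u) = (pB P * Tm P) *\<^sub>v cvec u"
    using c(1) Tm_carrier by (intro assoc_mult_mat_vec[symmetric]) auto
  also have "\<dots> = (pB P * Tm P * BTinv P) *\<^sub>v (?r - ?q)"
    unfolding cvec_def using c Tm_carrier r by (intro assoc_mult_mat_vec[symmetric]) auto
  also have "\<dots> = ?r - ?q"
    unfolding BTinv(2) using r by (intro one_mult_mat_vec) auto
  also have "?r - ?q + ?q = ?r"
    by (rule vec_diff_add_cancel[OF r])
  finally show ?thesis .
qed

lemma cvec_unique: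
  assumes x: "fst u \<in> carrier_vec ko" and c: "c \<in> carrier_vec kr"
    and B: "pB P *\<^sub>v (Tm P *\<^sub>v c + Qint (snd u)) = pBx P *\<^sub>v fst u"
  shows "c = cvec u"
proof -
  note p = param_carriers(3,4) BTinv(1)
  let ?q = "pB P *\<^sub>v Qint (snd u)"
  have q: "?q \<in> carrier_vec kr" using p by auto
  have Tc: "pB P *\<^sub>v (Tm P *\<^sub>v c) = (pB P * Tm P) *\<^sub>v c"
    using p(1) Tm_carrier c by (intro assoc_mult_mat_vec[symmetric]) auto
  have BTc: "(pB P * Tm P) *\<^sub>v c \<in> carrier_vec kr"
    using p(1) Tm_carrier c by auto
  have "pB P *\<^sub>v (Tm P *\<^sub>v c + Qint (snd u)) = (pB P * Tm P) *\<^sub>v c + ?q"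
    unfolding Tc[symmetric] using p(1) Tm_carrier c by (intro mult_add_distrib_mat_vec) auto
  then have "pBx P *\<^sub>v fst u - ?q = (pB P * Tm P) *\<^sub>v c + ?q - ?q"
    using B by simp
  also have "\<dots> = (pB P * Tm P) *\<^sub>v c"
    using q BTc by (intro eq_vecI) auto
  finally have "cvec u = BTinv P *\<^sub>v ((pB P * Tm P) *\<^sub>v c)"
    by (simp add: cvec_def)
  also have "\<dots> = (BTinv P * (pB P * Tm P)) *\<^sub>v c"
    using p Tm_carrier c by (intro assoc_mult_mat_vec[symmetric]) auto
  also have "\<dots> = c" unfolding BTinv(3) using c by simp
  finally show ?thesis by simp
qed

end

context ode_pde
begin

lemma PI_op_eq:
  assumes u: "u \<in> Z_space lo hi ko kp" and s: "s \<in> I" and M: "M \<in> carrier_mat m kr"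
    and e: "vint_on m {lo..s} e" and R0: "dim_vec (R0 s *\<^sub>v snd u s) = m"
    and R1: "\<And>\<theta>. \<theta> \<in> {lo..s} \<Longrightarrow>
      R1 s \<theta> *\<^sub>v snd u \<theta> = e \<theta> + - ((M * BTinv P * pB P) *\<^sub>v (Qm P lo \<theta> *\<^sub>v snd u \<theta>))"
    and R2: "\<And>\<theta>. \<theta> \<in> {s..hi} \<Longrightarrow> R2 s \<theta> *\<^sub>v snd u \<theta> = - ((M * BTinv P * pB P) *\<^sub>v (Qm P lo \<theta> *\<^sub>v snd u \<theta>))"
  shows "(M * BTinv P * pBx P) *\<^sub>v fst u + PI_op lo hi m R0 R1 R2 (snd u) s
    = M *\<^sub>v cvec u + (R0 s *\<^sub>v snd u s + vintegral m {lo..s} e)"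
proof -
  let ?y = "snd u" and ?M = "M * BTinv P * pB P"
  let ?Q = "\<lambda>\<theta>. Qm P lo \<theta> *\<^sub>v ?y \<theta>"
  let ?q1 = "?M *\<^sub>v vintegral (2 * kr) {lo..s} ?Q" and ?q2 = "?M *\<^sub>v vintegral (2 * kr) {s..hi} ?Q"
  note x = Z_spaceD(1)[OF u]
  have M': "?M \<in> carrier_mat m (2 * kr)"
    using M BTinv(1) param_carriers(3) by (intro mult_carrier_mat)
  have sub: "{lo..s} \<subseteq> I" "{s..hi} \<subseteq> I" using s by auto
  note Q = Q_integral(1)[OF Z_spaceD(2)[OF u]]
  note MQ1 = vintegral_mult_mat[OF M' vint_on_subinterval[OF Q sub(1)]]
    and MQ2 = vintegral_mult_mat[OF M' vint_on_subinterval[OF Q sub(2)]]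
  have "vintegral m {lo..s} (\<lambda>\<theta>. R1 s \<theta> *\<^sub>v ?y \<theta>) = vintegral m {lo..s} (\<lambda>\<theta>. e \<theta> + - (?M *\<^sub>v ?Q \<theta>))"
    by (rule vintegral_cong) (rule R1)
  then have i1: "vintegral m {lo..s} (\<lambda>\<theta>. R1 s \<theta> *\<^sub>v ?y \<theta>) = vintegral m {lo..s} e + - ?q1"
    by (simp only: vintegral_add(2)[OF e vintegral_uminus(1)[OF MQ1(1)]] vintegral_uminus(2)[OF MQ1(1)] MQ1(2))
  have "vintegral m {s..hi} (\<lambda>\<theta>. R2 s \<theta> *\<^sub>v ?y \<theta>) = vintegral m {s..hi} (\<lambda>\<theta>. - (?M *\<^sub>v ?Q \<theta>))"
    by (rule vintegral_cong) (rule R2)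
  then have i2: "vintegral m {s..hi} (\<lambda>\<theta>. R2 s \<theta> *\<^sub>v ?y \<theta>) = - ?q2"
    by (simp only: vintegral_uminus(2)[OF MQ2(1)] MQ2(2))
  have q: "?M *\<^sub>v Qint ?y = ?q1 + ?q2"
    unfolding Qint_def vintegral_combine[OF Q s]
    by (rule mult_add_distrib_mat_vec[OF M']) auto
  have h: "(M * BTinv P * pBx P) *\<^sub>v fst u \<in> carrier_vec m" "?q1 \<in> carrier_vec m" "?q2 \<in> carrier_vec m"
    using M M' BTinv(1) param_carriers(4) x by (auto intro!: mult_mat_vec_carrier mult_carrier_mat)
  show ?thesis
    unfolding PI_op_def i1 i2 mult_cvec[OF M x] q
    using carrier_vecD[OF h(1)] carrier_vecD[OF h(2)] carrier_vecD[OF h(3)] R0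
    by (intro eq_vecI) (simp_all del: dim_mult_mat_vec index_mult_mat_vec)
qed

lemma G_op_eq:
  assumes u: "u \<in> Z_space lo hi ko kp" and s: "s \<in> I"
  defines "y \<equiv> snd u" and "c \<equiv> cvec u"
  shows "G_op P u s = y1_of y s
     @\<^sub>v (slice 0 k2 c + vintegral k2 {lo..s} (y2_of y))
     @\<^sub>v (slice k2 k3 c + (s - lo) \<cdot>\<^sub>v slice (k2 + k3) k3 c
          + vintegral k3 {lo..s} (\<lambda>\<theta>. (s - \<theta>) \<cdot>\<^sub>v y3_of y \<theta>))"
proof -
  note ys = Z_spaceD(3)[OF u, folded y_def] and yL = y_of_L2v[OF Z_spaceD(2)[OF u, folded y_def]]
  let ?e = "\<lambda>\<theta>. 0\<^sub>v k1 @\<^sub>v y2_of y \<theta> @\<^sub>v ((s - \<theta>) \<cdot>\<^sub>v y3_of y \<theta>)"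
  have sub: "{lo..s} \<subseteq> I" "{s..hi} \<subseteq> I" using s by auto
  note v2 = vint_on_subinterval[OF vint_on_L2v[OF yL(2)] sub(1)]
    and v3 = vint_on_subinterval[OF vint_on_L2v[OF yL(3)] sub(1)]
  have v3': "vint_on k3 {lo..s} (\<lambda>\<theta>. (s - \<theta>) \<cdot>\<^sub>v y3_of y \<theta>)"
    by (intro vint_on_continuous_smult[OF v3] continuous_intros)
  note e2 = vintegral_append[OF v2 v3']
  note e1 = vintegral_append[OF vint_on_zero(1)[of k1] e2(1)]
  have d: "k1 + (k2 + k3) = kp" by (simp add: kp_eq)
  have g0: "G0 P *\<^sub>v y s = y1_of y s @\<^sub>v 0\<^sub>v k2 @\<^sub>v 0\<^sub>v k3"
    unfolding y_of_split[of y s, OF ys[OF s]] by (subst G0_mult) (simp_all add: y1_of_def slice_def)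
  have "G_op P u s = Km P s *\<^sub>v cvec u + (G0 P *\<^sub>v snd u s + vintegral kp {lo..s} ?e)"
    unfolding G_op_def H0_def
  proof (rule PI_op_eq[OF u s Km_carrier])
    show "vint_on kp {lo..s} ?e" using e1(1) unfolding d .
    show "dim_vec (G0 P *\<^sub>v snd u s) = kp" unfolding y_def[symmetric] g0 by (simp add: kp_eq)
  next
    fix \<theta> assume "\<theta> \<in> {lo..s}"
    then have c: "y \<theta> \<in> carrier_vec kp" using ys sub by blast
    have "G1 P s \<theta> *\<^sub>v y \<theta> = ?e \<theta> + G2 P s \<theta> *\<^sub>v y \<theta>"
      unfolding y_of_split[of y, OF c] by (subst G1_mult) simp_all
    then show "G1 P s \<theta> *\<^sub>v snd u \<theta> = ?e \<theta> + - ((Km P s * BTinv P * pB P) *\<^sub>v (Qm P lo \<theta> *\<^sub>v snd u \<theta>))"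
      by (simp only: G2_mult[OF c] y_def[symmetric])
  next
    fix \<theta> assume "\<theta> \<in> {s..hi}"
    then show "G2 P s \<theta> *\<^sub>v snd u \<theta> = - ((Km P s * BTinv P * pB P) *\<^sub>v (Qm P lo \<theta> *\<^sub>v snd u \<theta>))"
      using ys sub unfolding y_def by (intro G2_mult) blast
  qed
  also have "vintegral kp {lo..s} ?e = 0\<^sub>v k1 @\<^sub>v vintegral k2 {lo..s} (y2_of y) @\<^sub>v vintegral k3 {lo..s} (\<lambda>\<theta>. (s - \<theta>) \<cdot>\<^sub>v y3_of y \<theta>)"
    unfolding d[symmetric] e1(2) e2(2) vint_on_zero(2) ..
  also have "Km P s *\<^sub>v cvec u = 0\<^sub>v k1 @\<^sub>v slice 0 k2 c @\<^sub>v (slice k2 k3 c + (s - lo) \<cdot>\<^sub>v slice (k2 + k3) k3 c)"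
    unfolding c_def by (subst cvec_split) (simp add: Km_mult slice_def)
  finally show ?thesis
    unfolding y_def[symmetric] g0 by (intro eq_vecI) (auto simp: slice_def)
qed

lemma L_op_eq:
  assumes u: "u \<in> Z_space lo hi ko kp" and s: "s \<in> I"
  defines "y \<equiv> snd u" and "c \<equiv> cvec u"
  shows "L_op P u s = y2_of y s @\<^sub>v (slice (k2 + k3) k3 c + vintegral k3 {lo..s} (y3_of y))"
proof -
  note ys = Z_spaceD(3)[OF u, folded y_def] and yL = y_of_L2v[OF Z_spaceD(2)[OF u, folded y_def]]
  let ?e = "\<lambda>\<theta>. 0\<^sub>v k2 @\<^sub>v y3_of y \<theta>"
  have sub: "{lo..s} \<subseteq> I" "{s..hi} \<subseteq> I" using s by auto
  note v3 = vint_on_subinterval[OF vint_on_L2v[OF yL(3)] sub(1)]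
  note e = vintegral_append[OF vint_on_zero(1)[of k2] v3, unfolded vint_on_zero(2)]
  have l0: "L0m P *\<^sub>v y s = y2_of y s @\<^sub>v 0\<^sub>v k3"
    unfolding y_of_split[of y s, OF ys[OF s]] by (subst L0m_mult) (simp_all add: y2_of_def slice_def)
  have "L_op P u s = Vm P s *\<^sub>v cvec u + (L0m P *\<^sub>v snd u s + vintegral (k2 + k3) {lo..s} ?e)"
    unfolding L_op_def H1_def
  proof (rule PI_op_eq[OF u s Vm_carrier e(1)])
    show "dim_vec (L0m P *\<^sub>v snd u s) = k2 + k3" unfolding y_def[symmetric] l0 by simp
  next
    fix \<theta> assume "\<theta> \<in> {lo..s}"
    then have c: "y \<theta> \<in> carrier_vec kp" using ys sub by blast
    have "L1m P s \<theta> *\<^sub>v y \<theta> = ?e \<theta> + L2m P s \<theta> *\<^sub>v y \<theta>"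
      unfolding y_of_split[of y, OF c] by (subst L1m_mult) simp_all
    then show "L1m P s \<theta> *\<^sub>v snd u \<theta> = ?e \<theta> + - ((Vm P s * BTinv P * pB P) *\<^sub>v (Qm P lo \<theta> *\<^sub>v snd u \<theta>))"
      by (simp only: L2m_mult[OF c] y_def[symmetric])
  next
    fix \<theta> assume "\<theta> \<in> {s..hi}"
    then show "L2m P s \<theta> *\<^sub>v snd u \<theta> = - ((Vm P s * BTinv P * pB P) *\<^sub>v (Qm P lo \<theta> *\<^sub>v snd u \<theta>))"
      using ys sub unfolding y_def by (intro L2m_mult) blast
  qed
  also have "Vm P s *\<^sub>v cvec u = 0\<^sub>v k2 @\<^sub>v slice (k2 + k3) k3 c"
    unfolding c_def by (subst cvec_split) (simp add: Vm_mult slice_def)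
  finally show ?thesis
    unfolding y_def[symmetric] l0 e(2) by (intro eq_vecI) (auto simp: slice_def)
qed

lemma xb_of_eq:
  assumes u: "u \<in> Z_space lo hi ko kp"
  defines "y \<equiv> snd u" and "c \<equiv> cvec u"
  shows "xb_of u = slice 0 k2 c @\<^sub>v slice k2 k3 c @\<^sub>v slice (k2 + k3) k3 c
    @\<^sub>v (slice 0 k2 c + vintegral k2 I (y2_of y))
    @\<^sub>v (slice k2 k3 c + (hi - lo) \<cdot>\<^sub>v slice (k2 + k3) k3 c
          + vintegral k3 I (\<lambda>\<theta>. (hi - \<theta>) \<cdot>\<^sub>v y3_of y \<theta>))
    @\<^sub>v (slice (k2 + k3) k3 c + vintegral k3 I (y3_of y))"
proof -
  have "Tm P *\<^sub>v c = slice 0 k2 c @\<^sub>v slice k2 k3 c @\<^sub>v slice (k2 + k3) k3 c @\<^sub>v slice 0 k2 c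
      @\<^sub>v (slice k2 k3 c + (hi - lo) \<cdot>\<^sub>v slice (k2 + k3) k3 c) @\<^sub>v slice (k2 + k3) k3 c"
    unfolding c_def by (subst cvec_split) (simp add: Tm_mult slice_def)
  then show ?thesis
    unfolding xb_of_def c_def[symmetric] y_def[symmetric]
    using Q_integral(2)[OF Z_spaceD(2)[OF u]]
    by (intro eq_vecI) (auto simp: slice_def y_def)
qed

lemma T1_T2_xb_of:
  assumes u: "u \<in> Z_space lo hi ko kp" and N: "N \<in> carrier_mat m (2 * kr)"
  shows "vint_on m I (\<lambda>s. N *\<^sub>v (T2 P s *\<^sub>v snd u s))"
    "(N * T1 P) *\<^sub>v fst u + vintegral m I (\<lambda>s. N *\<^sub>v (T2 P s *\<^sub>v snd u s)) = N *\<^sub>v xb_of u"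
proof -
  let ?y = "snd u"
  let ?M = "Tm P * BTinv P * pB P"
  let ?Q = "\<lambda>\<theta>. Qm P lo \<theta> *\<^sub>v ?y \<theta>"
  note x = Z_spaceD(1)[OF u]
  have M: "?M \<in> carrier_mat (2 * kr) (2 * kr)"
    using Tm_carrier BTinv(1) param_carriers(3) by (intro mult_carrier_mat)
  have T1: "T1 P \<in> carrier_mat (2 * kr) ko"
    unfolding T1_def using Tm_carrier BTinv(1) param_carriers(4) by (intro mult_carrier_mat)
  note Q = Q_integral(1)[OF Z_spaceD(2)[OF u]]
  note MQ = vintegral_mult_mat[OF M Q]
  have T2: "T2 P s *\<^sub>v ?y s = - (?M *\<^sub>v ?Q s) + ?Q s" if "s \<in> I" for s
    by (rule T2_mult[OF Z_spaceD(3)[OF u that]])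
  note v = vintegral_add[OF vintegral_uminus(1)[OF MQ(1)] Q]
  have T2v: "vint_on (2 * kr) I (\<lambda>s. T2 P s *\<^sub>v ?y s)"
    using v(1) by (subst vint_on_cong[OF T2])
  have T2i: "vintegral (2 * kr) I (\<lambda>s. T2 P s *\<^sub>v ?y s) = - (?M *\<^sub>v Qint ?y) + Qint ?y"
  proof -
    have "vintegral (2 * kr) I (\<lambda>s. T2 P s *\<^sub>v ?y s) = vintegral (2 * kr) I (\<lambda>s. - (?M *\<^sub>v ?Q s) + ?Q s)"
      by (rule vintegral_cong) (rule T2)
    then show ?thesis
      by (simp only: v(2) vintegral_uminus(2)[OF MQ(1)] MQ(2) Qint_def)
  qed
  note NT = vintegral_mult_mat[OF N T2v]
  show "vint_on m I (\<lambda>s. N *\<^sub>v (T2 P s *\<^sub>v snd u s))" by (rule NT)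
  have "(N * T1 P) *\<^sub>v fst u = N *\<^sub>v (T1 P *\<^sub>v fst u)"
    by (rule assoc_mult_mat_vec[OF N T1 x])
  then have "(N * T1 P) *\<^sub>v fst u + vintegral m I (\<lambda>s. N *\<^sub>v (T2 P s *\<^sub>v snd u s))
    = N *\<^sub>v (T1 P *\<^sub>v fst u) + N *\<^sub>v (- (?M *\<^sub>v Qint ?y) + Qint ?y)"
    by (simp only: NT(2) T2i)
  also have "\<dots> = N *\<^sub>v (T1 P *\<^sub>v fst u + (- (?M *\<^sub>v Qint ?y) + Qint ?y))"
    using T1 M by (intro mult_add_distrib_mat_vec[OF N, symmetric]) (auto intro: carrier_vecI)
  also have "T1 P *\<^sub>v fst u + (- (?M *\<^sub>v Qint ?y) + Qint ?y) = (T1 P *\<^sub>v fst u - ?M *\<^sub>v Qint ?y) + Qint ?y"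
  proof -
    have "T1 P *\<^sub>v fst u \<in> carrier_vec (2 * kr)" "?M *\<^sub>v Qint ?y \<in> carrier_vec (2 * kr)"
      using T1 M x by (auto intro!: mult_mat_vec_carrier)
    then show ?thesis by (intro vec_add_uminus_add[of _ "2 * kr"]) auto
  qed
  also have "\<dots> = xb_of u"
    unfolding xb_of_def mult_cvec[OF Tm_carrier x] T1_def ..
  finally show "(N * T1 P) *\<^sub>v fst u + vintegral m I (\<lambda>s. N *\<^sub>v (T2 P s *\<^sub>v snd u s)) = N *\<^sub>v xb_of u" .
qed

lemma G_op_L2v:
  assumes u: "u \<in> Z_space lo hi ko kp"
  shows "G_op P u \<in> L2v I kp"
proof -
  let ?c = "cvec u" and ?y = "snd u"
  note y = Z_spaceD(2)[OF u]
  have G: "G_op P u s = y1_of ?y s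
     @\<^sub>v (slice 0 k2 ?c + vintegral k2 {lo..s} (y2_of ?y))
     @\<^sub>v (slice k2 k3 ?c + (s - lo) \<cdot>\<^sub>v slice (k2 + k3) k3 ?c
          + vintegral k3 {lo..s} (\<lambda>\<theta>. (s - \<theta>) \<cdot>\<^sub>v y3_of ?y \<theta>))" if "s \<in> I" for s
    using G_op_eq[OF u that] .
  have comp: "(\<lambda>s. G_op P u s $ i) \<in> L2 I" if i: "i < kp" for i
  proof -
    consider "i < k1" | j where "i = k1 + j" "j < k2" | j where "i = k1 + k2 + j" "j < k3"
      using i unfolding kp_eq by (metis add.assoc add_diff_inverse_nat nat_add_left_cancel_less)
    then show ?thesis
    proof cases
      case 1
      have "G_op P u s $ i = ?y s $ i" if "s \<in> I" for s
        using 1 by (simp add: G[OF that])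
      then show ?thesis
        using y i by (subst L2_cong[of _ _ "\<lambda>s. ?y s $ i"]) (auto simp: L2v_def)
    next
      case 2
      have "integrable (lebesgue_on I) (\<lambda>s. ?y s $ (k1 + j))"
        using vint_onD(3)[OF vint_on_L2v[OF y], of "k1 + j"] 2 i by simp
      then have "(\<lambda>s. slice 0 k2 ?c $ j + indef lo (\<lambda>s. ?y s $ (k1 + j)) s) \<in> L2 I"
        by (intro L2_continuous continuous_affine_indef)
      moreover have "G_op P u s $ i = slice 0 k2 ?c $ j + indef lo (\<lambda>s. ?y s $ (k1 + j)) s" if "s \<in> I" for s
        using 2 by (simp add: G[OF that] slice_def)
      ultimately show ?thesis
        by (subst L2_cong[of _ _ "\<lambda>s. slice 0 k2 ?c $ j + indef lo (\<lambda>s. ?y s $ (k1 + j)) s"]) auto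
    next
      case 3
      let ?f = "\<lambda>s. slice k2 k3 ?c $ j + (s - lo) * slice (k2 + k3) k3 ?c $ j + indef lo (\<lambda>\<theta>. (s - \<theta>) * ?y \<theta> $ (k1 + k2 + j)) s"
      have "(\<lambda>s. ?y s $ (k1 + k2 + j)) \<in> L2 I"
        using y 3 i by (auto simp: L2v_def)
      then have "?f \<in> W2 lo hi 2"
        by (intro W2_2_intro(1)[OF lo_less_hi]) auto
      then have "?f \<in> L2 I" by (simp add: W2_2_iff)
      moreover have "G_op P u s $ i = ?f s" if "s \<in> I" for s
        using 3 by (simp add: G[OF that] slice_def)
      ultimately show ?thesis by (subst L2_cong[of _ _ ?f]) auto
    qed
  qed
  have "G_op P u s \<in> carrier_vec kp" if "s \<in> I" for s
    by (intro carrier_vecI) (simp add: G[OF that] kp_eq slice_def)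
  with comp show ?thesis by (simp add: L2v_def)
qed

lemma L_op_L2v:
  assumes u: "u \<in> Z_space lo hi ko kp"
  shows "L_op P u \<in> L2v I (k2 + k3)"
proof -
  let ?c = "cvec u" and ?y = "snd u"
  note y = Z_spaceD(2)[OF u]
  have L: "L_op P u s = y2_of ?y s @\<^sub>v (slice (k2 + k3) k3 ?c + vintegral k3 {lo..s} (y3_of ?y))" if "s \<in> I" for s
    using L_op_eq[OF u that] .
  have comp: "(\<lambda>s. L_op P u s $ i) \<in> L2 I" if i: "i < k2 + k3" for i
  proof (cases "i < k2")
    case True
    have "L_op P u s $ i = ?y s $ (k1 + i)" if "s \<in> I" for s
      using True by (simp add: L[OF that])
    then show ?thesis
      using y True by (subst L2_cong[of _ _ "\<lambda>s. ?y s $ (k1 + i)"]) (auto simp: L2v_def kp_eq)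
  next
    case False
    then obtain j where j: "i = k2 + j" "j < k3" using i by (metis le_add_diff_inverse nat_add_left_cancel_less not_less)
    let ?f = "\<lambda>s. slice (k2 + k3) k3 ?c $ j + indef lo (\<lambda>s. ?y s $ (k1 + k2 + j)) s"
    have "integrable (lebesgue_on I) (\<lambda>s. ?y s $ (k1 + k2 + j))"
      using vint_onD(3)[OF vint_on_L2v[OF y], of "k1 + k2 + j"] j by (simp add: kp_eq)
    then have "?f \<in> L2 I"
      by (intro L2_continuous continuous_affine_indef)
    moreover have "L_op P u s $ i = ?f s" if "s \<in> I" for s
      using j by (simp add: L[OF that] slice_def)
    ultimately show ?thesis by (subst L2_cong[of _ _ ?f]) auto
  qed
  have "L_op P u s \<in> carrier_vec (k2 + k3)" if "s \<in> I" for s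
    by (intro carrier_vecI) (simp add: L[OF that] slice_def)
  with comp show ?thesis by (simp add: L2v_def)
qed

lemma output_formula:
  assumes u: "u \<in> Z_space lo hi ko kp" and M: "M \<in> carrier_mat m ko" and N: "N \<in> carrier_mat m (2 * kr)"
    and F: "bdd_int_mat lo hi m kp F" and H: "bdd_int_mat lo hi m (k2 + k3) H"
  shows "(M + N * T1 P) *\<^sub>v fst u
      + vintegral m I (\<lambda>s. N *\<^sub>v (T2 P s *\<^sub>v snd u s) + F s *\<^sub>v G_op P u s + H s *\<^sub>v L_op P u s)
    = M *\<^sub>v fst u + N *\<^sub>v xb_of u + vintegral m I (\<lambda>s. F s *\<^sub>v G_op P u s) + vintegral m I (\<lambda>s. H s *\<^sub>v L_op P u s)"
proof -
  note x = Z_spaceD(1)[OF u]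
  have T1: "T1 P \<in> carrier_mat (2 * kr) ko"
    unfolding T1_def using Tm_carrier BTinv(1) param_carriers(4) by (intro mult_carrier_mat)
  have NT: "N * T1 P \<in> carrier_mat m ko" using N T1 by auto
  note t = T1_T2_xb_of[OF u N]
  note f = vint_on_bdd_mult[OF F G_op_L2v[OF u]] and h = vint_on_bdd_mult[OF H L_op_L2v[OF u]]
  note v1 = vintegral_add[OF t(1) f]
  note v2 = vintegral_add[OF v1(1) h]
  have d: "(M + N * T1 P) *\<^sub>v fst u = M *\<^sub>v fst u + (N * T1 P) *\<^sub>v fst u"
    by (rule add_mult_distrib_mat_vec[OF M NT x])
  have dims: "dim_vec (M *\<^sub>v fst u) = m" "dim_vec ((N * T1 P) *\<^sub>v fst u) = m"
    using M NT by auto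
  show ?thesis
    unfolding d v2(2) v1(2) t(2)[symmetric] using dims
    by (intro eq_vecI) (simp_all del: dim_mult_mat_vec index_mult_mat_vec)
qed

end

section \<open>The fundamental state\<close>

lemma AE_finite_all_less:
  fixes Q :: "nat \<Rightarrow> 'b \<Rightarrow> bool"
  assumes "\<And>i. i < n \<Longrightarrow> AE s in M. Q i s"
  shows "AE s in M. \<forall>i<n. Q i s"
  using assms by (subst AE_all_countable) auto

context ode_pde
begin

abbreviation "wd \<equiv> wderiv lo hi"
abbreviation "pv \<equiv> point_value lo hi"

fun stackD :: "pstate \<Rightarrow> real \<Rightarrow> real vec" where
  "stackD (x1, x2, x3) s = x1 s @\<^sub>v pds lo hi k2 x2 s @\<^sub>v (pds lo hi k3 ^^ 2) x3 s"

text \<open>\<open>u\<close> is the fundamental state of the boundary-compatible state \<open>(fst u, X)\<close>.\<close>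

definition fundamental :: "zstate \<Rightarrow> pstate \<Rightarrow> bool" where
  "fundamental u X \<longleftrightarrow> u \<in> Z_space lo hi ko kp \<and> X \<in> X_space P \<and>
     (AE s in lebesgue_on I. snd u s = stackD X s) \<and> pB P *\<^sub>v x_b P X = pBx P *\<^sub>v fst u"

lemma pds_index [simp]: "i < n \<Longrightarrow> pds lo hi n f s $ i = wd (\<lambda>r. f r $ i) s"
  by (simp add: pds_def)

lemma pds_dim [simp]: "dim_vec (pds lo hi n f s) = n"
  by (simp add: pds_def)

lemma pds_pds_index [simp]: "i < n \<Longrightarrow> (pds lo hi n ^^ 2) f s $ i = wd (wd (\<lambda>r. f r $ i)) s"
  by (simp add: numeral_2_eq_2)

lemma pds_pds_dim [simp]: "dim_vec ((pds lo hi n ^^ 2) f s) = n"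
  by (simp add: numeral_2_eq_2)

lemma point_valuev_index [simp]: "i < n \<Longrightarrow> point_valuev lo hi n f c $ i = pv (\<lambda>r. f r $ i) c"
  and point_valuev_dim [simp]: "dim_vec (point_valuev lo hi n f c) = n"
  by (simp_all add: point_valuev_def)

lemma X_spaceD:
  assumes "(x1, x2, x3) \<in> X_space P"
  shows "x1 \<in> L2v I k1" "s \<in> I \<Longrightarrow> dim_vec (x1 s) = k1" "s \<in> I \<Longrightarrow> dim_vec (x2 s) = k2" "s \<in> I \<Longrightarrow> dim_vec (x3 s) = k3"
    "i < k1 \<Longrightarrow> (\<lambda>s. x1 s $ i) \<in> L2 I"
    "i < k2 \<Longrightarrow> (\<lambda>s. x2 s $ i) \<in> W2 lo hi 1"
    "i < k3 \<Longrightarrow> (\<lambda>s. x3 s $ i) \<in> W2 lo hi 2"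
  using assms unfolding X_space_def by (auto simp: L2v_def W2v_def simp del: One_nat_def W2.simps)

lemma x_b_dim: "dim_vec (x_b P X) = 2 * kr"
  by (cases X) (simp add: x_b_def kr_eq)

lemma kp_cases:
  assumes "i < kp"
  obtains "i < k1" | j where "i = k1 + j" "j < k2" | j where "i = k1 + k2 + j" "j < k3"
  using assms unfolding kp_eq by (metis add.assoc add_diff_inverse_nat nat_add_left_cancel_less)

lemma fundamental_components:
  assumes f: "fundamental u (x1, x2, x3)"
  shows "i < k1 \<Longrightarrow> AE s in lebesgue_on I. snd u s $ i = x1 s $ i"
    "i < k2 \<Longrightarrow> AE s in lebesgue_on I. snd u s $ (k1 + i) = wd (\<lambda>s. x2 s $ i) s"
    "i < k3 \<Longrightarrow> AE s in lebesgue_on I. snd u s $ (k1 + k2 + i) = wd (wd (\<lambda>s. x3 s $ i)) s"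
proof -
  have X: "(x1, x2, x3) \<in> X_space P" and ae: "AE s in lebesgue_on I. snd u s = stackD (x1, x2, x3) s"
    using f by (auto simp: fundamental_def)
  note d = X_spaceD(2)[OF X]
  show "AE s in lebesgue_on I. snd u s $ i = x1 s $ i" if "i < k1"
    using ae AE_lebesgue_on_space by eventually_elim (use that d in simp)
  show "AE s in lebesgue_on I. snd u s $ (k1 + i) = wd (\<lambda>s. x2 s $ i) s" if "i < k2"
    using ae AE_lebesgue_on_space by eventually_elim (use that d in simp)
  show "AE s in lebesgue_on I. snd u s $ (k1 + k2 + i) = wd (wd (\<lambda>s. x3 s $ i)) s" if "i < k3"
    using ae AE_lebesgue_on_space by eventually_elim (use that d in simp)
qed

lemma fundamental_L2:
  assumes "u \<in> Z_space lo hi ko kp" "i < kp"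
  shows "(\<lambda>s. snd u s $ i) \<in> L2 I"
  using Z_spaceD(2)[OF assms(1)] assms(2) by (auto simp: L2v_def)

lemma indef_weight_cong:
  assumes "AE s in lebesgue_on I. f s = g s" "f \<in> L2 I" "s \<in> I"
  shows "indef lo f s = indef lo g s" "indef lo (\<lambda>\<theta>. (s - \<theta>) * f \<theta>) s = indef lo (\<lambda>\<theta>. (s - \<theta>) * g \<theta>) s"
proof -
  show "indef lo f s = indef lo g s"
    by (rule indef_AE_cong[OF assms(1) L2_integrable[OF assms(2)] assms(3)])
  show "indef lo (\<lambda>\<theta>. (s - \<theta>) * f \<theta>) s = indef lo (\<lambda>\<theta>. (s - \<theta>) * g \<theta>) s"
  proof (rule indef_AE_cong[where a = lo and b = hi])
    show "AE \<theta> in lebesgue_on I. (s - \<theta>) * f \<theta> = (s - \<theta>) * g \<theta>"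
      using assms(1) by eventually_elim simp
    show "integrable (lebesgue_on I) (\<lambda>\<theta>. (s - \<theta>) * f \<theta>)"
      by (intro continuous_mult_integrable L2_integrable assms continuous_intros)
  qed (rule assms)
qed

lemma fundamental_traces:
  assumes f: "fundamental u (x1, x2, x3)" and t: "t \<in> I"
  defines "y \<equiv> snd u"
  shows "i < k2 \<Longrightarrow> pv (\<lambda>s. x2 s $ i) t = pv (\<lambda>s. x2 s $ i) lo + indef lo (\<lambda>\<theta>. y \<theta> $ (k1 + i)) t"
    "i < k3 \<Longrightarrow> pv (\<lambda>s. x3 s $ i) t = pv (\<lambda>s. x3 s $ i) lo + (t - lo) * pv (wd (\<lambda>s. x3 s $ i)) lo
        + indef lo (\<lambda>\<theta>. (t - \<theta>) * y \<theta> $ (k1 + k2 + i)) t"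
    "i < k3 \<Longrightarrow> pv (wd (\<lambda>s. x3 s $ i)) t = pv (wd (\<lambda>s. x3 s $ i)) lo + indef lo (\<lambda>\<theta>. y \<theta> $ (k1 + k2 + i)) t"
proof -
  have X: "(x1, x2, x3) \<in> X_space P" and u: "u \<in> Z_space lo hi ko kp"
    using f by (auto simp: fundamental_def)
  note comp = fundamental_components[OF f, folded y_def]
  show "pv (\<lambda>s. x2 s $ i) t = pv (\<lambda>s. x2 s $ i) lo + indef lo (\<lambda>\<theta>. y \<theta> $ (k1 + i)) t" if i: "i < k2"
  proof -
    have "(\<lambda>s. y s $ (k1 + i)) \<in> L2 I" using fundamental_L2[OF u, of "k1 + i"] i by (simp add: y_def kp_eq)
    from indef_weight_cong(1)[OF comp(2)[OF i] this t] W2_1_elim(4)[OF lo_less_hi X_spaceD(6)[OF X i] t]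
    show ?thesis by linarith
  qed
  assume i: "i < k3"
  have L: "(\<lambda>s. y s $ (k1 + k2 + i)) \<in> L2 I" using fundamental_L2[OF u, of "k1 + k2 + i"] i by (simp add: y_def kp_eq)
  note e = W2_2_elim(6,7)[OF lo_less_hi X_spaceD(7)[OF X i] t]
  show "pv (\<lambda>s. x3 s $ i) t = pv (\<lambda>s. x3 s $ i) lo + (t - lo) * pv (wd (\<lambda>s. x3 s $ i)) lo
        + indef lo (\<lambda>\<theta>. (t - \<theta>) * y \<theta> $ (k1 + k2 + i)) t"
    using indef_weight_cong(2)[OF comp(3)[OF i] L t] e(1) by linarith
  show "pv (wd (\<lambda>s. x3 s $ i)) t = pv (wd (\<lambda>s. x3 s $ i)) lo + indef lo (\<lambda>\<theta>. y \<theta> $ (k1 + k2 + i)) t"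
    using indef_weight_cong(1)[OF comp(3)[OF i] L t] e(2) by linarith
qed

lemma Tm_Qint_eq:
  assumes u: "u \<in> Z_space lo hi ko kp" and d: "dim_vec c2 = k2" "dim_vec c3 = k3" "dim_vec d3 = k3"
  shows "Tm P *\<^sub>v (c2 @\<^sub>v c3 @\<^sub>v d3) + Qint (snd u) = c2 @\<^sub>v c3 @\<^sub>v d3
    @\<^sub>v (c2 + vintegral k2 I (y2_of (snd u)))
    @\<^sub>v (c3 + (hi - lo) \<cdot>\<^sub>v d3 + vintegral k3 I (\<lambda>\<theta>. (hi - \<theta>) \<cdot>\<^sub>v y3_of (snd u) \<theta>))
    @\<^sub>v (d3 + vintegral k3 I (y3_of (snd u)))"
  unfolding Tm_mult[OF d] Q_integral(2)[OF Z_spaceD(2)[OF u]]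
  by (intro eq_vecI) (auto simp: d)

lemma x_c_lo_eq_cvec:
  assumes f: "fundamental u X"
  shows "x_c P X lo = cvec u" "x_b P X = xb_of u"
proof -
  obtain x1 x2 x3 where Xe: "X = (x1, x2, x3)" by (cases X)
  have u: "u \<in> Z_space lo hi ko kp" and B: "pB P *\<^sub>v x_b P X = pBx P *\<^sub>v fst u"
    using f by (auto simp: fundamental_def)
  have hi: "hi \<in> I" using lo_less_hi by simp
  note t = fundamental_traces[OF f[unfolded Xe] hi]
  have "x_c P X hi = (point_valuev lo hi k2 x2 lo + vintegral k2 I (y2_of (snd u)))
    @\<^sub>v (point_valuev lo hi k3 x3 lo + (hi - lo) \<cdot>\<^sub>v point_valuev lo hi k3 (pds lo hi k3 x3) lo
        + vintegral k3 I (\<lambda>\<theta>. (hi - \<theta>) \<cdot>\<^sub>v y3_of (snd u) \<theta>))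
    @\<^sub>v (point_valuev lo hi k3 (pds lo hi k3 x3) lo + vintegral k3 I (y3_of (snd u)))"
    unfolding Xe by (simp, intro conjI eq_vecI; simp add: t)
  then have xb: "x_b P X = Tm P *\<^sub>v x_c P X lo + Qint (snd u)"
    unfolding x_b_def Xe by (simp add: Tm_Qint_eq[OF u] append_vec_assoc)
  have c: "x_c P X lo \<in> carrier_vec kr"
    unfolding Xe by (intro carrier_vecI) (simp add: kr_eq)
  show "x_c P X lo = cvec u"
    using cvec_unique[OF Z_spaceD(1)[OF u] c] B unfolding xb by simp
  then show "x_b P X = xb_of u" by (simp add: xb xb_of_def)
qed

lemma cvec_index:
  assumes f: "fundamental u (x1, x2, x3)"
  shows "i < k2 \<Longrightarrow> cvec u $ i = pv (\<lambda>s. x2 s $ i) lo"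
    "i < k3 \<Longrightarrow> cvec u $ (k2 + i) = pv (\<lambda>s. x3 s $ i) lo"
    "i < k3 \<Longrightarrow> cvec u $ (k2 + k3 + i) = pv (wd (\<lambda>s. x3 s $ i)) lo"
  unfolding x_c_lo_eq_cvec(1)[OF f, symmetric] by simp_all

lemma fundamental_AE:
  assumes f: "fundamental u X"
  shows "AE s in lebesgue_on I. stack X s = G_op P u s"
    "AE s in lebesgue_on I. stack_s P X s = L_op P u s"
    "AE s in lebesgue_on I. x3_ss P X s = y3_of (snd u) s"
proof -
  obtain x1 x2 x3 where Xe: "X = (x1, x2, x3)" by (cases X)
  note f' = f[unfolded Xe]
  have X: "(x1, x2, x3) \<in> X_space P" and u: "u \<in> Z_space lo hi ko kp"
    using f' by (auto simp: fundamental_def)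
  note comp = fundamental_components[OF f'] and c = cvec_index[OF f']
  let ?y = "snd u"
  have y3: "AE s in lebesgue_on I. \<forall>i<k3. ?y s $ (k1 + k2 + i) = wd (wd (\<lambda>s. x3 s $ i)) s"
    by (intro AE_finite_all_less comp)
  have y2: "AE s in lebesgue_on I. \<forall>i<k2. ?y s $ (k1 + i) = wd (\<lambda>s. x2 s $ i) s"
    by (intro AE_finite_all_less comp)
  have y1: "AE s in lebesgue_on I. \<forall>i<k1. ?y s $ i = x1 s $ i"
    by (intro AE_finite_all_less comp)
  have x2: "AE s in lebesgue_on I. \<forall>i<k2. x2 s $ i = cvec u $ i + indef lo (\<lambda>\<theta>. ?y \<theta> $ (k1 + i)) s"
  proof (rule AE_finite_all_less)
    fix i assume i: "i < k2"
    have L: "(\<lambda>s. ?y s $ (k1 + i)) \<in> L2 I" using fundamental_L2[OF u, of "k1 + i"] i by (simp add: kp_eq)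
    show "AE s in lebesgue_on I. x2 s $ i = cvec u $ i + indef lo (\<lambda>\<theta>. ?y \<theta> $ (k1 + i)) s"
      using W2_1_elim(3)[OF lo_less_hi X_spaceD(6)[OF X i]] AE_lebesgue_on_space
    proof eventually_elim
      case (elim s)
      show ?case using indef_weight_cong(1)[OF comp(2)[OF i] L elim(2)] elim(1) c(1)[OF i] by linarith
    qed
  qed
  have x3: "AE s in lebesgue_on I. \<forall>i<k3. x3 s $ i = cvec u $ (k2 + i) + (s - lo) * cvec u $ (k2 + k3 + i)
      + indef lo (\<lambda>\<theta>. (s - \<theta>) * ?y \<theta> $ (k1 + k2 + i)) s \<and>
      wd (\<lambda>s. x3 s $ i) s = cvec u $ (k2 + k3 + i) + indef lo (\<lambda>\<theta>. ?y \<theta> $ (k1 + k2 + i)) s"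
  proof (rule AE_finite_all_less)
    fix i assume i: "i < k3"
    have L: "(\<lambda>s. ?y s $ (k1 + k2 + i)) \<in> L2 I" using fundamental_L2[OF u, of "k1 + k2 + i"] i by (simp add: kp_eq)
    show "AE s in lebesgue_on I. x3 s $ i = cvec u $ (k2 + i) + (s - lo) * cvec u $ (k2 + k3 + i)
      + indef lo (\<lambda>\<theta>. (s - \<theta>) * ?y \<theta> $ (k1 + k2 + i)) s \<and>
      wd (\<lambda>s. x3 s $ i) s = cvec u $ (k2 + k3 + i) + indef lo (\<lambda>\<theta>. ?y \<theta> $ (k1 + k2 + i)) s"
      using W2_2_elim(4,5)[OF lo_less_hi X_spaceD(7)[OF X i]] AE_lebesgue_on_space
    proof eventually_elim
      case (elim s)
      show ?case
        unfolding c(2,3)[OF i] indef_weight_cong[OF comp(3)[OF i] L elim(3)] using elim(1,2) by simp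
    qed
  qed
  show "AE s in lebesgue_on I. stack X s = G_op P u s"
    using y1 x2 x3 AE_lebesgue_on_space
  proof eventually_elim
    case (elim s)
    note d = X_spaceD(2-4)[OF X elim(4)]
    show ?case
      unfolding G_op_eq[OF u elim(4)] Xe
      using elim(1-3) by (simp add: append_vec_eq[OF carrier_vecI[OF d(1)] carrier_vecI]
          append_vec_eq[OF carrier_vecI[OF d(2)] carrier_vecI] slice_def)
        (intro conjI eq_vecI; simp add: d slice_def)
  qed
  show "AE s in lebesgue_on I. stack_s P X s = L_op P u s"
    using y2 x3 AE_lebesgue_on_space
  proof eventually_elim
    case (elim s)
    show ?case
      unfolding L_op_eq[OF u elim(3)] Xe using elim(1,2)
      by (intro eq_vecI) (auto simp: slice_def)
  qed
  show "AE s in lebesgue_on I. x3_ss P X s = y3_of (snd u) s"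
    using y3
  proof eventually_elim
    case (elim s)
    then show ?case unfolding Xe by (intro eq_vecI) auto
  qed
qed

definition unstack :: "(real \<Rightarrow> real vec) \<Rightarrow> pstate" where
  "unstack g = (\<lambda>s. slice 0 k1 (g s), \<lambda>s. slice k1 k2 (g s), \<lambda>s. slice (k1 + k2) k3 (g s))"

lemma fundamental_unstack:
  assumes u: "u \<in> Z_space lo hi ko kp"
  shows "fundamental u (unstack (G_op P u))"
proof -
  let ?y = "snd u" and ?c = "cvec u"
  let ?X = "unstack (G_op P u)"
  define x1 x2 x3 where "x1 = (\<lambda>s. slice 0 k1 (G_op P u s))" and "x2 = (\<lambda>s. slice k1 k2 (G_op P u s))"
    and "x3 = (\<lambda>s. slice (k1 + k2) k3 (G_op P u s))"
  have Xe: "?X = (x1, x2, x3)" by (simp add: unstack_def x1_def x2_def x3_def)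
  have G: "G_op P u s = y1_of ?y s
     @\<^sub>v (slice 0 k2 ?c + vintegral k2 {lo..s} (y2_of ?y))
     @\<^sub>v (slice k2 k3 ?c + (s - lo) \<cdot>\<^sub>v slice (k2 + k3) k3 ?c
          + vintegral k3 {lo..s} (\<lambda>\<theta>. (s - \<theta>) \<cdot>\<^sub>v y3_of ?y \<theta>))" if "s \<in> I" for s
    using G_op_eq[OF u that] .
  have X1: "x1 s = y1_of ?y s" if "s \<in> I" for s
    by (intro eq_vecI) (auto simp: x1_def G[OF that] slice_def)
  have x1L: "x1 \<in> L2v I k1"
    using slice_L2v[OF G_op_L2v[OF u], of 0 k1] by (simp add: x1_def kp_eq)
  have X2: "x2 s $ i = ?c $ i + indef lo (\<lambda>\<theta>. ?y \<theta> $ (k1 + i)) s" if "s \<in> I" "i < k2" for s i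
    using that by (simp add: x2_def G slice_def)
  have X3: "x3 s $ i = ?c $ (k2 + i) + (s - lo) * ?c $ (k2 + k3 + i)
      + indef lo (\<lambda>\<theta>. (s - \<theta>) * ?y \<theta> $ (k1 + k2 + i)) s" if "s \<in> I" "i < k3" for s i
    using that by (simp add: x3_def G slice_def)
  have L2: "(\<lambda>s. ?y s $ (k1 + i)) \<in> L2 I" if "i < k2" for i
    using fundamental_L2[OF u, of "k1 + i"] that by (simp add: kp_eq)
  have L3: "(\<lambda>s. ?y s $ (k1 + k2 + i)) \<in> L2 I" if "i < k3" for i
    using fundamental_L2[OF u, of "k1 + k2 + i"] that by (simp add: kp_eq)
  have ae2: "AE s in lebesgue_on I. x2 s $ i = ?c $ i + indef lo (\<lambda>\<theta>. ?y \<theta> $ (k1 + i)) s" if "i < k2" for i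
    using AE_lebesgue_on_space by eventually_elim (rule X2[OF _ that])
  have ae3: "AE s in lebesgue_on I. x3 s $ i = ?c $ (k2 + i) + (s - lo) * ?c $ (k2 + k3 + i)
      + indef lo (\<lambda>\<theta>. (s - \<theta>) * ?y \<theta> $ (k1 + k2 + i)) s" if "i < k3" for i
    using AE_lebesgue_on_space by eventually_elim (rule X3[OF _ that])
  note w2 = W2_1_intro[OF lo_less_hi L2 ae2] and w3 = W2_2_intro[OF lo_less_hi L3 ae3]
  have XX: "?X \<in> X_space P"
    unfolding Xe X_space_def using x1L w2(1) w3(1)
    by (auto simp: W2v_def x2_def x3_def simp del: W2.simps One_nat_def)
  have yw2: "AE s in lebesgue_on I. \<forall>i<k2. wd (\<lambda>s. x2 s $ i) s = ?y s $ (k1 + i)"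
    by (intro AE_finite_all_less w2(2))
  have yw3: "AE s in lebesgue_on I. \<forall>i<k3. wd (wd (\<lambda>s. x3 s $ i)) s = ?y s $ (k1 + k2 + i)"
    by (intro AE_finite_all_less w3(3))
  have AE: "AE s in lebesgue_on I. ?y s = stackD ?X s"
    using yw2 yw3 AE_lebesgue_on_space
  proof eventually_elim
    case (elim s)
    have "stackD ?X s = y1_of ?y s @\<^sub>v y2_of ?y s @\<^sub>v y3_of ?y s"
      unfolding Xe using elim(1,2)
      by (simp add: X1[OF elim(3)] append_vec_eq[OF carrier_vecI carrier_vecI])
        (intro conjI eq_vecI; auto)
    then show ?case using y_of_split[of ?y s, OF Z_spaceD(3)[OF u elim(3)]] by simp
  qed
  have lh: "lo \<in> I" "hi \<in> I" using lo_less_hi by auto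
  have "x_b P ?X = slice 0 k2 ?c @\<^sub>v slice k2 k3 ?c @\<^sub>v slice (k2 + k3) k3 ?c
    @\<^sub>v (slice 0 k2 ?c + vintegral k2 I (y2_of ?y))
    @\<^sub>v (slice k2 k3 ?c + (hi - lo) \<cdot>\<^sub>v slice (k2 + k3) k3 ?c
          + vintegral k3 I (\<lambda>\<theta>. (hi - \<theta>) \<cdot>\<^sub>v y3_of ?y \<theta>))
    @\<^sub>v (slice (k2 + k3) k3 ?c + vintegral k3 I (y3_of ?y))"
  proof -
    have "x_c P ?X lo = slice 0 k2 ?c @\<^sub>v slice k2 k3 ?c @\<^sub>v slice (k2 + k3) k3 ?c"
      unfolding Xe using w2(3)[OF _ _ lh(1)] w3(4,5)[OF _ _ lh(1)]
      by (intro eq_vecI) (auto simp: slice_def)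
    moreover have "x_c P ?X hi = (slice 0 k2 ?c + vintegral k2 I (y2_of ?y))
    @\<^sub>v (slice k2 k3 ?c + (hi - lo) \<cdot>\<^sub>v slice (k2 + k3) k3 ?c
          + vintegral k3 I (\<lambda>\<theta>. (hi - \<theta>) \<cdot>\<^sub>v y3_of ?y \<theta>))
    @\<^sub>v (slice (k2 + k3) k3 ?c + vintegral k3 I (y3_of ?y))"
      unfolding Xe using w2(3)[OF _ _ lh(2)] w3(4,5)[OF _ _ lh(2)]
      by (intro eq_vecI) (auto simp: slice_def)
    ultimately show ?thesis
      by (simp only: x_b_def append_vec_assoc)
  qed
  then have "x_b P ?X = xb_of u" using xb_of_eq[OF u] by simp
  then show ?thesis
    unfolding fundamental_def using u XX AE B_xb_of[OF Z_spaceD(1)[OF u]] by simp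
qed

end

section \<open>Norm estimates and the equations\<close>

lemma scalar_prod_self_sum:
  fixes v :: "real vec"
  assumes "v \<in> carrier_vec n"
  shows "v \<bullet> v = (\<Sum>i<n. (v $ i)\<^sup>2)"
  using assms by (simp add: scalar_prod_def power2_eq_square lessThan_atLeast0)

lemma l2_sq: "(l2 a b f)\<^sup>2 = (LINT s|lebesgue_on {a..b}. (f s)\<^sup>2)"
  by (simp add: l2_def integral_nonneg_AE)

lemma L2_inner_self_sum:
  assumes f: "f \<in> L2v {a..b} n"
  shows "L2_inner {a..b} f f = (\<Sum>i<n. (l2 a b (\<lambda>s. f s $ i))\<^sup>2)"
proof -
  have "L2_inner {a..b} f f = (LINT s|lebesgue_on {a..b}. (\<Sum>i<n. (f s $ i)\<^sup>2))"
    unfolding L2_inner_def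
    by (intro Bochner_Integration.integral_cong) (use f in \<open>auto simp: L2v_def intro!: scalar_prod_self_sum\<close>)
  also have "\<dots> = (\<Sum>i<n. LINT s|lebesgue_on {a..b}. (f s $ i)\<^sup>2)"
    by (rule Bochner_Integration.integral_sum) (use f in \<open>auto simp: L2v_def L2_def\<close>)
  finally show ?thesis by (simp add: l2_sq)
qed

lemma L2_norm_sq:
  assumes "f \<in> L2v {a..b} n"
  shows "(L2_norm {a..b} f)\<^sup>2 = (\<Sum>i<n. (l2 a b (\<lambda>s. f s $ i))\<^sup>2)"
  unfolding L2_norm_def L2_inner_self_sum[OF assms] by (simp add: sum_nonneg)

lemma L2_norm_nonneg:
  assumes "f \<in> L2v {a..b} n"
  shows "0 \<le> L2_norm {a..b} f"
  unfolding L2_norm_def L2_inner_self_sum[OF assms] by (simp add: sum_nonneg)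

lemma L2_norm_le_sum:
  assumes "f \<in> L2v {a..b} n"
  shows "L2_norm {a..b} f \<le> (\<Sum>i<n. l2 a b (\<lambda>s. f s $ i))"
  unfolding L2_norm_def L2_inner_self_sum[OF assms]
  using L2_set_le_sum[of "{..<n}" "\<lambda>i. l2 a b (\<lambda>s. f s $ i)"] by (simp add: L2_set_def l2_nonneg)

lemma l2_le_L2_norm:
  assumes f: "f \<in> L2v {a..b} n" and i: "i < n"
  shows "l2 a b (\<lambda>s. f s $ i) \<le> L2_norm {a..b} f"
proof (rule power2_le_imp_le)
  show "(l2 a b (\<lambda>s. f s $ i))\<^sup>2 \<le> (L2_norm {a..b} f)\<^sup>2"
    unfolding L2_norm_sq[OF f] using i by (intro member_le_sum) auto
qed (rule L2_norm_nonneg[OF f])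

lemma sum_lessThan_add:
  fixes f :: "nat \<Rightarrow> real"
  shows "(\<Sum>i<m + n. f i) = (\<Sum>i<m. f i) + (\<Sum>i<n. f (m + i))"
  by (induction n) auto

lemma sqrt_sum_squares2_le: "0 \<le> x \<Longrightarrow> 0 \<le> y \<Longrightarrow> sqrt (x\<^sup>2 + y\<^sup>2) \<le> x + (y::real)"
  by (intro real_le_lsqrt) (auto simp: power2_sum)

lemma sqrt_sum_squares3_le:
  fixes x y z :: real
  assumes "0 \<le> x" "0 \<le> y" "0 \<le> z"
  shows "sqrt (x\<^sup>2 + y\<^sup>2 + z\<^sup>2) \<le> x + y + z"
proof (rule real_le_lsqrt)
  have "0 \<le> x * y" "0 \<le> x * z" "0 \<le> y * z" using assms by auto
  then show "x\<^sup>2 + y\<^sup>2 + z\<^sup>2 \<le> (x + y + z)\<^sup>2"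
    by (simp add: power2_eq_square algebra_simps)
qed (use assms in auto)

lemma vnorm_nonneg: "0 \<le> vnorm x"
  by (simp add: vnorm_def scalar_prod_def sum_nonneg)

lemma vnorm_sq: "(vnorm x)\<^sup>2 = x \<bullet> x"
  by (simp add: vnorm_def scalar_prod_def sum_nonneg)

lemma abs_index_le_vnorm:
  assumes "x \<in> carrier_vec n" "i < n"
  shows "\<bar>x $ i\<bar> \<le> vnorm x"
proof (rule power2_le_imp_le)
  show "\<bar>x $ i\<bar>\<^sup>2 \<le> (vnorm x)\<^sup>2"
    unfolding vnorm_sq scalar_prod_self_sum[OF assms(1)] power2_abs
    using assms(2) by (intro member_le_sum) auto
qed (rule vnorm_nonneg)

definition dominated :: "'u set \<Rightarrow> ('u \<Rightarrow> real) \<Rightarrow> ('u \<Rightarrow> real) \<Rightarrow> bool" where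
  "dominated S N F \<longleftrightarrow> (\<exists>C\<ge>0. \<forall>u\<in>S. \<bar>F u\<bar> \<le> C * N u)"

lemma dominatedI: "0 \<le> C \<Longrightarrow> (\<And>u. u \<in> S \<Longrightarrow> \<bar>F u\<bar> \<le> C * N u) \<Longrightarrow> dominated S N F"
  by (auto simp: dominated_def)

lemma dominated_self: "(\<And>u. u \<in> S \<Longrightarrow> \<bar>F u\<bar> \<le> N u) \<Longrightarrow> dominated S N F"
  by (rule dominatedI[of 1]) auto

lemma dominated_mono:
  assumes "dominated S N G" "\<And>u. u \<in> S \<Longrightarrow> \<bar>F u\<bar> \<le> \<bar>G u\<bar>"
  shows "dominated S N F"
  using assms unfolding dominated_def by (meson order_trans)

lemma dominated_zero: "dominated S N (\<lambda>u. 0)"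
  by (rule dominatedI[of 0]) auto

lemma dominated_cmult: "dominated S N F \<Longrightarrow> dominated S N (\<lambda>u. c * F u)"
proof -
  assume "dominated S N F"
  then obtain C where "C \<ge> 0" and C: "\<forall>u\<in>S. \<bar>F u\<bar> \<le> C * N u" by (auto simp: dominated_def)
  then show ?thesis
    by (intro dominatedI[of "\<bar>c\<bar> * C"]) (auto simp: abs_mult mult.assoc intro: mult_left_mono)
qed

lemma dominated_add:
  assumes "dominated S N F" "dominated S N G"
  shows "dominated S N (\<lambda>u. F u + G u)"
proof -
  obtain C D where "C \<ge> 0" "D \<ge> 0" and C: "\<forall>u\<in>S. \<bar>F u\<bar> \<le> C * N u" and D: "\<forall>u\<in>S. \<bar>G u\<bar> \<le> D * N u"
    using assms by (auto simp: dominated_def)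
  show ?thesis
  proof (rule dominatedI[of "C + D"])
    fix u assume u: "u \<in> S"
    show "\<bar>F u + G u\<bar> \<le> (C + D) * N u"
      using bspec[OF C u] bspec[OF D u] abs_triangle_ineq[of "F u" "G u"] by (simp add: distrib_right)
  qed (use \<open>C \<ge> 0\<close> \<open>D \<ge> 0\<close> in simp)
qed

lemma dominated_diff:
  assumes "dominated S N F" "dominated S N G"
  shows "dominated S N (\<lambda>u. F u - G u)"
  using dominated_add[OF assms(1) dominated_cmult[OF assms(2), of "-1"]] by simp

lemma dominated_abs: "dominated S N F \<Longrightarrow> dominated S N (\<lambda>u. \<bar>F u\<bar>)"
  by (erule dominated_mono) simp

lemma dominated_sum:
  "(\<And>i. i < (n::nat) \<Longrightarrow> dominated S N (F i)) \<Longrightarrow> dominated S N (\<lambda>u. \<Sum>i<n. F i u)"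
proof (induction n)
  case 0
  show ?case by (simp add: dominated_zero)
next
  case (Suc n)
  then show ?case by (simp add: dominated_add)
qed

definition vdominated :: "'u set \<Rightarrow> ('u \<Rightarrow> real) \<Rightarrow> nat \<Rightarrow> ('u \<Rightarrow> real vec) \<Rightarrow> bool" where
  "vdominated S N n f \<longleftrightarrow> (\<forall>u\<in>S. f u \<in> carrier_vec n) \<and> (\<forall>i<n. dominated S N (\<lambda>u. f u $ i))"

lemma vdominatedD:
  assumes "vdominated S N n f"
  shows "u \<in> S \<Longrightarrow> f u \<in> carrier_vec n" "i < n \<Longrightarrow> dominated S N (\<lambda>u. f u $ i)"
  using assms by (auto simp: vdominated_def)

lemma vdominated_zero: "vdominated S N n (\<lambda>u. 0\<^sub>v n)"
  by (auto simp: vdominated_def dominated_zero)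

lemma vdominated_append:
  assumes f: "vdominated S N m f" and g: "vdominated S N n g"
  shows "vdominated S N (m + n) (\<lambda>u. f u @\<^sub>v g u)"
  unfolding vdominated_def
proof (intro conjI ballI allI impI)
  fix u assume "u \<in> S"
  then show "f u @\<^sub>v g u \<in> carrier_vec (m + n)"
    using vdominatedD(1)[OF f] vdominatedD(1)[OF g] by simp
next
  fix i assume i: "i < m + n"
  have eq: "(f u @\<^sub>v g u) $ i = (if i < m then f u $ i else g u $ (i - m))" if "u \<in> S" for u
    using carrier_vecD[OF vdominatedD(1)[OF f that]] carrier_vecD[OF vdominatedD(1)[OF g that]] i by simp
  have "dominated S N (\<lambda>u. if i < m then f u $ i else g u $ (i - m))"
    using vdominatedD(2)[OF f, of i] vdominatedD(2)[OF g, of "i - m"] i by (cases "i < m") auto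
  then show "dominated S N (\<lambda>u. (f u @\<^sub>v g u) $ i)"
    by (rule dominated_mono) (simp add: eq)
qed

lemma vdominated_mult_mat:
  assumes M: "M \<in> carrier_mat m n" and f: "vdominated S N n f"
  shows "vdominated S N m (\<lambda>u. M *\<^sub>v f u)"
  unfolding vdominated_def
proof (intro conjI ballI allI impI)
  fix u assume "u \<in> S"
  then show "M *\<^sub>v f u \<in> carrier_vec m" using M vdominatedD(1)[OF f] by auto
next
  fix i assume i: "i < m"
  have "dominated S N (\<lambda>u. \<Sum>j<n. M $$ (i, j) * f u $ j)"
    by (intro dominated_sum dominated_cmult vdominatedD(2)[OF f])
  then show "dominated S N (\<lambda>u. (M *\<^sub>v f u) $ i)"
    by (rule dominated_mono) (simp add: mult_mat_vec_index_sum[OF M vdominatedD(1)[OF f] i])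
qed

lemma vdominated_diff:
  assumes f: "vdominated S N n f" and g: "vdominated S N n g"
  shows "vdominated S N n (\<lambda>u. f u - g u)"
  unfolding vdominated_def
proof (intro conjI ballI allI impI)
  fix u assume "u \<in> S"
  then show "f u - g u \<in> carrier_vec n" using vdominatedD(1)[OF g] by (auto intro: carrier_vecI)
next
  fix i assume i: "i < n"
  show "dominated S N (\<lambda>u. (f u - g u) $ i)"
    using dominated_diff[OF vdominatedD(2)[OF f i] vdominatedD(2)[OF g i]]
    by (rule dominated_mono) (use i carrier_vecD[OF vdominatedD(1)[OF g]] in simp)
qed

lemma l2_W2_1_bound:
  assumes ab: "a < b" and f: "f \<in> W2 a b 1"
  shows "l2 a b f \<le> sqrt (b - a) * (\<bar>point_value a b f a\<bar> + sqrt (b - a) * l2 a b (wderiv a b f))"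
proof -
  note e = W2_1_elim[OF ab f]
  have "AE s in lebesgue_on {a..b}. \<bar>f s\<bar> \<le> \<bar>point_value a b f a\<bar> + sqrt (b - a) * l2 a b (wderiv a b f)"
    using e(3) AE_lebesgue_on_space
  proof eventually_elim
    case (elim s)
    show ?case
      using indef_bound[OF L2_integrable[OF e(2)] elim(2)] integral_abs_le_l2[OF ab e(2)] elim(1) by linarith
  qed
  then show ?thesis
    using ab by (intro l2_le_bound[OF ab e(1)]) (auto simp: l2_nonneg)
qed

lemma indef_l2_bound:
  assumes ab: "a < b" and f: "f \<in> L2 {a..b}" and s: "s \<in> {a..b}"
  shows "\<bar>indef a f s\<bar> \<le> sqrt (b - a) * l2 a b f"
  using indef_bound[OF L2_integrable[OF f] s] integral_abs_le_l2[OF ab f] by linarith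

lemma weighted_indef_l2_bound:
  assumes ab: "a < b" and f: "f \<in> L2 {a..b}"
  shows "\<bar>indef a (\<lambda>\<theta>. (b - \<theta>) * f \<theta>) b\<bar> \<le> (b - a) * (sqrt (b - a) * l2 a b f)"
proof -
  let ?M = "lebesgue_on {a..b}"
  have i: "integrable ?M (\<lambda>\<theta>. (b - \<theta>) * f \<theta>)"
    by (intro continuous_mult_integrable L2_integrable f continuous_intros)
  have "\<bar>indef a (\<lambda>\<theta>. (b - \<theta>) * f \<theta>) b\<bar> \<le> (LINT \<theta>|?M. \<bar>(b - \<theta>) * f \<theta>\<bar>)"
    using indef_bound[OF i, of b] ab by simp
  also have "\<dots> \<le> (LINT \<theta>|?M. (b - a) * \<bar>f \<theta>\<bar>)"
  proof (rule integral_mono)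
    show "integrable ?M (\<lambda>\<theta>. \<bar>(b - \<theta>) * f \<theta>\<bar>)" using i by (rule integrable_abs)
    show "integrable ?M (\<lambda>\<theta>. (b - a) * \<bar>f \<theta>\<bar>)" using L2_integrable[OF f] by simp
  qed (auto simp: abs_mult intro!: mult_right_mono)
  also have "\<dots> \<le> (b - a) * (sqrt (b - a) * l2 a b f)"
    using integral_abs_le_l2[OF ab f] ab by simp
  finally show ?thesis .
qed

context ode_pde
begin

lemma equations_iff:
  assumes fu: "fundamental u X" and fd: "fundamental d Xd" and w: "w \<in> carrier_vec (nu P)"
  shows "odepde_equations P w (fst u) X z (fst d) Xd \<longleftrightarrow>
    Z_eq lo hi (T_op P d) (Z_add (A_op P u) (B_op P w)) \<and> z = C_op P u + D_op P w"
proof -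
  have u: "u \<in> Z_space lo hi ko kp" and B: "pB P *\<^sub>v x_b P X = pBx P *\<^sub>v fst u"
    using fu by (auto simp: fundamental_def)
  note ae = fundamental_AE[OF fu] and xb = x_c_lo_eq_cvec(2)[OF fu]
  have intG: "vintegral m I (\<lambda>s. F s *\<^sub>v stack X s) = vintegral m I (\<lambda>s. F s *\<^sub>v G_op P u s)"
    if "bdd_int_mat lo hi m kp F" for m F
  proof (rule vintegral_AE_cong[symmetric, OF vint_on_bdd_mult[OF that G_op_L2v[OF u]]])
    show "AE s in lebesgue_on I. F s *\<^sub>v G_op P u s = F s *\<^sub>v stack X s"
      using ae(1) by eventually_elim simp
  qed
  have intL: "vintegral m I (\<lambda>s. F s *\<^sub>v stack_s P X s) = vintegral m I (\<lambda>s. F s *\<^sub>v L_op P u s)"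
    if "bdd_int_mat lo hi m (k2 + k3) F" for m F
  proof (rule vintegral_AE_cong[symmetric, OF vint_on_bdd_mult[OF that L_op_L2v[OF u]]])
    show "AE s in lebesgue_on I. F s *\<^sub>v L_op P u s = F s *\<^sub>v stack_s P X s"
      using ae(2) by eventually_elim simp
  qed
  have A: "fst (A_op P u) = pA P *\<^sub>v fst u + pE10 P *\<^sub>v x_b P X
         + vintegral ko I (\<lambda>s. pEa P s *\<^sub>v stack X s) + vintegral ko I (\<lambda>s. pEb P s *\<^sub>v stack_s P X s)"
    unfolding A_op_def fst_conv intG[OF param_functions(8)] intL[OF param_functions(9)] xb
    by (rule output_formula[OF u param_carriers(1,8) param_functions(8,9)])
  have C: "C_op P u = pC P *\<^sub>v fst u + pC10 P *\<^sub>v x_b P X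
         + vintegral (nz P) I (\<lambda>s. pCa P s *\<^sub>v stack X s) + vintegral (nz P) I (\<lambda>s. pCb P s *\<^sub>v stack_s P X s)"
    unfolding C_op_def intG[OF param_functions(5)] intL[OF param_functions(6)] xb
    by (rule output_formula[OF u param_carriers(5,6) param_functions(5,6)])
  have "AE s in lebesgue_on I. (stack Xd s = pE P s *\<^sub>v fst u + pA0 P s *\<^sub>v stack X s + pA1 P s *\<^sub>v stack_s P X s
           + pA2 P s *\<^sub>v x3_ss P X s + pB2 P s *\<^sub>v w)
       \<longleftrightarrow> (snd (T_op P d) s = snd (Z_add (A_op P u) (B_op P w)) s)"
    using ae fundamental_AE(1)[OF fd] AE_lebesgue_on_space
  proof eventually_elim
    case (elim s)
    note c = param_functions[unfolded bdd_int_mat_def, THEN conjunct1, THEN bspec[OF _ elim(5)]]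
    have y: "snd u s \<in> carrier_vec kp" using Z_spaceD(3)[OF u elim(5)] .
    have A2: "(0\<^sub>m kp k1 @\<^sub>c 0\<^sub>m kp k2 @\<^sub>c pA2 P s) *\<^sub>v snd u s = pA2 P s *\<^sub>v y3_of (snd u) s"
      by (subst (1) y_of_split[of "snd u", OF y]) (rule A2_block_mult[OF _ _ _ c(3)], simp_all)
    have d: "dim_row (pE P s) = kp" "dim_row (pA0 P s) = kp" "dim_row (pA1 P s) = kp" "dim_row (pA2 P s) = kp"
      using c by auto
    have comm: "pE P s *\<^sub>v fst u + pA0 P s *\<^sub>v G_op P u s + pA1 P s *\<^sub>v L_op P u s + pA2 P s *\<^sub>v y3_of (snd u) s
      = pE P s *\<^sub>v fst u + pA2 P s *\<^sub>v y3_of (snd u) s + pA0 P s *\<^sub>v G_op P u s + pA1 P s *\<^sub>v L_op P u s"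
      by (intro eq_vecI) (simp_all add: d del: index_mult_mat_vec)
    show ?case
      unfolding elim(1-4) T_op_def Z_add_def A_op_def B_op_def snd_conv fst_conv A2 comm ..
  qed
  then have ae_iff: "(AE s in lebesgue_on I. stack Xd s = pE P s *\<^sub>v fst u + pA0 P s *\<^sub>v stack X s + pA1 P s *\<^sub>v stack_s P X s
           + pA2 P s *\<^sub>v x3_ss P X s + pB2 P s *\<^sub>v w)
       \<longleftrightarrow> (AE s in lebesgue_on I. snd (T_op P d) s = snd (Z_add (A_op P u) (B_op P w)) s)"
    by (rule eventually_subst)
  have f: "fst (T_op P d) = fst d" "fst (Z_add (A_op P u) (B_op P w)) = fst (A_op P u) + pB1 P *\<^sub>v w"
    by (simp_all add: T_op_def Z_add_def B_op_def)
  show ?thesis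
    unfolding odepde_equations_def Let_def Z_eq_def ae_iff f A C D_op_def using B by auto
qed

lemma Z_norm_eq:
  assumes u: "u \<in> Z_space lo hi ko kp"
  shows "Z_norm lo hi u = sqrt ((vnorm (fst u))\<^sup>2 + (L2_norm I (snd u))\<^sup>2)"
  unfolding Z_norm_def Z_inner_def vnorm_sq L2_norm_sq[OF Z_spaceD(2)[OF u]] L2_inner_self_sum[OF Z_spaceD(2)[OF u]] ..

lemma Z_norm_bounds:
  assumes u: "u \<in> Z_space lo hi ko kp"
  shows "vnorm (fst u) \<le> Z_norm lo hi u" "L2_norm I (snd u) \<le> Z_norm lo hi u"
    "Z_norm lo hi u \<le> vnorm (fst u) + L2_norm I (snd u)" "0 \<le> Z_norm lo hi u"
    "i < kp \<Longrightarrow> l2 lo hi (\<lambda>s. snd u s $ i) \<le> Z_norm lo hi u"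
proof -
  note y = Z_spaceD(2)[OF u] and n = vnorm_nonneg[of "fst u"] and l = L2_norm_nonneg[OF Z_spaceD(2)[OF u]]
  show "vnorm (fst u) \<le> Z_norm lo hi u"
    unfolding Z_norm_eq[OF u] by (rule real_le_rsqrt) simp
  show 2: "L2_norm I (snd u) \<le> Z_norm lo hi u"
    unfolding Z_norm_eq[OF u] by (rule real_le_rsqrt) simp
  show "Z_norm lo hi u \<le> vnorm (fst u) + L2_norm I (snd u)"
    unfolding Z_norm_eq[OF u] using n l by (rule sqrt_sum_squares2_le)
  show "0 \<le> Z_norm lo hi u" unfolding Z_norm_eq[OF u] by simp
  show "i < kp \<Longrightarrow> l2 lo hi (\<lambda>s. snd u s $ i) \<le> Z_norm lo hi u"
    using l2_le_L2_norm[OF y, of i] 2 by linarith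
qed

lemma pds_L2v:
  assumes X: "(x1, x2, x3) \<in> X_space P"
  shows "x2 \<in> L2v I k2" "pds lo hi k2 x2 \<in> L2v I k2" "x3 \<in> L2v I k3" "pds lo hi k3 x3 \<in> L2v I k3"
    "(pds lo hi k3 ^^ 2) x3 \<in> L2v I k3"
proof -
  have 2: "(\<lambda>s. x2 s $ i) \<in> L2 I" "wd (\<lambda>s. x2 s $ i) \<in> L2 I" if "i < k2" for i
    using W2_1_elim(1,2)[OF lo_less_hi X_spaceD(6)[OF X that]] by auto
  have 3: "(\<lambda>s. x3 s $ i) \<in> L2 I" "wd (\<lambda>s. x3 s $ i) \<in> L2 I" "wd (wd (\<lambda>s. x3 s $ i)) \<in> L2 I" if "i < k3" for i
  proof -
    note e = W2_2_elim(1-3)[OF lo_less_hi X_spaceD(7)[OF X that]]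
    show "(\<lambda>s. x3 s $ i) \<in> L2 I" "wd (\<lambda>s. x3 s $ i) \<in> L2 I" "wd (wd (\<lambda>s. x3 s $ i)) \<in> L2 I"
      using W2_1_elim(1)[OF lo_less_hi e(1)] W2_1_elim(1)[OF lo_less_hi e(2)] e(3) by auto
  qed
  note c = X_spaceD(3,4)[OF X, THEN carrier_vecI]
  show "x2 \<in> L2v I k2" "x3 \<in> L2v I k3" using 2 3 c by (auto simp: L2v_def)
  show "pds lo hi k2 x2 \<in> L2v I k2" "pds lo hi k3 x3 \<in> L2v I k3" "(pds lo hi k3 ^^ 2) x3 \<in> L2v I k3"
    using 2 3 by (auto simp: L2v_def intro!: carrier_vecI)
qed

lemma W2_norm_1: "W2_norm lo hi 1 n f = sqrt ((L2_norm I f)\<^sup>2 + (L2_norm I (pds lo hi n f))\<^sup>2)"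
  by (simp add: W2_norm_def)

lemma W2_norm_2: "W2_norm lo hi 2 n f = sqrt ((L2_norm I f)\<^sup>2 + (L2_norm I (pds lo hi n f))\<^sup>2 + (L2_norm I ((pds lo hi n ^^ 2) f))\<^sup>2)"
  by (simp add: W2_norm_def numeral_2_eq_2)

lemma X_norm_eq:
  "X_norm P (x1, x2, x3) = sqrt ((L2_norm I x1)\<^sup>2 + ((L2_norm I x2)\<^sup>2 + (L2_norm I (pds lo hi k2 x2))\<^sup>2)
    + ((L2_norm I x3)\<^sup>2 + (L2_norm I (pds lo hi k3 x3))\<^sup>2 + (L2_norm I ((pds lo hi k3 ^^ 2) x3))\<^sup>2))"
  by (simp add: W2_norm_1[simplified] W2_norm_2)

lemma X_norm_bounds:
  assumes X: "(x1, x2, x3) \<in> X_space P"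
  shows "0 \<le> X_norm P (x1, x2, x3)" "L2_norm I x1 \<le> X_norm P (x1, x2, x3)" "L2_norm I x2 \<le> X_norm P (x1, x2, x3)"
    "L2_norm I (pds lo hi k2 x2) \<le> X_norm P (x1, x2, x3)" "L2_norm I x3 \<le> X_norm P (x1, x2, x3)"
    "L2_norm I (pds lo hi k3 x3) \<le> X_norm P (x1, x2, x3)"
    "L2_norm I ((pds lo hi k3 ^^ 2) x3) \<le> X_norm P (x1, x2, x3)"
    "X_norm P (x1, x2, x3) \<le> L2_norm I x1 + (L2_norm I x2 + L2_norm I (pds lo hi k2 x2))
      + (L2_norm I x3 + L2_norm I (pds lo hi k3 x3) + L2_norm I ((pds lo hi k3 ^^ 2) x3))"
proof -
  note n = L2_norm_nonneg[OF X_spaceD(1)[OF X]] L2_norm_nonneg[OF pds_L2v(1)[OF X]] L2_norm_nonneg[OF pds_L2v(2)[OF X]]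
    L2_norm_nonneg[OF pds_L2v(3)[OF X]] L2_norm_nonneg[OF pds_L2v(4)[OF X]] L2_norm_nonneg[OF pds_L2v(5)[OF X]]
  show "0 \<le> X_norm P (x1, x2, x3)" "L2_norm I x1 \<le> X_norm P (x1, x2, x3)" "L2_norm I x2 \<le> X_norm P (x1, x2, x3)"
    "L2_norm I (pds lo hi k2 x2) \<le> X_norm P (x1, x2, x3)" "L2_norm I x3 \<le> X_norm P (x1, x2, x3)"
    "L2_norm I (pds lo hi k3 x3) \<le> X_norm P (x1, x2, x3)"
    "L2_norm I ((pds lo hi k3 ^^ 2) x3) \<le> X_norm P (x1, x2, x3)"
    unfolding X_norm_eq by (auto intro!: real_le_rsqrt)
  have "X_norm P (x1, x2, x3) \<le> L2_norm I x1 + W2_norm lo hi 1 k2 x2 + W2_norm lo hi 2 k3 x3"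
    unfolding X_norm.simps using n(1) by (intro sqrt_sum_squares3_le) (auto simp: W2_norm_def sum_nonneg)
  also have "W2_norm lo hi 1 k2 x2 \<le> L2_norm I x2 + L2_norm I (pds lo hi k2 x2)"
    unfolding W2_norm_1 using n by (intro sqrt_sum_squares2_le)
  also have "W2_norm lo hi 2 k3 x3 \<le> L2_norm I x3 + L2_norm I (pds lo hi k3 x3) + L2_norm I ((pds lo hi k3 ^^ 2) x3)"
    unfolding W2_norm_2 using n by (intro sqrt_sum_squares3_le)
  finally show "X_norm P (x1, x2, x3) \<le> L2_norm I x1 + (L2_norm I x2 + L2_norm I (pds lo hi k2 x2))
      + (L2_norm I x3 + L2_norm I (pds lo hi k3 x3) + L2_norm I ((pds lo hi k3 ^^ 2) x3))" by simp
qed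

lemma Z_norm_le_X_norm:
  assumes u: "u \<in> Z_space lo hi ko kp" and X: "X \<in> X_space P"
    and ae: "AE s in lebesgue_on I. snd u s = stackD X s"
  shows "Z_norm lo hi u \<le> vnorm (fst u) + X_norm P X"
proof -
  obtain x1 x2 x3 where Xe: "X = (x1, x2, x3)" by (cases X)
  note X' = X[unfolded Xe]
  note p = pds_L2v[OF X']
  let ?f = "\<lambda>i. (l2 lo hi (\<lambda>s. snd u s $ i))\<^sup>2"
  have cong: "l2 lo hi (\<lambda>s. snd u s $ i) = l2 lo hi (\<lambda>s. stackD X s $ i)" if "i < kp" for i
    using ae by (intro l2_AE_cong fundamental_L2[OF u that]) (auto elim: eventually_mono)
  have l2c: "l2 lo hi f = l2 lo hi g" if "\<And>s. s \<in> I \<Longrightarrow> f s = g s" for f g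
    unfolding l2_def using that by (auto intro!: Bochner_Integration.integral_cong arg_cong[of _ _ sqrt])
  have 1: "?f i = (l2 lo hi (\<lambda>s. x1 s $ i))\<^sup>2" if "i < k1" for i
  proof -
    have "l2 lo hi (\<lambda>s. stackD X s $ i) = l2 lo hi (\<lambda>s. x1 s $ i)"
      using that X_spaceD(2)[OF X'] by (intro l2c) (simp add: Xe)
    then show ?thesis using cong[of i] that by (simp add: kp_eq)
  qed
  have 2: "?f (k1 + i) = (l2 lo hi (\<lambda>s. pds lo hi k2 x2 s $ i))\<^sup>2" if "i < k2" for i
  proof -
    have "l2 lo hi (\<lambda>s. stackD X s $ (k1 + i)) = l2 lo hi (\<lambda>s. pds lo hi k2 x2 s $ i)"
      using that X_spaceD(2)[OF X'] by (intro l2c) (simp add: Xe)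
    then show ?thesis using cong[of "k1 + i"] that by (simp add: kp_eq)
  qed
  have 3: "?f (k1 + k2 + i) = (l2 lo hi (\<lambda>s. (pds lo hi k3 ^^ 2) x3 s $ i))\<^sup>2" if "i < k3" for i
  proof -
    have "l2 lo hi (\<lambda>s. stackD X s $ (k1 + k2 + i)) = l2 lo hi (\<lambda>s. (pds lo hi k3 ^^ 2) x3 s $ i)"
      using that X_spaceD(2)[OF X'] by (intro l2c) (simp add: Xe)
    then show ?thesis using cong[of "k1 + k2 + i"] that by (simp add: kp_eq)
  qed
  have "(L2_norm I (snd u))\<^sup>2 = (\<Sum>i<k1 + k2 + k3. ?f i)"
    using L2_norm_sq[OF Z_spaceD(2)[OF u]] by (simp add: kp_eq)
  also have "\<dots> = (\<Sum>i<k1. ?f i) + (\<Sum>i<k2. ?f (k1 + i)) + (\<Sum>i<k3. ?f (k1 + k2 + i))"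
    by (simp add: sum_lessThan_add)
  also have "\<dots> = (L2_norm I x1)\<^sup>2 + (L2_norm I (pds lo hi k2 x2))\<^sup>2 + (L2_norm I ((pds lo hi k3 ^^ 2) x3))\<^sup>2"
    unfolding L2_norm_sq[OF X_spaceD(1)[OF X']] L2_norm_sq[OF p(2)] L2_norm_sq[OF p(5)] using 1 2 3 by simp
  also have "\<dots> \<le> (X_norm P X)\<^sup>2"
    unfolding Xe X_norm_eq by (simp add: add_nonneg_nonneg)
  finally have "L2_norm I (snd u) \<le> X_norm P X"
    using X_norm_bounds(1)[OF X'] unfolding Xe by (rule power2_le_imp_le)
  then show ?thesis using Z_norm_bounds(3)[OF u] by linarith
qed

lemma X_norm_le_Z_norm:
  "\<exists>C\<ge>0. \<forall>u X. fundamental u X \<longrightarrow> X_norm P X \<le> C * Z_norm lo hi u"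
proof -
  define S where "S = {(u, X). fundamental u X}"
  define N where "N = (\<lambda>(u, X :: pstate). Z_norm lo hi u)"
  let ?D = "dominated S N" and ?V = "vdominated S N"
  let ?r = "sqrt (hi - lo)"
  have Z: "fst p \<in> Z_space lo hi ko kp" if "p \<in> S" for p
    using that by (auto simp: S_def fundamental_def)
  have Nn: "N p = Z_norm lo hi (fst p)" for p by (simp add: N_def split_beta)
  have yL: "(\<lambda>s. snd (fst p) s $ i) \<in> L2 I" if "p \<in> S" "i < kp" for p i
    using fundamental_L2[OF Z[OF that(1)] that(2)] .
  have y: "?D (\<lambda>p. l2 lo hi (\<lambda>s. snd (fst p) s $ i))" if "i < kp" for i
    by (rule dominated_self) (use Z_norm_bounds(5)[OF Z that] in \<open>simp add: Nn l2_nonneg\<close>)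
  have x: "?V ko (\<lambda>p. fst (fst p))"
    unfolding vdominated_def
  proof (intro conjI ballI allI impI dominated_self)
    fix p assume p: "p \<in> S"
    show "fst (fst p) \<in> carrier_vec ko" by (rule Z_spaceD(1)[OF Z[OF p]])
    show "\<bar>fst (fst p) $ i\<bar> \<le> N p" if "i < ko" for i
      using abs_index_le_vnorm[OF Z_spaceD(1)[OF Z[OF p]] that] Z_norm_bounds(1)[OF Z[OF p]] by (simp add: Nn)
  qed
  have hi: "hi \<in> I" using lo_less_hi by simp
  have V: "?V n (\<lambda>p. vintegral n I (g (snd (fst p))))" if n: "j + n \<le> kp"
    and g: "\<And>p i. p \<in> S \<Longrightarrow> i < n \<Longrightarrow>
      \<bar>LINT s|lebesgue_on I. g (snd (fst p)) s $ i\<bar> \<le> B * l2 lo hi (\<lambda>s. snd (fst p) s $ (j + i))" for n j B g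
    unfolding vdominated_def
  proof (intro conjI ballI allI impI)
    fix i assume i: "i < n"
    have "?D (\<lambda>p. B * l2 lo hi (\<lambda>s. snd (fst p) s $ (j + i)))"
      using n i by (intro dominated_cmult y) simp
    then show "?D (\<lambda>p. vintegral n I (g (snd (fst p))) $ i)"
      by (rule dominated_mono) (use g i in force)
  qed simp
  have i2: "?V k2 (\<lambda>p. vintegral k2 I (y2_of (snd (fst p))))"
    by (rule V[where j = k1 and B = ?r]) (use indef_l2_bound[OF lo_less_hi yL hi] in \<open>simp_all add: kp_eq\<close>)
  have i3: "?V k3 (\<lambda>p. vintegral k3 I (y3_of (snd (fst p))))"
    by (rule V[where j = "k1 + k2" and B = ?r]) (use indef_l2_bound[OF lo_less_hi yL hi] in \<open>simp_all add: kp_eq\<close>)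
  have i4: "?V k3 (\<lambda>p. vintegral k3 I (\<lambda>\<theta>. (hi - \<theta>) \<cdot>\<^sub>v y3_of (snd (fst p)) \<theta>))"
    by (rule V[where j = "k1 + k2" and B = "(hi - lo) * ?r"])
      (use weighted_indef_l2_bound[OF lo_less_hi yL] in \<open>simp_all add: kp_eq mult.assoc\<close>)
  have "?V (k2 + (k3 + (k3 + (k2 + (k3 + k3))))) (\<lambda>p. 0\<^sub>v k2 @\<^sub>v 0\<^sub>v k3 @\<^sub>v 0\<^sub>v k3 @\<^sub>v vintegral k2 I (y2_of (snd (fst p)))
       @\<^sub>v vintegral k3 I (\<lambda>\<theta>. (hi - \<theta>) \<cdot>\<^sub>v y3_of (snd (fst p)) \<theta>) @\<^sub>v vintegral k3 I (y3_of (snd (fst p))))"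
    by (intro vdominated_append vdominated_zero i2 i3 i4)
  moreover have "k2 + (k3 + (k3 + (k2 + (k3 + k3)))) = 2 * kr" by (simp add: kr_eq)
  ultimately have Q': "?V (2 * kr) (\<lambda>p. 0\<^sub>v k2 @\<^sub>v 0\<^sub>v k3 @\<^sub>v 0\<^sub>v k3 @\<^sub>v vintegral k2 I (y2_of (snd (fst p)))
       @\<^sub>v vintegral k3 I (\<lambda>\<theta>. (hi - \<theta>) \<cdot>\<^sub>v y3_of (snd (fst p)) \<theta>) @\<^sub>v vintegral k3 I (y3_of (snd (fst p))))"
    by (simp only:)
  have Q: "?V (2 * kr) (\<lambda>p. Qint (snd (fst p)))"
    unfolding vdominated_def
  proof (intro conjI ballI allI impI)
    fix i assume "i < 2 * kr"
    from vdominatedD(2)[OF Q' this] show "?D (\<lambda>p. Qint (snd (fst p)) $ i)"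
      by (rule dominated_mono) (simp only: Q_integral(2)[OF Z_spaceD(2)[OF Z]] order_refl)
  qed simp
  have c: "?V kr (\<lambda>p. cvec (fst p))"
    unfolding cvec_def
    by (intro vdominated_mult_mat[OF BTinv(1)] vdominated_diff vdominated_mult_mat[OF param_carriers(4) x]
        vdominated_mult_mat[OF param_carriers(3) Q])
  define x1 x2 x3 where "x1 = (\<lambda>p :: zstate \<times> pstate. fst (snd p))"
    and "x2 = (\<lambda>p :: zstate \<times> pstate. fst (snd (snd p)))" and "x3 = (\<lambda>p :: zstate \<times> pstate. snd (snd (snd p)))"
  have fp: "fundamental (fst p) (x1 p, x2 p, x3 p)" if "p \<in> S" for p
    using that by (auto simp: S_def x1_def x2_def x3_def)
  have X: "(x1 p, x2 p, x3 p) \<in> X_space P" if "p \<in> S" for p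
    using fp[OF that] by (simp add: fundamental_def)
  have e1: "?D (\<lambda>p. l2 lo hi (\<lambda>s. x1 p s $ i))" if "i < k1" for i
  proof (rule dominated_mono[OF y[of i]])
    fix p assume p: "p \<in> S"
    show "\<bar>l2 lo hi (\<lambda>s. x1 p s $ i)\<bar> \<le> \<bar>l2 lo hi (\<lambda>s. snd (fst p) s $ i)\<bar>"
      using l2_AE_cong[OF fundamental_components(1)[OF fp[OF p] that] yL[OF p]] that by (simp add: kp_eq)
  qed (use that in \<open>simp add: kp_eq\<close>)
  have e2: "?D (\<lambda>p. l2 lo hi (wd (\<lambda>s. x2 p s $ i)))" if "i < k2" for i
  proof (rule dominated_mono[OF y[of "k1 + i"]])
    fix p assume p: "p \<in> S"
    show "\<bar>l2 lo hi (wd (\<lambda>s. x2 p s $ i))\<bar> \<le> \<bar>l2 lo hi (\<lambda>s. snd (fst p) s $ (k1 + i))\<bar>"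
      using l2_AE_cong[OF fundamental_components(2)[OF fp[OF p] that] yL[OF p]] that by (simp add: kp_eq)
  qed (use that in \<open>simp add: kp_eq\<close>)
  have e3: "?D (\<lambda>p. l2 lo hi (wd (wd (\<lambda>s. x3 p s $ i))))" if "i < k3" for i
  proof (rule dominated_mono[OF y[of "k1 + k2 + i"]])
    fix p assume p: "p \<in> S"
    show "\<bar>l2 lo hi (wd (wd (\<lambda>s. x3 p s $ i)))\<bar> \<le> \<bar>l2 lo hi (\<lambda>s. snd (fst p) s $ (k1 + k2 + i))\<bar>"
      using l2_AE_cong[OF fundamental_components(3)[OF fp[OF p] that] yL[OF p]] that by (simp add: kp_eq)
  qed (use that in \<open>simp add: kp_eq\<close>)
  have W: "?D (\<lambda>p. l2 lo hi (g p))" if g: "\<And>p. p \<in> S \<Longrightarrow> g p \<in> W2 lo hi 1" and j: "j < kr"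
    and gc: "\<And>p. p \<in> S \<Longrightarrow> cvec (fst p) $ j = pv (g p) lo" and gw: "?D (\<lambda>p. l2 lo hi (wd (g p)))" for g j
  proof (rule dominated_mono)
    show "?D (\<lambda>p. ?r * (\<bar>cvec (fst p) $ j\<bar> + ?r * l2 lo hi (wd (g p))))"
      by (intro dominated_cmult dominated_add dominated_abs vdominatedD(2)[OF c j] gw)
    fix p assume p: "p \<in> S"
    show "\<bar>l2 lo hi (g p)\<bar> \<le> \<bar>?r * (\<bar>cvec (fst p) $ j\<bar> + ?r * l2 lo hi (wd (g p)))\<bar>"
      using l2_W2_1_bound[OF lo_less_hi g[OF p]] gc[OF p] l2_nonneg[of lo hi "g p"] by simp
  qed
  have f2: "?D (\<lambda>p. l2 lo hi (\<lambda>s. x2 p s $ i))" if i: "i < k2" for i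
  proof (rule W[where g = "\<lambda>p s. x2 p s $ i" and j = i])
    show "(\<lambda>s. x2 p s $ i) \<in> W2 lo hi 1" if "p \<in> S" for p
      by (rule X_spaceD(6)[OF X[OF that] i])
    show "cvec (fst p) $ i = pv (\<lambda>s. x2 p s $ i) lo" if "p \<in> S" for p
      by (rule cvec_index(1)[OF fp[OF that] i])
  qed (use i e2 in \<open>simp_all add: kr_eq\<close>)
  have g3: "?D (\<lambda>p. l2 lo hi (wd (\<lambda>s. x3 p s $ i)))" if i: "i < k3" for i
  proof (rule W[where g = "\<lambda>p. wd (\<lambda>s. x3 p s $ i)" and j = "k2 + k3 + i"])
    show "wd (\<lambda>s. x3 p s $ i) \<in> W2 lo hi 1" if "p \<in> S" for p
      by (rule W2_2_elim(2)[OF lo_less_hi X_spaceD(7)[OF X[OF that] i]])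
    show "cvec (fst p) $ (k2 + k3 + i) = pv (wd (\<lambda>s. x3 p s $ i)) lo" if "p \<in> S" for p
      by (rule cvec_index(3)[OF fp[OF that] i])
  qed (use i e3 in \<open>simp_all add: kr_eq\<close>)
  have f3: "?D (\<lambda>p. l2 lo hi (\<lambda>s. x3 p s $ i))" if i: "i < k3" for i
  proof (rule W[where g = "\<lambda>p s. x3 p s $ i" and j = "k2 + i"])
    show "(\<lambda>s. x3 p s $ i) \<in> W2 lo hi 1" if "p \<in> S" for p
      by (rule W2_2_elim(1)[OF lo_less_hi X_spaceD(7)[OF X[OF that] i]])
    show "cvec (fst p) $ (k2 + i) = pv (\<lambda>s. x3 p s $ i) lo" if "p \<in> S" for p
      by (rule cvec_index(2)[OF fp[OF that] i])
  qed (use i g3 in \<open>simp_all add: kr_eq\<close>)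
  let ?F = "\<lambda>p. (\<Sum>i<k1. l2 lo hi (\<lambda>s. x1 p s $ i))
      + ((\<Sum>i<k2. l2 lo hi (\<lambda>s. x2 p s $ i)) + (\<Sum>i<k2. l2 lo hi (wd (\<lambda>s. x2 p s $ i))))
      + ((\<Sum>i<k3. l2 lo hi (\<lambda>s. x3 p s $ i)) + (\<Sum>i<k3. l2 lo hi (wd (\<lambda>s. x3 p s $ i)))
        + (\<Sum>i<k3. l2 lo hi (wd (wd (\<lambda>s. x3 p s $ i)))))"
  have "?D ?F"
    by (intro dominated_add dominated_sum e1 e2 e3 f2 f3 g3)
  then obtain C where C: "C \<ge> 0" "\<forall>p\<in>S. \<bar>?F p\<bar> \<le> C * N p"
    by (auto simp: dominated_def)
  have "X_norm P X \<le> C * Z_norm lo hi u" if "fundamental u X" for u X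
  proof -
    have p: "(u, X) \<in> S" using that by (simp add: S_def)
    note X' = X[OF p] and q = pds_L2v[OF X[OF p]]
    have "X_norm P X = X_norm P (x1 (u, X), x2 (u, X), x3 (u, X))"
      by (simp add: x1_def x2_def x3_def)
    also have "\<dots> \<le> L2_norm I (x1 (u, X)) + (L2_norm I (x2 (u, X)) + L2_norm I (pds lo hi k2 (x2 (u, X))))
      + (L2_norm I (x3 (u, X)) + L2_norm I (pds lo hi k3 (x3 (u, X))) + L2_norm I ((pds lo hi k3 ^^ 2) (x3 (u, X))))"
      by (rule X_norm_bounds(8)[OF X'])
    also have "\<dots> \<le> ?F (u, X)"
      using L2_norm_le_sum[OF X_spaceD(1)[OF X']] L2_norm_le_sum[OF q(1)] L2_norm_le_sum[OF q(2)]
        L2_norm_le_sum[OF q(3)] L2_norm_le_sum[OF q(4)] L2_norm_le_sum[OF q(5)]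
      by (intro add_mono) simp_all
    also have "\<dots> \<le> C * Z_norm lo hi u"
      using bspec[OF C(2) p] by (simp add: N_def)
    finally show ?thesis .
  qed
  with C(1) show ?thesis by blast
qed

end

section \<open>Transfer of solutions\<close>

lemma W2_zero:
  assumes ab: "a < b"
  shows "(\<lambda>_. 0) \<in> W2 a b 1" "(\<lambda>_. 0) \<in> W2 a b 2" "AE s in lebesgue_on {a..b}. wderiv a b (\<lambda>_. 0) s = 0"
    "AE s in lebesgue_on {a..b}. wderiv a b (wderiv a b (\<lambda>_. 0)) s = 0"
    "t \<in> {a..b} \<Longrightarrow> point_value a b (\<lambda>_. 0) t = 0" "t \<in> {a..b} \<Longrightarrow> point_value a b (wderiv a b (\<lambda>_. 0)) t = 0"
proof -
  have "AE s in lebesgue_on {a..b}. (\<lambda>_. 0) s = 0 + (s - a) * 0 + indef a (\<lambda>\<theta>. (s - \<theta>) * (\<lambda>_. 0) \<theta>) s" by simp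
  note w = W2_2_intro[OF ab L2_const this]
  note 1 = W2_2_elim(1)[OF ab w(1)]
  show "(\<lambda>_. 0) \<in> W2 a b 1" "(\<lambda>_. 0) \<in> W2 a b 2" using w(1) 1 by auto
  show "AE s in lebesgue_on {a..b}. wderiv a b (\<lambda>_. 0) s = 0"
    "AE s in lebesgue_on {a..b}. wderiv a b (wderiv a b (\<lambda>_. 0)) s = 0"
    using w(2,3) by simp_all
  show "t \<in> {a..b} \<Longrightarrow> point_value a b (\<lambda>_. 0) t = 0" "t \<in> {a..b} \<Longrightarrow> point_value a b (wderiv a b (\<lambda>_. 0)) t = 0"
    using w(4,5)[of t] by simp_all
qed

lemma AE_halfline_dense:
  fixes t :: real
  assumes ae: "AE s in lebesgue_on {0..}. Q s" and t: "0 \<le> t" and \<delta>: "0 < \<delta>"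
  shows "\<exists>r. t < r \<and> r < t + \<delta> \<and> Q r"
proof (rule ccontr)
  assume "\<not> ?thesis"
  then have no: "\<not> Q r" if "r \<in> {t<..<t + \<delta>}" for r using that by auto
  have "AE s in lebesgue. s \<in> {0..} \<longrightarrow> Q s"
    using ae by (subst (asm) AE_restrict_space_iff) auto
  then have "AE s in lebesgue. s \<notin> {t<..<t + \<delta>}"
    by eventually_elim (use no t in force)
  then have "{t<..<t + \<delta>} \<in> null_sets lebesgue"
    by (subst AE_iff_null_sets) auto
  then have "{t<..<t + \<delta>} \<in> null_sets lborel"
    by (subst (asm) null_sets_completion_iff) auto
  then show False using \<delta> by (simp add: null_sets_def)
qed

lemma has_frechet_at_mono:
  assumes N: "has_frechet_at N sub sc u d t"
    and bd: "\<And>r. 0 \<le> r \<Longrightarrow> 0 \<le> N' (sub' (sub' (u' r) (u' t)) (sc' (r - t) d')) \<and>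
      N' (sub' (sub' (u' r) (u' t)) (sc' (r - t) d')) \<le> C * N (sub (sub (u r) (u t)) (sc (r - t) d))"
  shows "has_frechet_at N' sub' sc' u' d' t"
  unfolding has_frechet_at_def
proof (rule real_tendsto_sandwich)
  have ev: "\<forall>\<^sub>F r in at t within {0..}. r \<in> {0..}"
    by (auto simp: eventually_at_filter)
  show "\<forall>\<^sub>F r in at t within {0..}. 0 \<le> N' (sub' (sub' (u' r) (u' t)) (sc' (r - t) d')) / \<bar>r - t\<bar>"
    using ev by eventually_elim (use bd in \<open>auto intro!: divide_nonneg_nonneg\<close>)
  show "\<forall>\<^sub>F r in at t within {0..}. N' (sub' (sub' (u' r) (u' t)) (sc' (r - t) d')) / \<bar>r - t\<bar>
      \<le> C * (N (sub (sub (u r) (u t)) (sc (r - t) d)) / \<bar>r - t\<bar>)"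
    using ev
  proof eventually_elim
    case (elim r)
    then show ?case using bd[of r] divide_right_mono[of _ _ "\<bar>r - t\<bar>"] by fastforce
  qed
  show "((\<lambda>r. C * (N (sub (sub (u r) (u t)) (sc (r - t) d)) / \<bar>r - t\<bar>)) \<longlongrightarrow> 0) (at t within {0..})"
    using tendsto_mult_left[OF N[unfolded has_frechet_at_def], of C] by simp
qed simp

context ode_pde
begin

definition X_remainder :: "pstate \<Rightarrow> pstate \<Rightarrow> real \<Rightarrow> pstate \<Rightarrow> pstate" where
  "X_remainder X Y h D = X_sub (X_sub X Y) (X_scale h D)"

definition Z_remainder :: "zstate \<Rightarrow> zstate \<Rightarrow> real \<Rightarrow> zstate \<Rightarrow> zstate" where
  "Z_remainder u v h d = Z_sub (Z_sub u v) (Z_scale h d)"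

lemma X_remainder:
  assumes X: "X \<in> X_space P" and Y: "Y \<in> X_space P" and D: "D \<in> X_space P"
  shows "X_remainder X Y h D \<in> X_space P"
    "AE s in lebesgue_on I. stackD (X_remainder X Y h D) s = stackD X s - stackD Y s - h \<cdot>\<^sub>v stackD D s"
    "x_b P (X_remainder X Y h D) = x_b P X - x_b P Y - h \<cdot>\<^sub>v x_b P D"
proof -
  obtain x1 x2 x3 y1 y2 y3 d1 d2 d3 where e: "X = (x1, x2, x3)" "Y = (y1, y2, y3)" "D = (d1, d2, d3)"
    by (cases X, cases Y, cases D)
  define e1 e2 e3 where "e1 = (\<lambda>s. x1 s - y1 s - h \<cdot>\<^sub>v d1 s)" and "e2 = (\<lambda>s. x2 s - y2 s - h \<cdot>\<^sub>v d2 s)"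
    and "e3 = (\<lambda>s. x3 s - y3 s - h \<cdot>\<^sub>v d3 s)"
  have E: "X_remainder X Y h D = (e1, e2, e3)"
    by (simp add: X_remainder_def e e1_def e2_def e3_def)
  note X' = X[unfolded e] and Y' = Y[unfolded e] and D' = D[unfolded e]
  have c1: "e1 s $ i = x1 s $ i - y1 s $ i - h * d1 s $ i" if "s \<in> I" "i < k1" for s i
    using that X_spaceD(2)[OF X'] X_spaceD(2)[OF Y'] X_spaceD(2)[OF D'] by (simp add: e1_def)
  have c2: "\<forall>s\<in>I. e2 s $ i = x2 s $ i - y2 s $ i - h * d2 s $ i" if "i < k2" for i
    using that X_spaceD(3)[OF X'] X_spaceD(3)[OF Y'] X_spaceD(3)[OF D'] by (simp add: e2_def)
  have c3: "\<forall>s\<in>I. e3 s $ i = x3 s $ i - y3 s $ i - h * d3 s $ i" if "i < k3" for i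
    using that X_spaceD(4)[OF X'] X_spaceD(4)[OF Y'] X_spaceD(4)[OF D'] by (simp add: e3_def)
  note l2 = W2_1_lincomb[OF lo_less_hi X_spaceD(6)[OF X'] X_spaceD(6)[OF Y'] X_spaceD(6)[OF D'] c2]
    and l3 = W2_2_lincomb[OF lo_less_hi X_spaceD(7)[OF X'] X_spaceD(7)[OF Y'] X_spaceD(7)[OF D'] c3]
  have dims: "dim_vec (e1 s) = k1" "dim_vec (e2 s) = k2" "dim_vec (e3 s) = k3" if "s \<in> I" for s
    using X_spaceD(2-4)[OF D' that] by (simp_all add: e1_def e2_def e3_def)
  have "(\<lambda>s. e1 s $ i) \<in> L2 I" if i: "i < k1" for i
  proof -
    have "(\<lambda>s. 1 * (1 * x1 s $ i + (- 1) * y1 s $ i) + (- h) * d1 s $ i) \<in> L2 I"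
      by (intro L2_lincomb X_spaceD(5)[OF X' i] X_spaceD(5)[OF Y' i] X_spaceD(5)[OF D' i])
    then show ?thesis by (subst L2_cong) (auto simp: c1 i)
  qed
  then show "X_remainder X Y h D \<in> X_space P"
    unfolding E X_space_def using l2(1) l3(1) dims
    by (auto simp: L2v_def W2v_def intro!: carrier_vecI simp del: W2.simps One_nat_def)
  have "AE s in lebesgue_on I. \<forall>i<k2. wd (\<lambda>s. e2 s $ i) s = wd (\<lambda>s. x2 s $ i) s - wd (\<lambda>s. y2 s $ i) s - h * wd (\<lambda>s. d2 s $ i) s"
    by (intro AE_finite_all_less l2(2); assumption)
  moreover have "AE s in lebesgue_on I. \<forall>i<k3. wd (wd (\<lambda>s. e3 s $ i)) s
      = wd (wd (\<lambda>s. x3 s $ i)) s - wd (wd (\<lambda>s. y3 s $ i)) s - h * wd (wd (\<lambda>s. d3 s $ i)) s"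
    by (intro AE_finite_all_less l3(2); assumption)
  ultimately show "AE s in lebesgue_on I. stackD (X_remainder X Y h D) s = stackD X s - stackD Y s - h \<cdot>\<^sub>v stackD D s"
    using AE_lebesgue_on_space
  proof eventually_elim
    case (elim s)
    note ds = dims[OF elim(3)] X_spaceD(2)[OF X' elim(3)] X_spaceD(2)[OF Y' elim(3)] X_spaceD(2)[OF D' elim(3)]
    show ?case
    proof (rule eq_vecI)
      fix i assume "i < dim_vec (stackD X s - stackD Y s - h \<cdot>\<^sub>v stackD D s)"
      then have i: "i < kp" by (simp add: e ds kp_eq)
      then show "stackD (X_remainder X Y h D) s $ i = (stackD X s - stackD Y s - h \<cdot>\<^sub>v stackD D s) $ i"
      proof (cases rule: kp_cases)
        case 1
        then show ?thesis unfolding E unfolding e by (simp add: ds c1[OF elim(3)])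
      next
        case (2 j)
        then show ?thesis unfolding E unfolding e using elim(1) by (simp add: ds)
      next
        case (3 j)
        then show ?thesis unfolding E unfolding e using elim(2) by (simp add: ds)
      qed
    qed (unfold E, unfold e, simp add: ds)
  qed
  have xc: "x_c P (e1, e2, e3) c = x_c P X c - x_c P Y c - h \<cdot>\<^sub>v x_c P D c" if "c \<in> I" for c
    unfolding e using l2(3)[OF _ _ _ _ that] l3(3,4)[OF _ _ _ _ that] by (intro eq_vecI) auto
  have lh: "lo \<in> I" "hi \<in> I" using lo_less_hi by auto
  have dc: "dim_vec (x_c P Z c) = kr" for Z c
    by (cases Z) (simp add: kr_eq)
  show "x_b P (X_remainder X Y h D) = x_b P X - x_b P Y - h \<cdot>\<^sub>v x_b P D"
    unfolding E x_b_def xc[OF lh(1)] xc[OF lh(2)] by (intro eq_vecI) (auto simp: dc)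
qed

lemma boundary_remainder:
  assumes "X \<in> X_space P" "Y \<in> X_space P" "D \<in> X_space P"
    and "x \<in> carrier_vec ko" "y \<in> carrier_vec ko" "d \<in> carrier_vec ko"
  shows "pB P *\<^sub>v x_b P (X_remainder X Y h D) - pBx P *\<^sub>v (x - y - h \<cdot>\<^sub>v d)
    = (pB P *\<^sub>v x_b P X - pBx P *\<^sub>v x) - (pB P *\<^sub>v x_b P Y - pBx P *\<^sub>v y) - h \<cdot>\<^sub>v (pB P *\<^sub>v x_b P D - pBx P *\<^sub>v d)"
proof -
  have lin: "M *\<^sub>v (p - q - h \<cdot>\<^sub>v r) = M *\<^sub>v p - M *\<^sub>v q - h \<cdot>\<^sub>v (M *\<^sub>v r)"
    if M: "M \<in> carrier_mat m n" and v: "p \<in> carrier_vec n" "q \<in> carrier_vec n" "r \<in> carrier_vec n"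
    for M :: "real mat" and p q r m n
  proof -
    have "M *\<^sub>v (p - q - h \<cdot>\<^sub>v r) = M *\<^sub>v (p - q) - M *\<^sub>v (h \<cdot>\<^sub>v r)"
      using v by (intro mult_minus_distrib_mat_vec[OF M]) auto
    also have "M *\<^sub>v (p - q) = M *\<^sub>v p - M *\<^sub>v q" by (rule mult_minus_distrib_mat_vec[OF M v(1,2)])
    also have "M *\<^sub>v (h \<cdot>\<^sub>v r) = h \<cdot>\<^sub>v (M *\<^sub>v r)" by (rule mult_mat_vec[OF M v(3)])
    finally show ?thesis .
  qed
  have xb: "x_b P Z \<in> carrier_vec (2 * kr)" for Z by (rule carrier_vecI[OF x_b_dim])
  note B = param_carriers(3) and Bx = param_carriers(4)
  have dims: "dim_vec (pB P *\<^sub>v p) = kr" "dim_vec (pBx P *\<^sub>v q) = kr" for p q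
    using B Bx by auto
  show ?thesis
    unfolding X_remainder(3)[OF assms(1-3)] lin[OF B xb xb xb] lin[OF Bx assms(4-6)]
    by (intro eq_vecI) (simp_all add: dims algebra_simps del: index_mult_mat_vec dim_mult_mat_vec)
qed

lemma boundary_bound:
  "\<exists>C\<ge>0. \<forall>x X i. x \<in> carrier_vec ko \<longrightarrow> X \<in> X_space P \<longrightarrow> i < kr \<longrightarrow>
    \<bar>(pB P *\<^sub>v x_b P X - pBx P *\<^sub>v x) $ i\<bar> \<le> C * (vnorm x + X_norm P X)"
proof -
  define S where "S = (carrier_vec ko :: real vec set) \<times> X_space P"
  define N where "N = (\<lambda>(x, X). vnorm x + X_norm P X)"
  let ?D = "dominated S N" and ?V = "vdominated S N"
  define x1 x2 x3 where "x1 = (\<lambda>p :: real vec \<times> pstate. fst (snd p))"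
    and "x2 = (\<lambda>p :: real vec \<times> pstate. fst (snd (snd p)))" and "x3 = (\<lambda>p :: real vec \<times> pstate. snd (snd (snd p)))"
  have X: "(x1 p, x2 p, x3 p) \<in> X_space P" and x: "fst p \<in> carrier_vec ko" if "p \<in> S" for p
    using that by (auto simp: S_def x1_def x2_def x3_def)
  have Np: "N p = vnorm (fst p) + X_norm P (x1 p, x2 p, x3 p)" for p
    by (simp add: N_def x1_def x2_def x3_def split_beta)
  have hi: "hi \<in> I" using lo_less_hi by simp
  have vx: "?V ko fst"
    unfolding vdominated_def
  proof (intro conjI ballI allI impI dominated_self)
    fix p assume p: "p \<in> S"
    show "fst p \<in> carrier_vec ko" by (rule x[OF p])
    show "\<bar>fst p $ i\<bar> \<le> N p" if "i < ko" for i
      unfolding Np using abs_index_le_vnorm[OF x[OF p] that] X_norm_bounds(1)[OF X[OF p]] by linarith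
  qed
  have comp: "?D (\<lambda>p. l2 lo hi (\<lambda>s. f p s $ i))"
    if f: "\<And>p. p \<in> S \<Longrightarrow> f p \<in> L2v I n" and b: "\<And>p. p \<in> S \<Longrightarrow> L2_norm I (f p) \<le> X_norm P (x1 p, x2 p, x3 p)"
      and i: "i < n" for f n i
  proof (rule dominated_self)
    fix p assume p: "p \<in> S"
    show "\<bar>l2 lo hi (\<lambda>s. f p s $ i)\<bar> \<le> N p"
      unfolding Np using l2_le_L2_norm[OF f[OF p] i] b[OF p] vnorm_nonneg[of "fst p"] l2_nonneg[of lo hi "\<lambda>s. f p s $ i"]
      by linarith
  qed
  have l2: "?D (\<lambda>p. l2 lo hi (\<lambda>s. x2 p s $ i))" "?D (\<lambda>p. l2 lo hi (wd (\<lambda>s. x2 p s $ i)))" if i: "i < k2" for i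
  proof -
    show "?D (\<lambda>p. l2 lo hi (\<lambda>s. x2 p s $ i))"
      by (rule comp[OF pds_L2v(1)[OF X] X_norm_bounds(3)[OF X] i])
    show "?D (\<lambda>p. l2 lo hi (wd (\<lambda>s. x2 p s $ i)))"
      using comp[OF pds_L2v(2)[OF X] X_norm_bounds(4)[OF X] i] i by simp
  qed
  have l3: "?D (\<lambda>p. l2 lo hi (\<lambda>s. x3 p s $ i))" "?D (\<lambda>p. l2 lo hi (wd (\<lambda>s. x3 p s $ i)))"
    "?D (\<lambda>p. l2 lo hi (wd (wd (\<lambda>s. x3 p s $ i))))" if i: "i < k3" for i
  proof -
    show "?D (\<lambda>p. l2 lo hi (\<lambda>s. x3 p s $ i))"
      by (rule comp[OF pds_L2v(3)[OF X] X_norm_bounds(5)[OF X] i])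
    show "?D (\<lambda>p. l2 lo hi (wd (\<lambda>s. x3 p s $ i)))"
      using comp[OF pds_L2v(4)[OF X] X_norm_bounds(6)[OF X] i] i by simp
    show "?D (\<lambda>p. l2 lo hi (wd (wd (\<lambda>s. x3 p s $ i))))"
      using comp[OF pds_L2v(5)[OF X] X_norm_bounds(7)[OF X] i] i by simp
  qed
  have trace: "?D (\<lambda>p. pv (g p) lo) \<and> ?D (\<lambda>p. pv (g p) hi)"
    if g: "\<And>p. p \<in> S \<Longrightarrow> g p \<in> W2 lo hi 1" and a: "?D (\<lambda>p. l2 lo hi (g p))" and b: "?D (\<lambda>p. l2 lo hi (wd (g p)))" for g
  proof
    show l: "?D (\<lambda>p. pv (g p) lo)"
    proof (rule dominated_mono)
      show "?D (\<lambda>p. ((1 / (hi - lo) + 1) * sqrt (hi - lo)) * (l2 lo hi (g p) + l2 lo hi (wd (g p))))"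
        by (intro dominated_cmult dominated_add a b)
      show "\<bar>pv (g p) lo\<bar> \<le> \<bar>(1 / (hi - lo) + 1) * sqrt (hi - lo) * (l2 lo hi (g p) + l2 lo hi (wd (g p)))\<bar>"
        if "p \<in> S" for p
        using point_value_left_bound[OF lo_less_hi g[OF that]] by linarith
    qed
    show "?D (\<lambda>p. pv (g p) hi)"
    proof (rule dominated_mono)
      show "?D (\<lambda>p. \<bar>pv (g p) lo\<bar> + sqrt (hi - lo) * l2 lo hi (wd (g p)))"
        by (intro dominated_add dominated_abs dominated_cmult l b)
      show "\<bar>pv (g p) hi\<bar> \<le> \<bar>\<bar>pv (g p) lo\<bar> + sqrt (hi - lo) * l2 lo hi (wd (g p))\<bar>" if "p \<in> S" for p
      proof -
        note e = W2_1_elim[OF lo_less_hi g[OF that]]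
        show ?thesis using e(4)[OF hi] indef_l2_bound[OF lo_less_hi e(2) hi] by linarith
      qed
    qed
  qed
  have t2: "?D (\<lambda>p. pv (\<lambda>s. x2 p s $ i) lo) \<and> ?D (\<lambda>p. pv (\<lambda>s. x2 p s $ i) hi)" if i: "i < k2" for i
    by (rule trace[OF X_spaceD(6)[OF X i] l2[OF i]])
  have t3: "?D (\<lambda>p. pv (\<lambda>s. x3 p s $ i) lo) \<and> ?D (\<lambda>p. pv (\<lambda>s. x3 p s $ i) hi)" if i: "i < k3" for i
    by (rule trace[OF W2_2_elim(1)[OF lo_less_hi X_spaceD(7)[OF X i]] l3(1,2)[OF i]])
  have t4: "?D (\<lambda>p. pv (wd (\<lambda>s. x3 p s $ i)) lo) \<and> ?D (\<lambda>p. pv (wd (\<lambda>s. x3 p s $ i)) hi)" if i: "i < k3" for i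
    by (rule trace[OF W2_2_elim(2)[OF lo_less_hi X_spaceD(7)[OF X i]] l3(2,3)[OF i]])
  have pvv: "?V n (\<lambda>p. point_valuev lo hi n (f p) c)" if "\<And>i. i < n \<Longrightarrow> ?D (\<lambda>p. pv (\<lambda>s. f p s $ i) c)" for n f c
    using that by (auto simp: vdominated_def intro!: carrier_vecI)
  have xc: "?V (k2 + (k3 + k3)) (\<lambda>p. x_c P (x1 p, x2 p, x3 p) c)" if "c \<in> {lo, hi}" for c
    unfolding x_c.simps
    using that t2 t3 t4 by (intro vdominated_append pvv) auto
  have "?V ((k2 + (k3 + k3)) + (k2 + (k3 + k3))) (\<lambda>p. x_b P (x1 p, x2 p, x3 p))"
    unfolding x_b_def by (intro vdominated_append xc) auto
  moreover have "(k2 + (k3 + k3)) + (k2 + (k3 + k3)) = 2 * kr" by (simp add: kr_eq)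
  ultimately have xb: "?V (2 * kr) (\<lambda>p. x_b P (x1 p, x2 p, x3 p))"
    by (simp only:)
  have V: "?V kr (\<lambda>p. pB P *\<^sub>v x_b P (x1 p, x2 p, x3 p) - pBx P *\<^sub>v fst p)"
    by (intro vdominated_diff vdominated_mult_mat[OF param_carriers(3) xb] vdominated_mult_mat[OF param_carriers(4) vx])
  have "?D (\<lambda>p. \<Sum>i<kr. \<bar>(pB P *\<^sub>v x_b P (x1 p, x2 p, x3 p) - pBx P *\<^sub>v fst p) $ i\<bar>)"
    by (intro dominated_sum dominated_abs vdominatedD(2)[OF V])
  then obtain C where C: "C \<ge> 0"
    "\<And>p. p \<in> S \<Longrightarrow> \<bar>\<Sum>i<kr. \<bar>(pB P *\<^sub>v x_b P (x1 p, x2 p, x3 p) - pBx P *\<^sub>v fst p) $ i\<bar>\<bar> \<le> C * N p"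
    unfolding dominated_def by blast
  have "\<bar>(pB P *\<^sub>v x_b P X - pBx P *\<^sub>v x) $ i\<bar> \<le> C * (vnorm x + X_norm P X)"
    if "x \<in> carrier_vec ko" "X \<in> X_space P" and i: "i < kr" for x X i
  proof -
    let ?g = "\<lambda>i. \<bar>(pB P *\<^sub>v x_b P X - pBx P *\<^sub>v x) $ i\<bar>"
    have p: "(x, X) \<in> S" using that by (simp add: S_def)
    have "?g i \<le> (\<Sum>i<kr. ?g i)" using i by (intro member_le_sum) auto
    also have "\<dots> \<le> C * (vnorm x + X_norm P X)"
      using C(2)[OF p] by (simp add: N_def x1_def x2_def x3_def del: index_mult_mat_vec index_minus_vec)
    finally show ?thesis .
  qed
  with C(1) show ?thesis by blast
qed

lemma X_norm_nonneg: "X \<in> X_space P \<Longrightarrow> 0 \<le> X_norm P X"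
  by (cases X) (simp add: X_norm_bounds(1) del: X_norm.simps)

text \<open>The boundary condition is a closed linear condition that holds along a dense set of times,
  hence it is inherited by the time derivative.\<close>

lemma boundary_derivative:
  assumes sp: "\<And>r. 0 \<le> r \<Longrightarrow> x r \<in> carrier_vec ko \<and> X r \<in> X_space P"
    and ae: "AE r in lebesgue_on {0..}. pB P *\<^sub>v x_b P (X r) = pBx P *\<^sub>v x r"
    and t: "0 \<le> t" "pB P *\<^sub>v x_b P (X t) = pBx P *\<^sub>v x t"
    and d: "xd \<in> carrier_vec ko" "Xd \<in> X_space P"
    and fx: "has_frechet_at vnorm (-) (\<cdot>\<^sub>v) x xd t" and fX: "has_frechet_at (X_norm P) X_sub X_scale X Xd t"
  shows "pB P *\<^sub>v x_b P Xd = pBx P *\<^sub>v xd"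
proof -
  obtain C where C: "C \<ge> 0" and bd: "\<And>x X i. x \<in> carrier_vec ko \<Longrightarrow> X \<in> X_space P \<Longrightarrow> i < kr \<Longrightarrow>
    \<bar>(pB P *\<^sub>v x_b P X - pBx P *\<^sub>v x) $ i\<bar> \<le> C * (vnorm x + X_norm P X)"
    using boundary_bound by blast
  let ?\<beta> = "\<lambda>x X. pB P *\<^sub>v x_b P X - pBx P *\<^sub>v x"
  define \<Phi> where "\<Phi> r = C * (vnorm (x r - x t - (r - t) \<cdot>\<^sub>v xd) / \<bar>r - t\<bar> + X_norm P (X_remainder (X r) (X t) (r - t) Xd) / \<bar>r - t\<bar>)" for r
  have \<Phi>: "(\<Phi> \<longlongrightarrow> 0) (at t within {0..})"
    unfolding \<Phi>_def X_remainder_def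
    using tendsto_mult_left[OF tendsto_add[OF fx[unfolded has_frechet_at_def] fX[unfolded has_frechet_at_def]], of C] by simp
  have dims: "dim_vec (pB P *\<^sub>v p) = kr" "dim_vec (pBx P *\<^sub>v q) = kr" for p q
    using param_carriers(3,4) by auto
  have zero: "?\<beta> xd Xd $ i = 0" if i: "i < kr" for i
  proof -
    have "\<bar>?\<beta> xd Xd $ i\<bar> \<le> 0 + \<epsilon>" if \<epsilon>: "\<epsilon> > 0" for \<epsilon>
    proof -
      have "\<forall>\<^sub>F r in at t within {0..}. \<Phi> r < \<epsilon>"
        using order_tendstoD(2)[OF \<Phi> \<epsilon>] .
      then obtain \<delta> where \<delta>: "\<delta> > 0" "\<And>r. r \<in> {0..} \<Longrightarrow> r \<noteq> t \<Longrightarrow> dist r t < \<delta> \<Longrightarrow> \<Phi> r < \<epsilon>"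
        unfolding eventually_at by blast
      obtain r where r: "t < r" "r < t + \<delta>" "pB P *\<^sub>v x_b P (X r) = pBx P *\<^sub>v x r"
        using AE_halfline_dense[OF ae t(1) \<delta>(1)] by blast
      have r0: "0 \<le> r" and h: "r - t > 0" using r t by auto
      note s1 = sp[OF r0] and s2 = sp[OF t(1)]
      have z: "?\<beta> (x r) (X r) = 0\<^sub>v kr" "?\<beta> (x t) (X t) = 0\<^sub>v kr"
        unfolding r(3) t(2) by (intro eq_vecI; simp add: dims del: dim_mult_mat_vec index_mult_mat_vec)+
      have "?\<beta> (x r - x t - (r - t) \<cdot>\<^sub>v xd) (X_remainder (X r) (X t) (r - t) Xd) = 0\<^sub>v kr - 0\<^sub>v kr - (r - t) \<cdot>\<^sub>v ?\<beta> xd Xd"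
        using boundary_remainder[of "X r" "X t" Xd "x r" "x t" xd "r - t"] s1 s2 d unfolding z by blast
      then have "?\<beta> (x r - x t - (r - t) \<cdot>\<^sub>v xd) (X_remainder (X r) (X t) (r - t) Xd) $ i = - ((r - t) * ?\<beta> xd Xd $ i)"
        using i by (simp add: dims del: dim_mult_mat_vec index_mult_mat_vec)
      moreover have "\<bar>?\<beta> (x r - x t - (r - t) \<cdot>\<^sub>v xd) (X_remainder (X r) (X t) (r - t) Xd) $ i\<bar>
          \<le> C * (vnorm (x r - x t - (r - t) \<cdot>\<^sub>v xd) + X_norm P (X_remainder (X r) (X t) (r - t) Xd))"
        using s1 s2 d i X_remainder(1) by (intro bd) auto
      ultimately have "(r - t) * \<bar>?\<beta> xd Xd $ i\<bar> \<le> C * (vnorm (x r - x t - (r - t) \<cdot>\<^sub>v xd) + X_norm P (X_remainder (X r) (X t) (r - t) Xd))"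
        using h by (simp add: abs_mult del: index_mult_mat_vec index_minus_vec)
      also have "\<dots> = (r - t) * \<Phi> r"
      proof -
        have "C * (A + B) = k * (C * (A / \<bar>k\<bar> + B / \<bar>k\<bar>))" if "k > 0" for A B k :: real
          using that by (simp add: field_simps)
        from this[OF h] show ?thesis unfolding \<Phi>_def .
      qed
      finally have "\<bar>?\<beta> xd Xd $ i\<bar> \<le> \<Phi> r" using h by simp
      also have "\<dots> \<le> \<epsilon>" using \<delta>(2)[of r] r r0 by (simp add: dist_real_def)
      finally show ?thesis by simp
    qed
    then have "\<bar>?\<beta> xd Xd $ i\<bar> \<le> 0" by (rule field_le_epsilon)
    then show ?thesis by linarith
  qed
  show ?thesis
  proof (rule eq_vecI)
    fix i assume "i < dim_vec (pBx P *\<^sub>v xd)"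
    then have "i < kr" by (simp only: dims)
    from zero[OF this] \<open>i < kr\<close> show "(pB P *\<^sub>v x_b P Xd) $ i = (pBx P *\<^sub>v xd) $ i"
      by (simp add: dims del: index_mult_mat_vec dim_mult_mat_vec)
  qed (simp only: dims)
qed

lemma fundamental_remainder:
  assumes "fundamental u X" "fundamental v Y" "fundamental d D"
  shows "fundamental (Z_remainder u v h d) (X_remainder X Y h D)"
proof -
  have Z: "u \<in> Z_space lo hi ko kp" "v \<in> Z_space lo hi ko kp" "d \<in> Z_space lo hi ko kp"
    and X: "X \<in> X_space P" "Y \<in> X_space P" "D \<in> X_space P"
    and B: "pB P *\<^sub>v x_b P X = pBx P *\<^sub>v fst u" "pB P *\<^sub>v x_b P Y = pBx P *\<^sub>v fst v" "pB P *\<^sub>v x_b P D = pBx P *\<^sub>v fst d"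
    and ae: "AE s in lebesgue_on I. snd u s = stackD X s" "AE s in lebesgue_on I. snd v s = stackD Y s"
      "AE s in lebesgue_on I. snd d s = stackD D s"
    using assms by (auto simp: fundamental_def)
  note x = Z_spaceD(1)[OF Z(1)] Z_spaceD(1)[OF Z(2)] Z_spaceD(1)[OF Z(3)]
  have e: "fst (Z_remainder u v h d) = fst u - fst v - h \<cdot>\<^sub>v fst d"
    "snd (Z_remainder u v h d) = (\<lambda>s. snd u s - snd v s - h \<cdot>\<^sub>v snd d s)"
    by (simp_all add: Z_remainder_def Z_sub_def Z_scale_def)
  have "(\<lambda>s. (snd u s - snd v s - h \<cdot>\<^sub>v snd d s) $ i) \<in> L2 I" if i: "i < kp" for i
  proof -
    have "(\<lambda>s. 1 * (1 * snd u s $ i + (- 1) * snd v s $ i) + (- h) * snd d s $ i) \<in> L2 I"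
      by (intro L2_lincomb fundamental_L2[OF Z(1) i] fundamental_L2[OF Z(2) i] fundamental_L2[OF Z(3) i])
    moreover have "(snd u s - snd v s - h \<cdot>\<^sub>v snd d s) $ i = 1 * (1 * snd u s $ i + (- 1) * snd v s $ i) + (- h) * snd d s $ i"
      if "s \<in> I" for s
      using Z_spaceD(4)[OF Z(1) that] Z_spaceD(4)[OF Z(2) that] Z_spaceD(4)[OF Z(3) that] i by simp
    ultimately show ?thesis by (subst L2_cong) auto
  qed
  then have "Z_remainder u v h d \<in> Z_space lo hi ko kp"
    using x Z_spaceD(4)[OF Z(3)] unfolding Z_space_def mem_Times_iff e L2v_def
    by (auto intro!: carrier_vecI)
  moreover have "AE s in lebesgue_on I. snd (Z_remainder u v h d) s = stackD (X_remainder X Y h D) s"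
    unfolding e using ae X_remainder(2)[OF X, where h = h] by eventually_elim simp
  moreover have "pB P *\<^sub>v x_b P (X_remainder X Y h D) = pBx P *\<^sub>v fst (Z_remainder u v h d)"
  proof -
    have xb: "x_b P Z \<in> carrier_vec (2 * kr)" for Z by (rule carrier_vecI[OF x_b_dim])
    have dims: "dim_vec (pB P *\<^sub>v p) = kr" "dim_vec (pBx P *\<^sub>v q) = kr" for p q
      using param_carriers(3,4) by auto
    have "pB P *\<^sub>v x_b P (X_remainder X Y h D) - pBx P *\<^sub>v fst (Z_remainder u v h d) = 0\<^sub>v kr"
      unfolding e boundary_remainder[OF X x] B
      by (intro eq_vecI) (simp_all add: dims del: index_mult_mat_vec dim_mult_mat_vec)
    then show ?thesis
      using vec_diff_add_cancel[OF carrier_vecI[OF dims(1)] carrier_vecI[OF dims(2)]]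
      by (metis carrier_vecI dims(2) left_zero_vec)
  qed
  ultimately show ?thesis
    unfolding fundamental_def using X_remainder(1)[OF X] by blast
qed

lemma X_zero_facts:
  shows "X_zero P \<in> X_space P" "AE s in lebesgue_on I. stackD (X_zero P) s = 0\<^sub>v kp"
    "pB P *\<^sub>v x_b P (X_zero P) = pBx P *\<^sub>v 0\<^sub>v ko"
proof -
  note z = W2_zero[OF lo_less_hi]
  have lh: "lo \<in> I" "hi \<in> I" using lo_less_hi by auto
  show "X_zero P \<in> X_space P"
    using z(1,2) L2_const[of 0 lo hi]
    by (simp add: X_zero_def X_space_def L2v_def W2v_def del: W2.simps One_nat_def)
  show "AE s in lebesgue_on I. stackD (X_zero P) s = 0\<^sub>v kp"
    using z(3,4)
  proof eventually_elim
    case (elim s)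
    have "pds lo hi k2 (\<lambda>s. 0\<^sub>v k2) s = 0\<^sub>v k2" "(pds lo hi k3 ^^ 2) (\<lambda>s. 0\<^sub>v k3) s = 0\<^sub>v k3"
      using elim by (intro eq_vecI; simp)+
    then show ?case unfolding X_zero_def stackD.simps by (intro eq_vecI) (auto simp: kp_eq)
  qed
  have "x_c P (X_zero P) c = 0\<^sub>v kr" if "c \<in> I" for c
    unfolding X_zero_def using z(5,6)[OF that] by (intro eq_vecI) (auto simp: kr_eq)
  then have "x_b P (X_zero P) = 0\<^sub>v (2 * kr)"
    using lh unfolding x_b_def by (intro eq_vecI) auto
  then show "pB P *\<^sub>v x_b P (X_zero P) = pBx P *\<^sub>v 0\<^sub>v ko"
    using param_carriers(3,4) by (intro eq_vecI) (auto simp: scalar_prod_def)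
qed

lemma pie_to_odepde:
  assumes w: "\<And>t. 0 \<le> t \<Longrightarrow> w t \<in> carrier_vec (nu P)"
    and sol: "pie_solution lo hi ko kp (nz P) (T_op P) (A_op P) (B_op P) (C_op P) (D_op P) w (Z_zero ko kp) v z"
  shows "odepde_solution P w (0\<^sub>v ko) (X_zero P) (\<lambda>t. fst (v t)) (\<lambda>t. unstack (G_op P (v t))) z"
proof -
  let ?X = "\<lambda>u. unstack (G_op P u)"
  have v: "v t \<in> Z_space lo hi ko kp" and z: "z t \<in> carrier_vec (nz P)" if "0 \<le> t" for t
    using sol that by (auto simp: pie_solution_def)
  have v0: "Z_eq lo hi (v 0) (Z_zero ko kp)"
    and eqs: "AE t in lebesgue_on {0..}. \<exists>d \<in> Z_space lo hi ko kp.
        has_frechet_at (Z_norm lo hi) Z_sub Z_scale v d t \<and>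
        Z_eq lo hi (T_op P d) (Z_add (A_op P (v t)) (B_op P (w t))) \<and>
        z t = C_op P (v t) + D_op P (w t)"
    using sol by (auto simp: pie_solution_def)
  note f = fundamental_unstack[OF v]
  have dom: "(fst (v t), ?X (v t)) \<in> odepde_domain P" if "0 \<le> t" for t
    using f[OF that] Z_spaceD(1)[OF v[OF that]] by (simp add: odepde_domain_def fundamental_def)
  obtain C where C: "C \<ge> 0" "\<And>u X. fundamental u X \<Longrightarrow> X_norm P X \<le> C * Z_norm lo hi u"
    using X_norm_le_Z_norm by blast
  have "fundamental (v 0) (X_zero P)"
    unfolding fundamental_def
  proof (intro conjI)
    show "AE s in lebesgue_on I. snd (v 0) s = stackD (X_zero P) s"
      using v0 X_zero_facts(2) unfolding Z_eq_def Z_zero_def by auto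
    show "pB P *\<^sub>v x_b P (X_zero P) = pBx P *\<^sub>v fst (v 0)"
      using v0 X_zero_facts(3) by (simp add: Z_eq_def Z_zero_def)
  qed (use v[of 0] X_zero_facts(1) in simp_all)
  from fundamental_AE(1)[OF this] fundamental_AE(1)[OF f[of 0]]
  have init: "X_eq P (?X (v 0)) (X_zero P)"
    unfolding X_eq_def by auto
  have "AE t in lebesgue_on {0..}. \<exists>xd \<in> carrier_vec ko. \<exists>Xd \<in> X_space P.
        has_frechet_at vnorm (-) (\<cdot>\<^sub>v) (\<lambda>t. fst (v t)) xd t \<and>
        has_frechet_at (X_norm P) X_sub X_scale (\<lambda>t. ?X (v t)) Xd t \<and>
        odepde_equations P (w t) (fst (v t)) (?X (v t)) (z t) xd Xd"
    using eqs AE_lebesgue_on_space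
  proof eventually_elim
    case (elim t)
    then have t: "0 \<le> t" by simp
    from elim(1) obtain d where d: "d \<in> Z_space lo hi ko kp"
      and fd: "has_frechet_at (Z_norm lo hi) Z_sub Z_scale v d t"
      and e: "Z_eq lo hi (T_op P d) (Z_add (A_op P (v t)) (B_op P (w t)))" "z t = C_op P (v t) + D_op P (w t)"
      by blast
    note fr = fundamental_remainder[OF f f[OF t] fundamental_unstack[OF d]]
    have 1: "has_frechet_at vnorm (-) (\<cdot>\<^sub>v) (\<lambda>t. fst (v t)) (fst d) t"
    proof (rule has_frechet_at_mono[OF fd, where C = 1])
      fix r :: real assume "0 \<le> r"
      from fr[OF this, of "r - t"] have "Z_remainder (v r) (v t) (r - t) d \<in> Z_space lo hi ko kp"
        by (simp add: fundamental_def)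
      from Z_norm_bounds(1)[OF this] vnorm_nonneg
      show "0 \<le> vnorm (fst (v r) - fst (v t) - (r - t) \<cdot>\<^sub>v fst d) \<and>
        vnorm (fst (v r) - fst (v t) - (r - t) \<cdot>\<^sub>v fst d) \<le> 1 * Z_norm lo hi (Z_sub (Z_sub (v r) (v t)) (Z_scale (r - t) d))"
        by (simp add: Z_remainder_def Z_sub_def Z_scale_def)
    qed
    have 2: "has_frechet_at (X_norm P) X_sub X_scale (\<lambda>t. ?X (v t)) (?X d) t"
    proof (rule has_frechet_at_mono[OF fd, where C = C])
      fix r :: real assume "0 \<le> r"
      from fr[OF this, of "r - t"]
      have F: "fundamental (Z_remainder (v r) (v t) (r - t) d) (X_remainder (?X (v r)) (?X (v t)) (r - t) (?X d))" .
      then show "0 \<le> X_norm P (X_sub (X_sub (?X (v r)) (?X (v t))) (X_scale (r - t) (?X d))) \<and>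
        X_norm P (X_sub (X_sub (?X (v r)) (?X (v t))) (X_scale (r - t) (?X d))) \<le> C * Z_norm lo hi (Z_sub (Z_sub (v r) (v t)) (Z_scale (r - t) d))"
        using C(2)[OF F] X_norm_nonneg unfolding X_remainder_def Z_remainder_def fundamental_def by blast
    qed
    have 3: "odepde_equations P (w t) (fst (v t)) (?X (v t)) (z t) (fst d) (?X d)"
      using equations_iff[OF f[OF t] fundamental_unstack[OF d] w[OF t]] e by blast
    show ?case
      using 1 2 3 Z_spaceD(1)[OF d] fundamental_unstack[OF d] unfolding fundamental_def by blast
  qed
  moreover have "AE t in lebesgue_on {0..}. (fst (v t), ?X (v t)) \<in> odepde_domain P"
    using AE_lebesgue_on_space by eventually_elim (use dom in simp)
  moreover have "fst (v t) \<in> carrier_vec ko \<and> ?X (v t) \<in> X_space P \<and> z t \<in> carrier_vec (nz P)" if "0 \<le> t" for t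
    using Z_spaceD(1)[OF v[OF that]] f[OF that] z[OF that] by (simp add: fundamental_def)
  ultimately show ?thesis
    unfolding odepde_solution_def using init v0 by (simp add: Z_eq_def Z_zero_def)
qed

lemma odepde_to_pie:
  assumes w: "\<And>t. 0 \<le> t \<Longrightarrow> w t \<in> carrier_vec (nu P)"
    and sol: "odepde_solution P w (0\<^sub>v ko) (X_zero P) x X z"
  shows "pie_solution lo hi ko kp (nz P) (T_op P) (A_op P) (B_op P) (C_op P) (D_op P) w (Z_zero ko kp)
    (\<lambda>t. (x t, stackD (X t))) z"
proof -
  have sp: "x t \<in> carrier_vec ko \<and> X t \<in> X_space P" and z: "z t \<in> carrier_vec (nz P)" if "0 \<le> t" for t
    using sol that by (auto simp: odepde_solution_def)
  have init: "x 0 = 0\<^sub>v ko" "X_eq P (X 0) (X_zero P)"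
    and dom: "AE t in lebesgue_on {0..}. (x t, X t) \<in> odepde_domain P"
    and eqs: "AE t in lebesgue_on {0..}. \<exists>xd \<in> carrier_vec ko. \<exists>Xd \<in> X_space P.
        has_frechet_at vnorm (-) (\<cdot>\<^sub>v) x xd t \<and> has_frechet_at (X_norm P) X_sub X_scale X Xd t \<and>
        odepde_equations P (w t) (x t) (X t) (z t) xd Xd"
    using sol by (auto simp: odepde_solution_def)
  have Zsp: "(e, stackD E) \<in> Z_space lo hi ko kp" if e: "e \<in> carrier_vec ko" and E: "E \<in> X_space P" for e E
  proof -
    obtain x1 x2 x3 where Ee: "E = (x1, x2, x3)" by (cases E)
    note E' = E[unfolded Ee]
    note p = pds_L2v[OF E']
    have "(\<lambda>s. x1 s @\<^sub>v pds lo hi k2 x2 s @\<^sub>v (pds lo hi k3 ^^ 2) x3 s) \<in> L2v I (k1 + (k2 + k3))"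
      by (intro L2v_append X_spaceD(1)[OF E'] p(2,5))
    moreover have "stackD E = (\<lambda>s. x1 s @\<^sub>v pds lo hi k2 x2 s @\<^sub>v (pds lo hi k3 ^^ 2) x3 s)"
      by (rule ext) (simp add: Ee)
    ultimately show ?thesis
      using e unfolding Z_space_def by (simp add: kp_eq add.assoc)
  qed
  have fund: "fundamental (e, stackD E) E"
    if "e \<in> carrier_vec ko" "E \<in> X_space P" "pB P *\<^sub>v x_b P E = pBx P *\<^sub>v e" for e E
    using that Zsp by (simp add: fundamental_def)
  have bc: "AE t in lebesgue_on {0..}. pB P *\<^sub>v x_b P (X t) = pBx P *\<^sub>v x t"
    using dom by eventually_elim (simp add: odepde_domain_def)
  (* the boundary condition may fail at t = 0, so the map from fundamental states is not available here *)
  have v0: "Z_eq lo hi (x 0, stackD (X 0)) (Z_zero ko kp)"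
  proof -
    obtain x1 x2 x3 where Xe: "X 0 = (x1, x2, x3)" by (cases "X 0")
    have X': "(x1, x2, x3) \<in> X_space P" using sp[of 0] by (simp add: Xe)
    note z = W2_zero[OF lo_less_hi]
    have ae: "AE s in lebesgue_on I. x1 s @\<^sub>v x2 s @\<^sub>v x3 s = 0\<^sub>v k1 @\<^sub>v 0\<^sub>v k2 @\<^sub>v 0\<^sub>v k3"
      using init(2) by (simp add: X_eq_def Xe X_zero_def)
    have comp: "AE s in lebesgue_on I. x1 s = 0\<^sub>v k1 \<and> x2 s = 0\<^sub>v k2 \<and> x3 s = 0\<^sub>v k3"
      using ae AE_lebesgue_on_space
    proof eventually_elim
      case (elim s)
      note d = X_spaceD(2-4)[OF X' elim(2), THEN carrier_vecI]
      from elim(1) show ?case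
        by (simp add: append_vec_eq[OF d(1) zero_carrier_vec] append_vec_eq[OF d(2) zero_carrier_vec])
    qed
    have 2: "AE s in lebesgue_on I. wd (\<lambda>s. x2 s $ i) s = 0" if i: "i < k2" for i
    proof -
      have "AE s in lebesgue_on I. 0 = x2 s $ i" using comp by eventually_elim (simp add: i)
      from W2_1_AE_cong(2)[OF lo_less_hi z(1) this] z(3) show ?thesis by eventually_elim simp
    qed
    have 3: "AE s in lebesgue_on I. wd (wd (\<lambda>s. x3 s $ i)) s = 0" if i: "i < k3" for i
    proof -
      have "AE s in lebesgue_on I. 0 = x3 s $ i" using comp by eventually_elim (simp add: i)
      from W2_1_AE_cong(2)[OF lo_less_hi z(1) this] z(3)
      have "AE s in lebesgue_on I. 0 = wd (\<lambda>s. x3 s $ i) s" by eventually_elim simp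
      from W2_1_AE_cong(2)[OF lo_less_hi z(1) this] z(3) show ?thesis by eventually_elim simp
    qed
    have "AE s in lebesgue_on I. \<forall>i<k2. wd (\<lambda>s. x2 s $ i) s = 0" "AE s in lebesgue_on I. \<forall>i<k3. wd (wd (\<lambda>s. x3 s $ i)) s = 0"
      by (intro AE_finite_all_less 2 3; assumption)+
    with comp have "AE s in lebesgue_on I. stackD (X 0) s = 0\<^sub>v kp"
    proof eventually_elim
      case (elim s)
      then show ?case unfolding Xe by (intro eq_vecI) (auto simp: kp_eq)
    qed
    then show ?thesis using init(1) by (simp add: Z_eq_def Z_zero_def)
  qed
  have "AE t in lebesgue_on {0..}. \<exists>d \<in> Z_space lo hi ko kp.
        has_frechet_at (Z_norm lo hi) Z_sub Z_scale (\<lambda>t. (x t, stackD (X t))) d t \<and>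
        Z_eq lo hi (T_op P d) (Z_add (A_op P (x t, stackD (X t))) (B_op P (w t))) \<and>
        z t = C_op P (x t, stackD (X t)) + D_op P (w t)"
    using eqs bc AE_lebesgue_on_space
  proof eventually_elim
    case (elim t)
    then have t: "0 \<le> t" by simp
    from elim(1) obtain xd Xd where d: "xd \<in> carrier_vec ko" "Xd \<in> X_space P"
      and fx: "has_frechet_at vnorm (-) (\<cdot>\<^sub>v) x xd t" and fX: "has_frechet_at (X_norm P) X_sub X_scale X Xd t"
      and e: "odepde_equations P (w t) (x t) (X t) (z t) xd Xd"
      by blast
    have Bd: "pB P *\<^sub>v x_b P Xd = pBx P *\<^sub>v xd"
      by (rule boundary_derivative[OF sp bc t elim(2) d fx fX])
    note fd = fund[OF d Bd] and fu = fund[OF conjunct1[OF sp[OF t]] conjunct2[OF sp[OF t]] elim(2)]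
    have eq: "Z_eq lo hi (T_op P (xd, stackD Xd)) (Z_add (A_op P (x t, stackD (X t))) (B_op P (w t))) \<and>
        z t = C_op P (x t, stackD (X t)) + D_op P (w t)"
      using equations_iff[OF fu fd w[OF t]] e by simp
    have "has_frechet_at (Z_norm lo hi) Z_sub Z_scale (\<lambda>t. (x t, stackD (X t))) (xd, stackD Xd) t"
      unfolding has_frechet_at_def
    proof (rule real_tendsto_sandwich)
      let ?e = "\<lambda>r. Z_sub (Z_sub (x r, stackD (X r)) (x t, stackD (X t))) (Z_scale (r - t) (xd, stackD Xd))"
      let ?E = "\<lambda>r. X_sub (X_sub (X r) (X t)) (X_scale (r - t) Xd)"
      have bd: "0 \<le> Z_norm lo hi (?e r) \<and> Z_norm lo hi (?e r) \<le> vnorm (x r - x t - (r - t) \<cdot>\<^sub>v xd) + X_norm P (?E r)"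
        if r: "0 \<le> r" for r
      proof -
        note s1 = sp[OF r] and s2 = sp[OF t]
        note R = X_remainder[OF conjunct2[OF s1] conjunct2[OF s2] d(2), of "r - t", unfolded X_remainder_def]
        have st: "stackD E s \<in> carrier_vec kp" if "E \<in> X_space P" "s \<in> I" for E s
          using Z_spaceD(3)[OF Zsp[OF d(1) that(1)] that(2)] by simp
        have snd: "snd (?e r) = (\<lambda>s. stackD (X r) s - stackD (X t) s - (r - t) \<cdot>\<^sub>v stackD Xd s)"
          and fst: "fst (?e r) = x r - x t - (r - t) \<cdot>\<^sub>v xd"
          by (simp_all add: Z_sub_def Z_scale_def)
        have ae: "AE s in lebesgue_on I. snd (?e r) s = stackD (?E r) s"
          unfolding snd using R(2) by eventually_elim simp
        have "x r - x t - (r - t) \<cdot>\<^sub>v xd \<in> carrier_vec ko" using s1 s2 d by auto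
        note zE = Zsp[OF this R(1)]
        have "?e r \<in> Z_space lo hi ko kp"
        proof -
          have "(\<lambda>s. snd (?e r) s $ i) \<in> L2 I" if "i < kp" for i
          proof (rule L2_AE_cong[OF fundamental_L2[OF zE that]])
            show "AE s in lebesgue_on I. snd (x r - x t - (r - t) \<cdot>\<^sub>v xd, stackD (?E r)) s $ i = snd (?e r) s $ i"
              using ae by eventually_elim simp
          qed
          moreover have "snd (?e r) s \<in> carrier_vec kp" if "s \<in> I" for s
            unfolding snd using st[OF d(2) that] by (auto intro: carrier_vecI)
          moreover have "fst (?e r) \<in> carrier_vec ko" unfolding fst using s1 s2 d by auto
          ultimately show ?thesis unfolding Z_space_def mem_Times_iff L2v_def by blast
        qed
        from Z_norm_le_X_norm[OF this R(1) ae] Z_norm_bounds(4)[OF this] show ?thesis by (simp only: fst)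
      qed
      have ev: "\<forall>\<^sub>F r in at t within {0..}. r \<in> {0..}"
        by (auto simp: eventually_at_filter)
      show "\<forall>\<^sub>F r in at t within {0..}. 0 \<le> Z_norm lo hi (?e r) / \<bar>r - t\<bar>"
        using ev by eventually_elim (use bd in \<open>auto intro!: divide_nonneg_nonneg\<close>)
      show "\<forall>\<^sub>F r in at t within {0..}. Z_norm lo hi (?e r) / \<bar>r - t\<bar>
          \<le> vnorm (x r - x t - (r - t) \<cdot>\<^sub>v xd) / \<bar>r - t\<bar> + X_norm P (?E r) / \<bar>r - t\<bar>"
        using ev
      proof eventually_elim
        case (elim r)
        then have "0 \<le> r" by simp
        from divide_right_mono[OF conjunct2[OF bd[OF this]], of "\<bar>r - t\<bar>"] show ?case
          by (simp add: add_divide_distrib)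
      qed
      show "((\<lambda>r. vnorm (x r - x t - (r - t) \<cdot>\<^sub>v xd) / \<bar>r - t\<bar> + X_norm P (?E r) / \<bar>r - t\<bar>) \<longlongrightarrow> 0) (at t within {0..})"
        using tendsto_add[OF fx[unfolded has_frechet_at_def] fX[unfolded has_frechet_at_def]] by simp
    qed simp
    with eq Zsp[OF d] show ?case by blast
  qed
  then show ?thesis
    unfolding pie_solution_def using v0 Zsp sp z by simp
qed

end

theorem lemma8:
  fixes P :: odepde and \<gamma> :: real
  assumes "odepde_params P" and "\<gamma> > 0"
  shows
    "(\<forall>w \<in> L2v {0..} (nu P). \<forall>v z.
        pie_solution (pa P) (pb P) (no P) (np P) (nz P)
          (T_op P) (A_op P) (B_op P) (C_op P) (D_op P) w (Z_zero (no P) (np P)) v z \<longrightarrow>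
        z \<in> L2v {0..} (nz P) \<and> L2_norm {0..} z \<le> \<gamma> * L2_norm {0..} w)
     \<longleftrightarrow>
     (\<forall>w \<in> L2v {0..} (nu P). \<forall>x X z.
        odepde_solution P w (0\<^sub>v (no P)) (X_zero P) x X z \<longrightarrow>
        z \<in> L2v {0..} (nz P) \<and> L2_norm {0..} z \<le> \<gamma> * L2_norm {0..} w)"
proof -
  interpret ode_pde P by (rule ode_pde.intro[OF assms(1)])
  have w: "w t \<in> carrier_vec (nu P)" if "w \<in> L2v {0..} (nu P)" "0 \<le> t" for w t
    using that by (auto simp: L2v_def)
  show ?thesis
    using pie_to_odepde odepde_to_pie w by meson
qed

end
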